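(* Let $k$ be an algebraically closed field and let $E_i^m$ ($1\le i\le 8$, $m\ge0$), $F_\pm$, $G_\pm$ be the exceptional representations of the quiver $Q_2$ described in the context. Write $[X,Y]=(\hom(X,Y),\hom^1(X,Y))$. The dimensions for pairs of (distinct) exceptional objects of $Rep_k(Q_2)$ are as follows ($m,n\ge0$ throughout). (1) For $i\in\{1,4,6,7\}$ and $n<m$: $[E_i^m,E_i^n]=(1+m-n,0)$, $[E_i^n,E_i^m]=(0,m-n-1)$. For $i\in\{2,3,5,8\}$ and $m<n$: $[E_i^m,E_i^n]=(1+n-m,0)$, $[E_i^n,E_i^m]=(0,n-m-1)$. (2) For all $m,n$: $[E_1^m,E_2^n]=(0,2+n+m)$, $[E_2^n,E_1^m]=(m+n,0)$; $[E_1^m,E_3^n]=(0,n+m)$, $[E_3^n,E_1^m]=(m+n,0)$; $[E_1^m,E_5^n]=(0,n+m+1)$, $[E_5^n,E_1^m]=(n+m,0)$; $[E_1^m,E_8^n]=(0,n+m+1)$, $[E_8^n,E_1^m]=(n+m,0)$; $[E_2^m,E_4^n]=(2+m+n,0)$, $[E_4^n,E_2^m]=(0,n+m+2)$; $[E_2^m,E_6^n]=(1+m+n,0)$, $[E_6^n,E_2^m]=(0,n+m+2)$; $[E_2^m,E_7^n]=(1+m+n,0)$, $[E_7^n,E_2^m]=(0,n+m+2)$; $[E_3^m,E_4^n]=(m+n,0)$, $[E_4^n,E_3^m]=(0,n+m+2)$; $[E_3^m,E_6^n]=(m+n,0)$, $[E_6^n,E_3^m]=(0,n+m+1)$; $[E_3^m,E_7^n]=(m+n,0)$,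 $[E_7^n,E_3^m]=(0,n+m+1)$; $[E_4^m,E_5^n]=(0,2+m+n)$, $[E_5^n,E_4^m]=(1+m+n,0)$; $[E_4^m,E_8^n]=(0,2+m+n)$, $[E_8^n,E_4^m]=(1+m+n,0)$; $[E_5^m,E_6^n]=(m+n,0)$, $[E_6^n,E_5^m]=(0,2+m+n)$; $[E_5^m,E_7^n]=(1+m+n,0)$, $[E_7^n,E_5^m]=(0,1+m+n)$; $[E_6^m,E_8^n]=(0,1+m+n)$, $[E_8^n,E_6^m]=(1+m+n,0)$; $[E_7^m,E_8^n]=(0,2+m+n)$, $[E_8^n,E_7^m]=(m+n,0)$. (3) $(E_1,E_4)$: if $n<m$, $[E_1^m,E_4^n]=(m-n-1,0)$, $[E_4^n,E_1^m]=(0,m-n-1)$; if $m\le n$, $[E_1^m,E_4^n]=(0,n-m+1)$, $[E_4^n,E_1^m]=(n-m+1,0)$. For $i\in\{6,7\}$: if $n<m$, $[E_1^m,E_i^n]=(m-n,0)$, $[E_i^n,E_1^m]=(0,m-n-1)$; if $m\le n$, $[E_1^m,E_i^n]=(0,n-m)$, $[E_i^n,E_1^m]=(n-m+1,0)$. $(E_2,E_3)$: if $n\le m$, $[E_2^m,E_3^n]=(0,m-n+1)$, $[E_3^n,E_2^m]=(m-n+1,0)$; if $m<n$, $[E_2^m,E_3^n]=(n-m-1,0)$, $[E_3^n,E_2^m]=(0,n-m-1)$. For $i\in\{5,8\}$: if $m<n$, $[E_2^m,E_i^n]=(n-m,0)$, $[E_i^n,E_2^m]=(0,n-m-1)$;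 if $n\le m$, $[E_2^m,E_i^n]=(0,m-n)$, $[E_i^n,E_2^m]=(m-n+1,0)$. For $i\in\{5,8\}$: if $m\le n$, $[E_3^m,E_i^n]=(n-m+1,0)$, $[E_i^n,E_3^m]=(0,n-m)$; if $n<m$, $[E_3^m,E_i^n]=(0,m-n-1)$, $[E_i^n,E_3^m]=(m-n,0)$. For $i\in\{6,7\}$: if $m<n$, $[E_4^m,E_i^n]=(0,n-m-1)$, $[E_i^n,E_4^m]=(n-m,0)$; if $n\le m$, $[E_4^m,E_i^n]=(1+m-n,0)$, $[E_i^n,E_4^m]=(0,m-n)$. $(E_5,E_8)$: if $m\le n$, $[E_5^m,E_8^n]=(n-m,0)$, $[E_8^n,E_5^m]=(0,n-m)$; if $n\le m$, $[E_5^m,E_8^n]=(0,m-n)$, $[E_8^n,E_5^m]=(m-n,0)$. $(E_6,E_7)$: if $n\le m$, $[E_6^m,E_7^n]=(m-n,0)$, $[E_7^n,E_6^m]=(0,m-n)$; if $m\le n$, $[E_6^m,E_7^n]=(0,n-m)$, $[E_7^n,E_6^m]=(n-m,0)$. (4) For all $m$ and each sign: $[F_\pm,E_1^m]=(0,0)$, $[E_1^m,F_\pm]=(0,1)$; $[F_\pm,E_2^m]=(0,0)$, $[E_2^m,F_\pm]=(1,0)$; $[F_\pm,E_3^m]=(0,1)$, $[E_3^m,F_\pm]=(0,0)$; $[F_\pm,E_4^m]=(1,0)$, $[E_4^m,F_\pm]=(0,0)$; $[F_+,E_5^m]=(0,1)$, $[E_5^m,F_+]=(0,0)$; $[F_-,E_5^m]=(0,0)$,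 $[E_5^m,F_-]=(1,0)$; $[F_+,E_6^m]=(1,0)$, $[E_6^m,F_+]=(0,0)$; $[F_-,E_6^m]=(0,0)$, $[E_6^m,F_-]=(0,1)$; $[F_+,E_7^m]=(0,0)$, $[E_7^m,F_+]=(0,1)$; $[F_-,E_7^m]=(1,0)$, $[E_7^m,F_-]=(0,0)$; $[F_+,E_8^m]=(0,0)$, $[E_8^m,F_+]=(1,0)$; $[F_-,E_8^m]=(0,1)$, $[E_8^m,F_-]=(0,0)$; $[G_\pm,E_1^m]=(1,0)$, $[E_1^m,G_\pm]=(0,0)$; $[G_\pm,E_2^m]=(0,1)$, $[E_2^m,G_\pm]=(0,0)$; $[G_\pm,E_3^m]=(0,0)$, $[E_3^m,G_\pm]=(1,0)$; $[G_\pm,E_4^m]=(0,0)$, $[E_4^m,G_\pm]=(0,1)$; $[G_+,E_5^m]=(0,1)$, $[E_5^m,G_+]=(0,0)$; $[G_-,E_5^m]=(0,0)$, $[E_5^m,G_-]=(1,0)$; $[G_+,E_6^m]=(1,0)$, $[E_6^m,G_+]=(0,0)$; $[G_-,E_6^m]=(0,0)$, $[E_6^m,G_-]=(0,1)$; $[G_+,E_7^m]=(0,0)$, $[E_7^m,G_+]=(0,1)$; $[G_-,E_7^m]=(1,0)$, $[E_7^m,G_-]=(0,0)$; $[G_+,E_8^m]=(0,0)$, $[E_8^m,G_+]=(1,0)$; $[G_-,E_8^m]=(0,1)$, $[E_8^m,G_-]=(0,0)$. (5) $[F_+,G_-]=[G_-,F_+]=[F_-,G_+]=[G_+,F_-]=(0,1)$,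 and $[F_+,F_-]=[F_-,F_+]=[F_+,G_+]=[G_+,F_+]=[F_-,G_-]=[G_-,F_-]=[G_+,G_-]=[G_-,G_+]=(0,0)$.
   Context: $Q_2$ is the quiver with vertices $b,+,-,e$ and arrows $b\to +$, $+\to e$, $b\to -$, $-\to e$ (no relations); $Rep_k(Q_2)$ is its category of finite-dimensional $k$-representations; $\hom=\dim_k\mathrm{Hom}$, $\hom^1=\dim_k\mathrm{Ext}^1$. A representation is given by spaces $(V_b,V_-,V_+,V_e)$ and maps $(V_b\to V_+, V_+\to V_e, V_b\to V_-, V_-\to V_e)$. The exceptional objects up to isomorphism are ($m\ge0$): $E_1^m$: $(k^{m+1},k^m,k^m,k^m)$, $(\pi_+^m,\mathrm{Id},\pi_-^m,\mathrm{Id})$; $E_2^m$: $(k^{m},k^{m+1},k^{m+1},k^{m+1})$, $(j_+^m,\mathrm{Id},j_-^m,\mathrm{Id})$; $E_3^m$: $(k^{m},k^{m},k^{m},k^{m+1})$, $(\mathrm{Id},j_+^m,\mathrm{Id},j_-^m)$; $E_4^m$: $(k^{m+1},k^{m+1},k^{m+1},k^{m})$, $(\mathrm{Id},\pi_+^m,\mathrm{Id},\pi_-^m)$; $E_5^m$: $(k^{m},k^{m+1},k^{m},k^{m+1})$, $(\mathrm{Id},j_+^m,j_-^m,\mathrm{Id})$; $E_6^m$: $(k^{m+1},k^{m},k^{m+1},k^{m})$, $(\mathrm{Id},\pi_+^m,\pi_-^m,\mathrm{Id})$; $E_7^m$: $(k^{m+1},k^{m+1},k^{m},k^{m})$, $(\pi_+^m,\mathrm{Id},\mathrm{Id},\pi_-^m)$;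 $E_8^m$: $(k^{m},k^{m},k^{m+1},k^{m+1})$, $(j_+^m,\mathrm{Id},\mathrm{Id},j_-^m)$; $F_+$: $(0,0,k,0)$ and $F_-$: $(0,k,0,0)$, zero maps; $G_+$: $(k,0,k,k)$, $(\mathrm{Id},\mathrm{Id},0,0)$; $G_-$: $(k,k,0,k)$, $(0,0,\mathrm{Id},\mathrm{Id})$. Here $\pi_+^m(a_1,\dots,a_{m+1})=(a_1,\dots,a_m)$, $\pi_-^m(a_1,\dots,a_{m+1})=(a_2,\dots,a_{m+1})$, $j_+^m(a_1,\dots,a_m)=(a_1,\dots,a_m,0)$, $j_-^m(a_1,\dots,a_m)=(0,a_1,\dots,a_m)$ (zero maps for $m=0$). *)

theory Defs
  imports "Jordan_Normal_Form.VS_Connect"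
begin

datatype vertex = Vb | Vminus | Vplus | Ve

datatype arrow = b_to_plus | plus_to_e | b_to_minus | minus_to_e

fun source :: "arrow \<Rightarrow> vertex" where
  "source b_to_plus = Vb"
| "source plus_to_e = Vplus"
| "source b_to_minus = Vb"
| "source minus_to_e = Vminus"

fun target :: "arrow \<Rightarrow> vertex" where
  "target b_to_plus = Vplus"
| "target plus_to_e = Ve"
| "target b_to_minus = Vminus"
| "target minus_to_e = Ve"

text \<open>
  The field \<open>k\<close> is a type \<open>'k\<close>, seen as a ring record through \<^const>\<open>class_ring\<close>; the space at a
  vertex is an arbitrary module record with elements in \<open>'v\<close>. Only the values of the arrow maps on
  the carriers matter.
\<close>

record ('k, 'v) rep =
  space_at :: "vertex \<Rightarrow> ('k, 'v) module"
  map_at :: "arrow \<Rightarrow> 'v \<Rightarrow> 'v"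

definition is_rep :: "('k::field, 'v) rep \<Rightarrow> bool" where
  "is_rep V \<longleftrightarrow>
     (\<forall>v. vectorspace class_ring (space_at V v) \<and> vectorspace.fin_dim class_ring (space_at V v)) \<and>
     (\<forall>a. map_at V a \<in>
        LinearCombinations.module_hom class_ring (space_at V (source a)) (space_at V (target a)))"

text \<open>
  Morphisms are extensional (\<^const>\<open>undefined\<close> off the carriers), so that equal morphisms are equal
  as HOL functions.
\<close>

definition rep_hom :: "('k::field, 'v) rep \<Rightarrow> ('k, 'w) rep \<Rightarrow> (vertex \<Rightarrow> 'v \<Rightarrow> 'w) set" where
  "rep_hom V W = {f.
     (\<forall>v. f v \<in> LinearCombinations.module_hom class_ring (space_at V v) (space_at W v) \<inter>
               extensional (carrier (space_at V v))) \<and>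
     (\<forall>a. \<forall>x \<in> carrier (space_at V (source a)).
        f (target a) (map_at V a x) = map_at W a (f (source a) x))}"

definition hom_space :: "('k::field, 'v) rep \<Rightarrow> ('k, 'w) rep \<Rightarrow> ('k, vertex \<Rightarrow> 'v \<Rightarrow> 'w) module" where
  "hom_space V W = \<lparr>
     carrier = rep_hom V W,
     mult = undefined,
     one = undefined,
     zero = (\<lambda>v. \<lambda>x \<in> carrier (space_at V v). \<zero>\<^bsub>space_at W v\<^esub>),
     add = (\<lambda>f g v. \<lambda>x \<in> carrier (space_at V v). f v x \<oplus>\<^bsub>space_at W v\<^esub> g v x),
     smult = (\<lambda>c f v. \<lambda>x \<in> carrier (space_at V v). c \<odot>\<^bsub>space_at W v\<^esub> f v x)\<rparr>"

definition hom_dim :: "('k::field, 'v) rep \<Rightarrow> ('k, 'w) rep \<Rightarrow> nat" where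
  "hom_dim V W = vectorspace.dim class_ring (hom_space V W)"

text \<open>
  The middle term of an extension must live in some fixed type. The carrier of every \<open>k\<^sup>n\<close> lies in
  \<open>'k vec\<close>, so every finite-dimensional representation is isomorphic to one over \<open>'k vec\<close>, and
  nothing is lost by taking all representations from there.
\<close>

type_synonym 'k vrep = "('k, 'k vec) rep"

record 'k extension =
  middle :: "'k vrep"
  inc :: "vertex \<Rightarrow> 'k vec \<Rightarrow> 'k vec"
  prj :: "vertex \<Rightarrow> 'k vec \<Rightarrow> 'k vec"

text \<open>Short exact sequences \<open>0 \<rightarrow> Y \<rightarrow> M \<rightarrow> X \<rightarrow> 0\<close>.\<close>

definition extensions :: "('k::field) vrep \<Rightarrow> 'k vrep \<Rightarrow> 'k extension set" where
  "extensions X Y = {S.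
     is_rep (middle S) \<and> inc S \<in> rep_hom Y (middle S) \<and> prj S \<in> rep_hom (middle S) X \<and>
     (\<forall>v. inj_on (inc S v) (carrier (space_at Y v)) \<and>
          prj S v ` carrier (space_at (middle S) v) = carrier (space_at X v) \<and>
          inc S v ` carrier (space_at Y v) =
            {m \<in> carrier (space_at (middle S) v). prj S v m = \<zero>\<^bsub>space_at X v\<^esub>})}"

definition ext_equiv :: "('k::field) vrep \<Rightarrow> 'k vrep \<Rightarrow> ('k extension \<times> 'k extension) set" where
  "ext_equiv X Y = {(S, T). S \<in> extensions X Y \<and> T \<in> extensions X Y \<and>
     (\<exists>\<phi> \<in> rep_hom (middle S) (middle T). \<forall>v.
        bij_betw (\<phi> v) (carrier (space_at (middle S) v)) (carrier (space_at (middle T) v)) \<and>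
        (\<forall>y \<in> carrier (space_at Y v). \<phi> v (inc S v y) = inc T v y) \<and>
        (\<forall>m \<in> carrier (space_at (middle S) v). prj T v (\<phi> v m) = prj S v m))}"

definition fibre_product :: "('k::field) extension \<Rightarrow> 'k extension \<Rightarrow> ('k, 'k vec \<times> 'k vec) rep" where
  "fibre_product S T = \<lparr>
     space_at = (\<lambda>v. (direct_sum (space_at (middle S) v) (space_at (middle T) v))
       \<lparr>carrier := {(m, n). m \<in> carrier (space_at (middle S) v) \<and>
                            n \<in> carrier (space_at (middle T) v) \<and> prj S v m = prj T v n}\<rparr>),
     map_at = (\<lambda>a (m, n). (map_at (middle S) a m, map_at (middle T) a n))\<rparr>"

text \<open>
  \<open>U\<close> is a Baer sum of \<open>S\<close> and \<open>T\<close>: its middle term is, via \<open>\<sigma>\<close>, the quotient of the fibre product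
  of the middle terms over \<open>X\<close> by the antidiagonal copy \<open>{(y, -y)}\<close> of \<open>Y\<close>. The maps of \<open>U\<close> are
  \<open>y \<mapsto> [(y, 0)]\<close> and \<open>[(m, n)] \<mapsto>\<close> the common image of \<open>m\<close> and \<open>n\<close> in \<open>X\<close>.
\<close>

definition is_baer_sum ::
  "('k::field) vrep \<Rightarrow> 'k vrep \<Rightarrow> 'k extension \<Rightarrow> 'k extension \<Rightarrow> 'k extension \<Rightarrow> bool" where
  "is_baer_sum X Y S T U \<longleftrightarrow> U \<in> extensions X Y \<and>
     (\<exists>\<sigma> \<in> rep_hom (fibre_product S T) (middle U). \<forall>v.
        \<sigma> v ` carrier (space_at (fibre_product S T) v) = carrier (space_at (middle U) v) \<and>
        {z \<in> carrier (space_at (fibre_product S T) v). \<sigma> v z = \<zero>\<^bsub>space_at (middle U) v\<^esub>} =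
          (\<lambda>y. (inc S v y, inc T v (\<ominus>\<^bsub>space_at Y v\<^esub> y))) ` carrier (space_at Y v) \<and>
        (\<forall>y \<in> carrier (space_at Y v). \<sigma> v (inc S v y, \<zero>\<^bsub>space_at (middle T) v\<^esub>) = inc U v y) \<and>
        (\<forall>(m, n) \<in> carrier (space_at (fibre_product S T) v). prj U v (\<sigma> v (m, n)) = prj S v m))"

text \<open>
  \<open>T\<close> is the pushout of \<open>S\<close> along multiplication by \<open>c\<close> on \<open>Y\<close>. A morphism of short exact sequences
  that is the identity on \<open>X\<close> always has a pushout square on the left.
\<close>

definition is_scalar_multiple ::
  "('k::field) vrep \<Rightarrow> 'k vrep \<Rightarrow> 'k \<Rightarrow> 'k extension \<Rightarrow> 'k extension \<Rightarrow> bool" where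
  "is_scalar_multiple X Y c S T \<longleftrightarrow> T \<in> extensions X Y \<and>
     (\<exists>\<phi> \<in> rep_hom (middle S) (middle T). \<forall>v.
        (\<forall>y \<in> carrier (space_at Y v). \<phi> v (inc S v y) = inc T v (c \<odot>\<^bsub>space_at Y v\<^esub> y)) \<and>
        (\<forall>m \<in> carrier (space_at (middle S) v). prj T v (\<phi> v m) = prj S v m))"

definition is_split :: "('k::field) vrep \<Rightarrow> 'k vrep \<Rightarrow> 'k extension \<Rightarrow> bool" where
  "is_split X Y S \<longleftrightarrow> S \<in> extensions X Y \<and>
     (\<exists>s \<in> rep_hom X (middle S). \<forall>v. \<forall>x \<in> carrier (space_at X v). prj S v (s v x) = x)"

definition ext_space :: "('k::field) vrep \<Rightarrow> 'k vrep \<Rightarrow> ('k, 'k extension set) module" where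
  "ext_space X Y = \<lparr>
     carrier = extensions X Y // ext_equiv X Y,
     mult = undefined,
     one = undefined,
     zero = {S. is_split X Y S},
     add = (\<lambda>C D. {U. \<exists>S \<in> C. \<exists>T \<in> D. is_baer_sum X Y S T U}),
     smult = (\<lambda>c C. {T. \<exists>S \<in> C. is_scalar_multiple X Y c S T})\<rparr>"

definition ext_dim :: "('k::field) vrep \<Rightarrow> 'k vrep \<Rightarrow> nat" where
  "ext_dim X Y = vectorspace.dim class_ring (ext_space X Y)"

definition bracket :: "('k::field) vrep \<Rightarrow> 'k vrep \<Rightarrow> nat \<times> nat" where
  "bracket X Y = (hom_dim X Y, ext_dim X Y)"

text \<open>Coordinates of \<^typ>\<open>'k vec\<close> are numbered from 0.\<close>

definition pi_plus :: "nat \<Rightarrow> 'k vec \<Rightarrow> 'k vec" where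
  "pi_plus m x = vec m (\<lambda>i. x $ i)"

definition pi_minus :: "nat \<Rightarrow> 'k vec \<Rightarrow> 'k vec" where
  "pi_minus m x = vec m (\<lambda>i. x $ Suc i)"

definition j_plus :: "nat \<Rightarrow> 'k::zero vec \<Rightarrow> 'k vec" where
  "j_plus m x = vec (Suc m) (\<lambda>i. if i < m then x $ i else 0)"

definition j_minus :: "nat \<Rightarrow> 'k::zero vec \<Rightarrow> 'k vec" where
  "j_minus m x = vec (Suc m) (\<lambda>i. case i of 0 \<Rightarrow> 0 | Suc l \<Rightarrow> x $ l)"

text \<open>
  Dimensions are given in the order of vertices \<open>b, -, +, e\<close>, but the maps in the order of arrows
  \<open>b \<rightarrow> +\<close>, \<open>+ \<rightarrow> e\<close>, \<open>b \<rightarrow> -\<close>, \<open>- \<rightarrow> e\<close>.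
\<close>

definition coord_rep :: "'k::field itself \<Rightarrow> nat \<times> nat \<times> nat \<times> nat \<Rightarrow>
    ('k vec \<Rightarrow> 'k vec) \<times> ('k vec \<Rightarrow> 'k vec) \<times> ('k vec \<Rightarrow> 'k vec) \<times> ('k vec \<Rightarrow> 'k vec) \<Rightarrow> 'k vrep" where
  "coord_rep k = (\<lambda>(nb, nminus, nplus, ne) (f, g, p, q). \<lparr>
     space_at = (\<lambda>v. module_vec k
       (case v of Vb \<Rightarrow> nb | Vminus \<Rightarrow> nminus | Vplus \<Rightarrow> nplus | Ve \<Rightarrow> ne)),
     map_at = (\<lambda>a. case a of
       b_to_plus \<Rightarrow> f | plus_to_e \<Rightarrow> g | b_to_minus \<Rightarrow> p | minus_to_e \<Rightarrow> q)\<rparr>)"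

definition E1 :: "'k::field itself \<Rightarrow> nat \<Rightarrow> 'k vrep" where
  "E1 k m = coord_rep k (m+1, m, m, m) (pi_plus m, id, pi_minus m, id)"

definition E2 :: "'k::field itself \<Rightarrow> nat \<Rightarrow> 'k vrep" where
  "E2 k m = coord_rep k (m, m+1, m+1, m+1) (j_plus m, id, j_minus m, id)"

definition E3 :: "'k::field itself \<Rightarrow> nat \<Rightarrow> 'k vrep" where
  "E3 k m = coord_rep k (m, m, m, m+1) (id, j_plus m, id, j_minus m)"

definition E4 :: "'k::field itself \<Rightarrow> nat \<Rightarrow> 'k vrep" where
  "E4 k m = coord_rep k (m+1, m+1, m+1, m) (id, pi_plus m, id, pi_minus m)"

definition E5 :: "'k::field itself \<Rightarrow> nat \<Rightarrow> 'k vrep" where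
  "E5 k m = coord_rep k (m, m+1, m, m+1) (id, j_plus m, j_minus m, id)"

definition E6 :: "'k::field itself \<Rightarrow> nat \<Rightarrow> 'k vrep" where
  "E6 k m = coord_rep k (m+1, m, m+1, m) (id, pi_plus m, pi_minus m, id)"

definition E7 :: "'k::field itself \<Rightarrow> nat \<Rightarrow> 'k vrep" where
  "E7 k m = coord_rep k (m+1, m+1, m, m) (pi_plus m, id, id, pi_minus m)"

definition E8 :: "'k::field itself \<Rightarrow> nat \<Rightarrow> 'k vrep" where
  "E8 k m = coord_rep k (m, m, m+1, m+1) (j_plus m, id, id, j_minus m)"

text \<open>Meaningful for \<open>1 \<le> i \<le> 8\<close> only.\<close>

definition E_rep :: "'k::field itself \<Rightarrow> nat \<Rightarrow> nat \<Rightarrow> 'k vrep" where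
  "E_rep k i m = [E1 k m, E2 k m, E3 k m, E4 k m, E5 k m, E6 k m, E7 k m, E8 k m] ! (i - 1)"

abbreviation zero_map :: "nat \<Rightarrow> 'k::zero vec \<Rightarrow> 'k vec" where
  "zero_map n \<equiv> (\<lambda>_. 0\<^sub>v n)"

definition F_plus :: "'k::field itself \<Rightarrow> 'k vrep" where
  "F_plus k = coord_rep k (0, 0, 1, 0) (zero_map 1, zero_map 0, zero_map 0, zero_map 0)"

definition F_minus :: "'k::field itself \<Rightarrow> 'k vrep" where
  "F_minus k = coord_rep k (0, 1, 0, 0) (zero_map 0, zero_map 0, zero_map 1, zero_map 0)"

definition G_plus :: "'k::field itself \<Rightarrow> 'k vrep" where
  "G_plus k = coord_rep k (1, 0, 1, 1) (id, id, zero_map 0, zero_map 1)"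

definition G_minus :: "'k::field itself \<Rightarrow> 'k vrep" where
  "G_minus k = coord_rep k (1, 1, 0, 1) (zero_map 0, zero_map 1, id, id)"

end

theory Submission
  imports Defs
begin

text \<open>
  Extensions of \<open>X\<close> by \<open>Y\<close> are classified by cocycles: a linear section of the projection exists at
  every vertex, and its failure to commute with the arrow \<open>a\<close> is a linear map from \<open>X\<close> at the source
  of \<open>a\<close> to \<open>Y\<close> at the target of \<open>a\<close>. So \<open>Hom\<close> and \<open>Ext\<close> are the kernel and the cokernel of one map
  \<open>h \<mapsto> (Y\<^sub>a h\<^sub>s - h\<^sub>t X\<^sub>a)\<^sub>a\<close> between spaces of known dimension. In every case of the table this map is
  injective or surjective, and the other dimension is then given by the Euler form.

  To see this, unfold the cycle \<open>b \<rightarrow> + \<rightarrow> e \<leftarrow> - \<leftarrow> b\<close> to the integers, with \<open>b, +, e, -\<close> at the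
  positions congruent to \<open>0, 1, 2, 3\<close> modulo 4. Each exceptional representation has a basis indexed by
  an interval \<open>[p, q]\<close>, on which every arrow moves a basis vector to the neighbouring position, or to 0
  if that leaves the interval. For two intervals the map above splits into one part for each translate
  of the second interval by a multiple of 4; such a part is the difference map of a segment, and
  only the arrows at the two ends of the intersection decide whether it is injective or surjective.
\<close>

text \<open>Ext is given by Yoneda classes with Baer sums, and the operations of
  \<open>ext_space\<close> are bare sets of all extensions satisfying some relation, so not even the
  vector space axioms are available at first. A cocycle depends on the chosen section; hence it is
  attached to an extension by a relation, \<open>has_cocycle\<close>, and not by a function. Each
  relation in the definition of Ext (equivalence, Baer sum, scalar multiple, split) turns into an
  equation between cocycles, so \<open>cocycle_class\<close> respects the operations and carries the
  axioms over from the cochains. Every cochain occurs as a cocycle because the quiver has no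
  relations: the complex is Hom(-, Y) applied to the standard projective resolution of X, which has
  length one. On a segment, n unknowns satisfy n - 1 inner equations and one more for each end
  crossed by an arrow. So the map is injective if some end is crossed and surjective unless both
  are, and each entry of the table reduces to residues of end points modulo 4.\<close>

section \<open>Linear maps between module records\<close>

abbreviation linear_maps :: "('k::field, 'v) module \<Rightarrow> ('k, 'w) module \<Rightarrow> ('v \<Rightarrow> 'w) set" where
  "linear_maps \<equiv> LinearCombinations.module_hom class_ring"

lemma linear_mapsI:
  assumes "\<And>x. x \<in> carrier V \<Longrightarrow> f x \<in> carrier W"
    and "\<And>x y. x \<in> carrier V \<Longrightarrow> y \<in> carrier V \<Longrightarrow> f (x \<oplus>\<^bsub>V\<^esub> y) = f x \<oplus>\<^bsub>W\<^esub> f y"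
    and "\<And>c x. x \<in> carrier V \<Longrightarrow> f (c \<odot>\<^bsub>V\<^esub> x) = c \<odot>\<^bsub>W\<^esub> f x"
  shows "f \<in> linear_maps V W"
  using assms by (auto simp: LinearCombinations.module_hom_def)

lemma linear_mapsD:
  assumes "f \<in> linear_maps V W"
  shows "x \<in> carrier V \<Longrightarrow> f x \<in> carrier W"
    and "x \<in> carrier V \<Longrightarrow> y \<in> carrier V \<Longrightarrow> f (x \<oplus>\<^bsub>V\<^esub> y) = f x \<oplus>\<^bsub>W\<^esub> f y"
    and "x \<in> carrier V \<Longrightarrow> f (c \<odot>\<^bsub>V\<^esub> x) = c \<odot>\<^bsub>W\<^esub> f x"
  using assms by (auto simp: LinearCombinations.module_hom_def)

lemma linear_mapI:
  assumes "vectorspace class_ring V" "vectorspace class_ring W" "f \<in> linear_maps V W"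
  shows "linear_map class_ring V W f"
  using assms unfolding linear_map_def mod_hom_def mod_hom_axioms_def
  by (auto intro: vectorspace.axioms)

lemma linear_maps_zero:
  assumes "vectorspace class_ring V" "vectorspace class_ring W" "f \<in> linear_maps V W"
  shows "f \<zero>\<^bsub>V\<^esub> = \<zero>\<^bsub>W\<^esub>"
proof -
  interpret linear_map class_ring V W f by (rule linear_mapI[OF assms])
  show ?thesis by simp
qed

text \<open>Each axiom for W is pulled back to V by choosing preimages. W is only a record and not
  yet a group, so preservation of zero has to be assumed. The lemma is meant for
  \<open>ext_space\<close>: it spares checking the axioms, such as associativity, on Baer
  sums.\<close>

lemma surjective_image_vectorspace:
  assumes "vectorspace class_ring V" and f: "f \<in> linear_maps V W"
    and surj: "f ` carrier V = carrier W" and zero: "f \<zero>\<^bsub>V\<^esub> = \<zero>\<^bsub>W\<^esub>"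
  shows "vectorspace class_ring W"
proof -
  interpret V: vectorspace class_ring V by fact
  note f' = linear_mapsD(2,3)[OF f, symmetric]
  have ex: "\<exists>v \<in> carrier V. w = f v" if "w \<in> carrier W" for w
    using that surj by blast
  show ?thesis
  proof (rule vs_criteria[OF class_field]; (intro ballI allI impI; (elim conjE)?)?)
    show "\<zero>\<^bsub>W\<^esub> \<in> carrier W" using zero surj by (metis V.M.zero_closed imageI)
  next
    fix v w assume "v \<in> carrier W" "w \<in> carrier W"
    then obtain v' w' where [simp]: "v' \<in> carrier V" "v = f v'" "w' \<in> carrier V" "w = f w'"
      using ex by metis
    show "v \<oplus>\<^bsub>W\<^esub> w \<in> carrier W" using surj by (auto simp: f')
    show "v \<oplus>\<^bsub>W\<^esub> w = w \<oplus>\<^bsub>W\<^esub> v" by (simp add: f' V.M.a_comm)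
    fix a :: 'a
    show "a \<odot>\<^bsub>W\<^esub> (v \<oplus>\<^bsub>W\<^esub> w) = a \<odot>\<^bsub>W\<^esub> v \<oplus>\<^bsub>W\<^esub> a \<odot>\<^bsub>W\<^esub> w"
      by (simp add: f' V.smult_r_distr)
    fix x assume "x \<in> carrier W"
    then obtain x' where [simp]: "x' \<in> carrier V" "x = f x'" using ex by metis
    show "v \<oplus>\<^bsub>W\<^esub> w \<oplus>\<^bsub>W\<^esub> x = v \<oplus>\<^bsub>W\<^esub> (w \<oplus>\<^bsub>W\<^esub> x)" by (simp add: f' V.M.a_assoc)
  next
    fix v assume "v \<in> carrier W"
    then obtain v' where [simp]: "v' \<in> carrier V" "v = f v'" using ex by metis
    show "\<exists>w\<in>carrier W. v \<oplus>\<^bsub>W\<^esub> w = \<zero>\<^bsub>W\<^esub>"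
    proof
      show "f (\<ominus>\<^bsub>V\<^esub> v') \<in> carrier W" using surj by auto
      show "v \<oplus>\<^bsub>W\<^esub> f (\<ominus>\<^bsub>V\<^esub> v') = \<zero>\<^bsub>W\<^esub>" by (simp add: f' V.M.r_neg zero)
    qed
    show "v \<oplus>\<^bsub>W\<^esub> \<zero>\<^bsub>W\<^esub> = v" by (simp add: f' flip: zero)
    show "\<one>\<^bsub>class_ring\<^esub> \<odot>\<^bsub>W\<^esub> v = v" using V.smult_one[of v'] by (simp add: f' del: V.smult_one)
    fix a b :: 'a
    show "a \<odot>\<^bsub>W\<^esub> v \<in> carrier W" using V.smult_closed[of a v'] surj by (auto simp: f')
    show "(a \<otimes>\<^bsub>class_ring\<^esub> b) \<odot>\<^bsub>W\<^esub> v = a \<odot>\<^bsub>W\<^esub> (b \<odot>\<^bsub>W\<^esub> v)"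
      using V.smult_assoc1[of a b v'] V.smult_closed[of b v'] by (simp add: f')
    show "(a \<oplus>\<^bsub>class_ring\<^esub> b) \<odot>\<^bsub>W\<^esub> v = a \<odot>\<^bsub>W\<^esub> v \<oplus>\<^bsub>W\<^esub> b \<odot>\<^bsub>W\<^esub> v"
      using V.smult_l_distr[of a b v'] V.smult_closed[of b v'] V.smult_closed[of a v']
      by (simp add: f')
  qed
qed

section \<open>Families of linear maps and their dimension\<close>

definition hom_family ::
  "('i \<Rightarrow> ('k::field, 'v) module) \<Rightarrow> ('i \<Rightarrow> ('k, 'w) module) \<Rightarrow> ('k, 'i \<Rightarrow> 'v \<Rightarrow> 'w) module" where
  "hom_family V W = \<lparr>
     carrier = {f. \<forall>i. f i \<in> linear_maps (V i) (W i) \<inter> extensional (carrier (V i))},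
     mult = undefined,
     one = undefined,
     zero = (\<lambda>i. \<lambda>x \<in> carrier (V i). \<zero>\<^bsub>W i\<^esub>),
     add = (\<lambda>f g i. \<lambda>x \<in> carrier (V i). f i x \<oplus>\<^bsub>W i\<^esub> g i x),
     smult = (\<lambda>c f i. \<lambda>x \<in> carrier (V i). c \<odot>\<^bsub>W i\<^esub> f i x)\<rparr>"

lemma hom_family_carrierD:
  assumes "f \<in> carrier (hom_family V W)"
  shows "f i \<in> linear_maps (V i) (W i)" "f i \<in> extensional (carrier (V i))"
  using assms by (auto simp: hom_family_def)

lemma hom_family_eqI:
  assumes "f \<in> carrier (hom_family V W)" "g \<in> carrier (hom_family V W)"
    and "\<And>i x. x \<in> carrier (V i) \<Longrightarrow> f i x = g i x"
  shows "f = g"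
proof
  fix i show "f i = g i"
    using assms by (intro extensionalityI[of _ "carrier (V i)"]) (auto simp: hom_family_carrierD)
qed

lemma hom_family_vectorspace:
  fixes V :: "'i \<Rightarrow> ('k::field, 'v) module" and W :: "'i \<Rightarrow> ('k, 'w) module"
  assumes V: "\<And>i. vectorspace class_ring (V i)" and W: "\<And>i. vectorspace class_ring (W i)"
  shows "vectorspace class_ring (hom_family V W)"
proof -
  interpret V: vectorspace class_ring "V i" for i by (rule V)
  interpret W: vectorspace class_ring "W i" for i by (rule W)
  let ?H = "hom_family V W"
  note cl = linear_mapsD[OF hom_family_carrierD(1)]
  note [simp] = V.smult_closed[simplified] W.smult_closed[simplified]
    W.smult_assoc1[simplified] V.smult_one[simplified] W.smult_one[simplified]
    V.smult_l_distr[simplified] W.smult_l_distr[simplified]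
    V.smult_r_distr[simplified] W.smult_r_distr[simplified] W.M.a_ac
  have lm: "linear_map class_ring (V i) (W i) (f i)" if "f \<in> carrier ?H" for f i
    using that by (intro linear_mapI V W hom_family_carrierD)
  have z: "\<zero>\<^bsub>?H\<^esub> \<in> carrier ?H"
    by (auto simp: hom_family_def intro!: linear_mapsI)
  have add: "f \<oplus>\<^bsub>?H\<^esub> g \<in> carrier ?H" if "f \<in> carrier ?H" "g \<in> carrier ?H" for f g
    using cl[OF that(1)] cl[OF that(2)]
    by (auto simp: hom_family_def intro!: linear_mapsI)
  have sm: "c \<odot>\<^bsub>?H\<^esub> f \<in> carrier ?H" if "f \<in> carrier ?H" for f c
    using cl[OF that]
    by (auto simp: hom_family_def intro!: linear_mapsI)
       (metis W.smult_assoc1 UNIV_I monoid.simps(1) partial_object.simps(1) mult.commute)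
  have ap: "\<zero>\<^bsub>?H\<^esub> i x = \<zero>\<^bsub>W i\<^esub>" "(f \<oplus>\<^bsub>?H\<^esub> g) i x = f i x \<oplus>\<^bsub>W i\<^esub> g i x"
     "(c \<odot>\<^bsub>?H\<^esub> f) i x = c \<odot>\<^bsub>W i\<^esub> f i x" if "x \<in> carrier (V i)" for f g c i x
    using that by (simp_all add: hom_family_def)
  show ?thesis
  proof (rule vs_criteria[OF class_field]; (intro ballI allI impI; (elim conjE)?)?)
    fix f assume f: "f \<in> carrier ?H"
    \<comment> \<open>The additive inverse is taken as the multiple by -1, whose membership is
      already known.\<close>
    have n: "(- 1) \<odot>\<^bsub>?H\<^esub> f \<in> carrier ?H" using f by (rule sm)
    show "\<exists>g \<in> carrier ?H. f \<oplus>\<^bsub>?H\<^esub> g = \<zero>\<^bsub>?H\<^esub>"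
    proof (rule bexI[OF _ n], rule hom_family_eqI[OF add[OF f n] z])
      fix i x assume x: "x \<in> carrier (V i)"
      have "f i x \<oplus>\<^bsub>W i\<^esub> (- 1) \<odot>\<^bsub>W i\<^esub> f i x = (1 + - 1) \<odot>\<^bsub>W i\<^esub> f i x"
        using W.smult_l_distr[of 1 "-1" "f i x" i] cl(1)[OF f x] W.smult_one[of "f i x" i] by simp
      also have "\<dots> = \<zero>\<^bsub>W i\<^esub>"
        using W.lmult_0[OF cl(1)[OF f x]] by simp
      finally show "(f \<oplus>\<^bsub>?H\<^esub> - 1 \<odot>\<^bsub>?H\<^esub> f) i x = \<zero>\<^bsub>?H\<^esub> i x" using x by (simp add: ap)
    qed
  qed (auto intro!: z add sm hom_family_eqI[where V = V and W = W] simp: ap cl)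
qed

lemma module_vec_apply [simp]:
  "carrier (module_vec ty n) = carrier_vec n"
  "\<zero>\<^bsub>module_vec ty n\<^esub> = 0\<^sub>v n"
  "x \<oplus>\<^bsub>module_vec ty n\<^esub> y = x + y"
  "c \<odot>\<^bsub>module_vec ty n\<^esub> x = c \<cdot>\<^sub>v x"
  by (simp_all add: module_vec_def)

lemma linear_maps_eq_on_unit_vecs:
  fixes W :: "('k::field, 'w) module"
  assumes W: "vectorspace class_ring W"
    and f: "f \<in> linear_maps (module_vec TYPE('k) n) W"
    and g: "g \<in> linear_maps (module_vec TYPE('k) n) W"
    and eq: "\<And>j. j < n \<Longrightarrow> f (unit_vec n j) = g (unit_vec n j)"
    and x: "x \<in> carrier_vec n"
  shows "f x = g x"
proof -
  \<comment> \<open>Truncations of x to its first k coordinates. Consecutive ones differ by a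
    multiple of a unit vector, so induction on k reaches x at k = n without finite sums in
    W.\<close>
  let ?t = "\<lambda>k. vec n (\<lambda>i. if i < k then x $ i else 0)"
  have *: "f (?t k) = g (?t k)" if "k \<le> n" for k
    using that
  proof (induction k)
    case 0
    have "?t 0 = 0\<^sub>v n" by auto
    then show ?case
      using linear_maps_zero[OF vec_vs W f] linear_maps_zero[OF vec_vs W g] by simp
  next
    case (Suc k)
    have t: "?t (Suc k) = ?t k + x $ k \<cdot>\<^sub>v unit_vec n k"
      using Suc.prems by (auto simp: less_Suc_eq)
    show ?case
      unfolding t using Suc eq[of k] linear_mapsD[OF f] linear_mapsD[OF g] by simp
  qed
  have "?t n = x" using x by auto
  with *[of n] show ?thesis by simp
qed

lemma linear_maps_exists_on_unit_vecs:
  fixes W :: "('k::field, 'w) module"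
  assumes W: "vectorspace class_ring W" and b: "\<And>j. j < n \<Longrightarrow> b j \<in> carrier W"
  obtains f where "f \<in> linear_maps (module_vec TYPE('k) n) W" "\<And>j. j < n \<Longrightarrow> f (unit_vec n j) = b j"
proof -
  interpret W: vectorspace class_ring W by (rule W)
  note [simp] = W.smult_closed[simplified] W.smult_assoc1[simplified] W.smult_one[simplified]
    W.smult_l_distr[simplified] W.smult_r_distr[simplified] W.M.a_ac W.lmult_0[simplified]
  \<comment> \<open>Partial sums of coordinates times prescribed values. The recursion lets
    linearity and the values on unit vectors be proved by one induction on k.\<close>
  define s where "s = rec_nat (\<lambda>x. \<zero>\<^bsub>W\<^esub>) (\<lambda>k h x. h x \<oplus>\<^bsub>W\<^esub> x $ k \<odot>\<^bsub>W\<^esub> b k)"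
  have s0: "s 0 x = \<zero>\<^bsub>W\<^esub>" and sS: "s (Suc k) x = s k x \<oplus>\<^bsub>W\<^esub> x $ k \<odot>\<^bsub>W\<^esub> b k" for k x
    by (simp_all add: s_def)
  have "s k \<in> linear_maps (module_vec TYPE('k) n) W \<and>
      (\<forall>j < n. s k (unit_vec n j) = (if j < k then b j else \<zero>\<^bsub>W\<^esub>))" if "k \<le> n" for k
    using that
  proof (induction k)
    case 0
    then show ?case by (auto simp: s0 intro!: linear_mapsI)
  next
    case (Suc k)
    then have l: "s k \<in> linear_maps (module_vec TYPE('k) n) W" by simp
    have "s (Suc k) \<in> linear_maps (module_vec TYPE('k) n) W"
      using linear_mapsD[OF l] Suc.prems b[of k]
      by (intro linear_mapsI) (auto simp: sS)
    moreover have "s (Suc k) (unit_vec n j) = (if j < Suc k then b j else \<zero>\<^bsub>W\<^esub>)" if "j < n" for j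
      using Suc b[of k] b[of j] that by (auto simp: sS less_Suc_eq)
    ultimately show ?case by simp
  qed
  from this[of n] show ?thesis by (intro that[of "s n"]) auto
qed

text \<open>Lift the unit vectors through p and extend linearly. Only the target needs an explicit
  basis, which matters because the middle term of an extension is not given in coordinates.\<close>

lemma linear_section_exists:
  fixes M :: "('k::field, 'v) module"
  assumes M: "vectorspace class_ring M" and p: "p \<in> linear_maps M (module_vec TYPE('k) n)"
    and surj: "p ` carrier M = carrier_vec n"
  obtains s where "s \<in> linear_maps (module_vec TYPE('k) n) M"
    "\<And>x. x \<in> carrier_vec n \<Longrightarrow> p (s x) = x"
proof -
  have "\<exists>m \<in> carrier M. p m = unit_vec n j" for j
    using surj unit_vec_carrier[of n j] by (metis imageE)
  then have "\<exists>b. \<forall>j. b j \<in> carrier M \<and> p (b j) = unit_vec n j" by (intro choice) blast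
  then obtain b where b: "\<And>j. b j \<in> carrier M" "\<And>j. p (b j) = unit_vec n j" by blast
  obtain s where s: "s \<in> linear_maps (module_vec TYPE('k) n) M"
    and sb: "\<And>j. j < n \<Longrightarrow> s (unit_vec n j) = b j"
    using linear_maps_exists_on_unit_vecs[OF M, of n b] b(1) by blast
  have c: "(\<lambda>x. p (s x)) \<in> linear_maps (module_vec TYPE('k) n) (module_vec TYPE('k) n)"
    using linear_mapsD[OF s] linear_mapsD[OF p] by (intro linear_mapsI) simp_all
  have i: "(\<lambda>x. x) \<in> linear_maps (module_vec TYPE('k) n) (module_vec TYPE('k) n)"
    by (intro linear_mapsI) simp_all
  show ?thesis
    using linear_maps_eq_on_unit_vecs[OF vec_vs c i] sb b(2) by (intro that[OF s]) simp
qed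

text \<open>The first index of A belongs to the source, so \<open>A j\<close> is the image of the
  j-th unit vector; this is the transpose of the usual matrix convention.\<close>

definition matrix_map :: "nat \<Rightarrow> nat \<Rightarrow> (nat \<Rightarrow> nat \<Rightarrow> 'k::field) \<Rightarrow> 'k vec \<Rightarrow> 'k vec" where
  "matrix_map n m A = (\<lambda>x \<in> carrier_vec n. vec m (\<lambda>l. \<Sum>j<n. A j l * x $ j))"

lemma matrix_map_linear:
  "matrix_map n m A \<in> linear_maps (module_vec TYPE('k::field) n) (module_vec TYPE('k) m)"
  by (intro linear_mapsI)
     (auto simp: matrix_map_def algebra_simps sum.distrib sum_distrib_left intro!: eq_vecI)

lemma matrix_map_unit_vec:
  assumes "j < n" shows "matrix_map n m A (unit_vec n j) = vec m (A j)"
proof (rule eq_vecI)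
  fix l assume "l < dim_vec (vec m (A j))"
  then show "matrix_map n m A (unit_vec n j) $ l = vec m (A j) $ l"
    using assms by (simp add: matrix_map_def if_distrib[of "(*) _"] cong: if_cong)
qed (use assms in \<open>simp add: matrix_map_def\<close>)

lemma matrix_map_cong:
  assumes "\<And>j l. j < n \<Longrightarrow> l < m \<Longrightarrow> A j l = B j l"
  shows "matrix_map n m A = matrix_map n m B"
  using assms by (auto simp: matrix_map_def fun_eq_iff intro!: eq_vecI)

lemma matrix_map_add:
  "x \<in> carrier_vec n \<Longrightarrow>
    matrix_map n m (\<lambda>j l. A j l + B j l) x = matrix_map n m A x + matrix_map n m B x"
  by (auto simp: matrix_map_def distrib_right sum.distrib)

lemma matrix_map_smult:
  "x \<in> carrier_vec n \<Longrightarrow> matrix_map n m (\<lambda>j l. c * A j l) x = c \<cdot>\<^sub>v matrix_map n m A x"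
  by (auto simp: matrix_map_def sum_distrib_left mult.assoc)

text \<open>Listing all matrix entries of all members of a family gives an isomorphism with a
  coordinate space.\<close>

lemma hom_family_module_vec_dim:
  fixes n m :: "'i::finite \<Rightarrow> nat"
  defines "H \<equiv> hom_family (\<lambda>i. module_vec TYPE('k::field) (n i)) (\<lambda>i. module_vec TYPE('k) (m i))"
  shows "vectorspace.fin_dim class_ring H" and "vectorspace.dim class_ring H = (\<Sum>i\<in>UNIV. n i * m i)"
proof -
  \<comment> \<open>A triple consists of a member of the family, a source coordinate and a target
    coordinate; e will number these triples.\<close>
  define I where "I = (SIGMA i:UNIV. {..<n i} \<times> {..<m i})"
  define N where "N = card I"
  have "finite I" by (simp add: I_def)
  then obtain e where e: "bij_betw e I {..<N}"
    using ex_bij_betw_finite_nat[of I] by (auto simp: N_def atLeast0LessThan)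
  define L :: "'k vec \<Rightarrow> 'i \<Rightarrow> 'k vec \<Rightarrow> 'k vec" where
    "L = (\<lambda>u i. matrix_map (n i) (m i) (\<lambda>j l. u $ e (i, j, l)))"
  have eN: "e (i, j, l) < N" if "j < n i" "l < m i" for i j l
    using bij_betwE[OF e] that by (auto simp: I_def)
  have H: "vectorspace class_ring H" unfolding H_def by (intro hom_family_vectorspace vec_vs)
  interpret H: vectorspace class_ring H by (rule H)
  have LH: "L u \<in> carrier H" for u
    using matrix_map_linear by (auto simp: H_def hom_family_def L_def matrix_map_def)
  have lin: "L \<in> linear_maps (module_vec TYPE('k) N) H"
  proof (rule linear_mapsI)
    fix u v :: "'k vec" and c :: 'k
    assume u: "u \<in> carrier (module_vec TYPE('k) N)"
    have 1: "matrix_map (n i) (m i) (\<lambda>j l. (c \<cdot>\<^sub>v u) $ e (i, j, l)) =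
        matrix_map (n i) (m i) (\<lambda>j l. c * u $ e (i, j, l))" for i
      using u eN by (intro matrix_map_cong) auto
    show "L (c \<odot>\<^bsub>module_vec TYPE('k) N\<^esub> u) = c \<odot>\<^bsub>H\<^esub> L u"
      unfolding H_def
      by (rule hom_family_eqI[OF LH[unfolded H_def]
            H.smult_closed[OF _ LH, simplified, of c u, unfolded H_def]])
         (simp add: 1 L_def hom_family_def matrix_map_smult)
    assume v: "v \<in> carrier (module_vec TYPE('k) N)"
    have 2: "matrix_map (n i) (m i) (\<lambda>j l. (u + v) $ e (i, j, l)) =
        matrix_map (n i) (m i) (\<lambda>j l. u $ e (i, j, l) + v $ e (i, j, l))" for i
      using u v eN by (intro matrix_map_cong) auto
    show "L (u \<oplus>\<^bsub>module_vec TYPE('k) N\<^esub> v) = L u \<oplus>\<^bsub>H\<^esub> L v"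
      unfolding H_def
      by (rule hom_family_eqI[OF LH[unfolded H_def] H.M.a_closed[OF LH LH, of u v, unfolded H_def]])
         (simp add: 2 L_def hom_family_def matrix_map_add)
  qed (rule LH)
  interpret L: linear_map class_ring "module_vec TYPE('k) N" H L
    by (rule linear_mapI[OF vec_vs H lin])
  interpret V: vec_space "TYPE('k)" N .
  have inj: "inj_on L (carrier (module_vec TYPE('k) N))"
  proof (rule inj_onI)
    fix u v :: "'k vec"
    assume u: "u \<in> carrier (module_vec TYPE('k) N)" and v: "v \<in> carrier (module_vec TYPE('k) N)"
      and eq: "L u = L v"
    show "u = v"
    proof (rule eq_vecI)
      fix r assume "r < dim_vec v"
      then have "r \<in> e ` I" using e v by (simp add: bij_betw_def)
      then obtain i j l where r: "r = e (i, j, l)" "j < n i" "l < m i" by (auto simp: I_def)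
      have "L u i (unit_vec (n i) j) $ l = L v i (unit_vec (n i) j) $ l" by (simp add: eq)
      then show "u $ r = v $ r" using r by (simp add: L_def matrix_map_unit_vec)
    qed (use u v in simp)
  qed
  have surj: "L ` carrier (module_vec TYPE('k) N) = carrier H"
  proof (intro equalityI subsetI)
    fix h assume h: "h \<in> carrier H"
    define u where "u = vec N (\<lambda>r. case inv_into I e r of (i, j, l) \<Rightarrow> h i (unit_vec (n i) j) $ l)"
    have ue: "u $ e (i, j, l) = h i (unit_vec (n i) j) $ l" if "j < n i" "l < m i" for i j l
    proof -
      have "inv_into I e (e (i, j, l)) = (i, j, l)"
        using that e by (intro inv_into_f_f) (auto simp: I_def bij_betw_def)
      then show ?thesis using that eN by (simp add: u_def)
    qed
    have "L u = h"
    proof (rule hom_family_eqI)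
      show "L u \<in> carrier (hom_family (\<lambda>i. module_vec TYPE('k) (n i)) (\<lambda>i. module_vec TYPE('k) (m i)))"
        using LH by (simp add: H_def)
      show h': "h \<in> carrier (hom_family (\<lambda>i. module_vec TYPE('k) (n i)) (\<lambda>i. module_vec TYPE('k) (m i)))"
        using h by (simp add: H_def)
      fix i x assume x: "x \<in> carrier (module_vec TYPE('k) (n i))"
      have hi: "h i \<in> linear_maps (module_vec TYPE('k) (n i)) (module_vec TYPE('k) (m i))"
        using hom_family_carrierD(1)[OF h'] .
      show "L u i x = h i x"
      proof (rule linear_maps_eq_on_unit_vecs[OF vec_vs _ hi])
        show "L u i \<in> linear_maps (module_vec TYPE('k) (n i)) (module_vec TYPE('k) (m i))"
          by (simp add: L_def matrix_map_linear)
        fix j assume j: "j < n i"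
        have "h i (unit_vec (n i) j) \<in> carrier_vec (m i)"
          using linear_mapsD(1)[OF hi] by simp
        then show "L u i (unit_vec (n i) j) = h i (unit_vec (n i) j)"
          using j by (auto simp: L_def matrix_map_unit_vec ue)
      qed (use x in simp)
    qed
    then show "h \<in> L ` carrier (module_vec TYPE('k) N)"
      by (intro image_eqI[of _ _ u]) (simp_all add: u_def)
  qed (use LH in auto)
  show "vectorspace.fin_dim class_ring H"
    by (rule L.surj_fin_dim[OF V.fin_dim surj])
  have "vectorspace.dim class_ring H = N"
    using L.dim_eq[OF V.fin_dim inj surj] V.dim_is_n by simp
  then show "vectorspace.dim class_ring H = (\<Sum>i\<in>UNIV. n i * m i)"
    by (simp add: N_def I_def)
qed

section \<open>The two-term complex of a pair of coordinate representations\<close>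

lemma smult_diff_distrib_vec:
  fixes u w :: "'k::ring vec"
  assumes "u \<in> carrier_vec n" "w \<in> carrier_vec n"
  shows "k \<cdot>\<^sub>v (u - w) = k \<cdot>\<^sub>v u - k \<cdot>\<^sub>v w"
  using assms by (auto simp: right_diff_distrib)

lemma add_diff_add_vec:
  fixes u u' w w' :: "'k::ab_group_add vec"
  assumes "u \<in> carrier_vec n" "u' \<in> carrier_vec n" "w \<in> carrier_vec n" "w' \<in> carrier_vec n"
  shows "(u + u') - (w + w') = (u - w) + (u' - w')"
  using assms by auto

text \<open>Only the spaces are in coordinates, while the arrow maps are arbitrary linear maps.
  Everything up to \<open>euler_form\<close> therefore holds for any such pair, before intervals
  enter.\<close>

locale coordinate_reps =
  fixes X Y :: "'k::field vrep" and x y :: "vertex \<Rightarrow> nat"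
  assumes X_space [simp]: "space_at X v = module_vec TYPE('k) (x v)"
    and Y_space [simp]: "space_at Y v = module_vec TYPE('k) (y v)"
    and X_map: "map_at X a \<in> linear_maps (space_at X (source a)) (space_at X (target a))"
    and Y_map: "map_at Y a \<in> linear_maps (space_at Y (source a)) (space_at Y (target a))"
begin

lemmas X_map_simps [simp] = linear_mapsD[OF X_map, simplified]
lemmas Y_map_simps [simp] = linear_mapsD[OF Y_map, simplified]

definition cochains :: "('k, arrow \<Rightarrow> 'k vec \<Rightarrow> 'k vec) module" where
  "cochains = hom_family (\<lambda>a. module_vec TYPE('k) (x (source a))) (\<lambda>a. module_vec TYPE('k) (y (target a)))"

definition vertex_maps :: "('k, vertex \<Rightarrow> 'k vec \<Rightarrow> 'k vec) module" where
  "vertex_maps = hom_family (\<lambda>v. module_vec TYPE('k) (x v)) (\<lambda>v. module_vec TYPE('k) (y v))"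

text \<open>The sign is chosen so that adding \<open>inc h\<close> to a section adds
  \<open>coboundary h\<close> to its cocycle.\<close>

definition coboundary :: "(vertex \<Rightarrow> 'k vec \<Rightarrow> 'k vec) \<Rightarrow> arrow \<Rightarrow> 'k vec \<Rightarrow> 'k vec" where
  "coboundary h = (\<lambda>a. \<lambda>z \<in> carrier_vec (x (source a)).
     map_at Y a (h (source a) z) - h (target a) (map_at X a z))"

lemma cochainsD:
  assumes "c \<in> carrier cochains"
  shows "c a \<in> linear_maps (module_vec TYPE('k) (x (source a))) (module_vec TYPE('k) (y (target a)))"
    and "z \<in> carrier_vec (x (source a)) \<Longrightarrow> c a z \<in> carrier_vec (y (target a))"
    and "z \<in> carrier_vec (x (source a)) \<Longrightarrow> z' \<in> carrier_vec (x (source a)) \<Longrightarrow>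
      c a (z + z') = c a z + c a z'"
    and "z \<in> carrier_vec (x (source a)) \<Longrightarrow> c a (k \<cdot>\<^sub>v z) = k \<cdot>\<^sub>v c a z"
proof -
  show l: "c a \<in> linear_maps (module_vec TYPE('k) (x (source a))) (module_vec TYPE('k) (y (target a)))"
    using hom_family_carrierD(1)[OF assms[unfolded cochains_def]] .
  show "z \<in> carrier_vec (x (source a)) \<Longrightarrow> c a z \<in> carrier_vec (y (target a))"
    and "z \<in> carrier_vec (x (source a)) \<Longrightarrow> z' \<in> carrier_vec (x (source a)) \<Longrightarrow>
      c a (z + z') = c a z + c a z'"
    and "z \<in> carrier_vec (x (source a)) \<Longrightarrow> c a (k \<cdot>\<^sub>v z) = k \<cdot>\<^sub>v c a z"
    using linear_mapsD[OF l] by simp_all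
qed

lemma vertex_mapsD:
  assumes "h \<in> carrier vertex_maps"
  shows "h v \<in> linear_maps (module_vec TYPE('k) (x v)) (module_vec TYPE('k) (y v))"
    and "z \<in> carrier_vec (x v) \<Longrightarrow> h v z \<in> carrier_vec (y v)"
    and "z \<in> carrier_vec (x v) \<Longrightarrow> z' \<in> carrier_vec (x v) \<Longrightarrow> h v (z + z') = h v z + h v z'"
    and "z \<in> carrier_vec (x v) \<Longrightarrow> h v (k \<cdot>\<^sub>v z) = k \<cdot>\<^sub>v h v z"
proof -
  show l: "h v \<in> linear_maps (module_vec TYPE('k) (x v)) (module_vec TYPE('k) (y v))"
    using hom_family_carrierD(1)[OF assms[unfolded vertex_maps_def]] .
  show "z \<in> carrier_vec (x v) \<Longrightarrow> h v z \<in> carrier_vec (y v)"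
    and "z \<in> carrier_vec (x v) \<Longrightarrow> z' \<in> carrier_vec (x v) \<Longrightarrow> h v (z + z') = h v z + h v z'"
    and "z \<in> carrier_vec (x v) \<Longrightarrow> h v (k \<cdot>\<^sub>v z) = k \<cdot>\<^sub>v h v z"
    using linear_mapsD[OF l] by simp_all
qed

lemma cochains_vectorspace: "vectorspace class_ring cochains"
  unfolding cochains_def by (intro hom_family_vectorspace vec_vs)

lemma vertex_maps_vectorspace: "vectorspace class_ring vertex_maps"
  unfolding vertex_maps_def by (intro hom_family_vectorspace vec_vs)

sublocale C: vectorspace class_ring cochains by (rule cochains_vectorspace)

sublocale H: vectorspace class_ring vertex_maps by (rule vertex_maps_vectorspace)

lemma cochains_apply:
  assumes "z \<in> carrier_vec (x (source a))"
  shows "\<zero>\<^bsub>cochains\<^esub> a z = 0\<^sub>v (y (target a))"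
    and "(c \<oplus>\<^bsub>cochains\<^esub> c') a z = c a z + c' a z"
    and "(k \<odot>\<^bsub>cochains\<^esub> c) a z = k \<cdot>\<^sub>v c a z"
  using assms by (simp_all add: cochains_def hom_family_def)

lemma vertex_maps_apply:
  assumes "z \<in> carrier_vec (x v)"
  shows "\<zero>\<^bsub>vertex_maps\<^esub> v z = 0\<^sub>v (y v)"
    and "(h \<oplus>\<^bsub>vertex_maps\<^esub> h') v z = h v z + h' v z"
    and "(k \<odot>\<^bsub>vertex_maps\<^esub> h) v z = k \<cdot>\<^sub>v h v z"
  using assms by (simp_all add: vertex_maps_def hom_family_def)

lemma cochains_eqI:
  assumes "c \<in> carrier cochains" "c' \<in> carrier cochains"
    and "\<And>a z. z \<in> carrier_vec (x (source a)) \<Longrightarrow> c a z = c' a z"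
  shows "c = c'"
  using assms unfolding cochains_def by (elim hom_family_eqI) simp_all

lemma cochainsI:
  assumes "\<And>a. c a \<in> linear_maps (module_vec TYPE('k) (x (source a))) (module_vec TYPE('k) (y (target a)))"
    and "\<And>a. c a \<in> extensional (carrier_vec (x (source a)))"
  shows "c \<in> carrier cochains"
  using assms by (simp add: cochains_def hom_family_def)

lemma vertex_mapsI:
  assumes "\<And>v. h v \<in> linear_maps (module_vec TYPE('k) (x v)) (module_vec TYPE('k) (y v))"
    and "\<And>v. h v \<in> extensional (carrier_vec (x v))"
  shows "h \<in> carrier vertex_maps"
  using assms by (simp add: vertex_maps_def hom_family_def)

lemma coboundary_apply:
  "z \<in> carrier_vec (x (source a)) \<Longrightarrow>
    coboundary h a z = map_at Y a (h (source a) z) - h (target a) (map_at X a z)"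
  by (simp add: coboundary_def)

lemma coboundary_closed:
  assumes h: "h \<in> carrier vertex_maps"
  shows "coboundary h \<in> carrier cochains"
proof (rule cochainsI)
  fix a
  note [simp] = vertex_mapsD[OF h]
  show "coboundary h a \<in> linear_maps (module_vec TYPE('k) (x (source a))) (module_vec TYPE('k) (y (target a)))"
    by (intro linear_mapsI)
       (auto simp: coboundary_apply intro!: add_diff_add_vec[of _ "y (target a)"] smult_diff_distrib_vec[of _ "y (target a)", symmetric])
  show "coboundary h a \<in> extensional (carrier_vec (x (source a)))"
    by (simp add: coboundary_def)
qed

lemma coboundary_linear: "coboundary \<in> linear_maps vertex_maps cochains"
proof (rule linear_mapsI)
  fix h :: "vertex \<Rightarrow> 'k vec \<Rightarrow> 'k vec" and k :: 'k
  assume h: "h \<in> carrier vertex_maps"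
  note hD = vertex_mapsD(2)[OF h]
  show "coboundary h \<in> carrier cochains" by (rule coboundary_closed[OF h])
  show "coboundary (k \<odot>\<^bsub>vertex_maps\<^esub> h) = k \<odot>\<^bsub>cochains\<^esub> coboundary h"
  proof (rule cochains_eqI)
    fix a and z :: "'k vec" assume z: "z \<in> carrier_vec (x (source a))"
    have "map_at Y a (h (source a) z) \<in> carrier_vec (y (target a))"
      "h (target a) (map_at X a z) \<in> carrier_vec (y (target a))"
      using z by (simp_all add: hD)
    note [simp] = smult_diff_distrib_vec[OF this]
    show "coboundary (k \<odot>\<^bsub>vertex_maps\<^esub> h) a z = (k \<odot>\<^bsub>cochains\<^esub> coboundary h) a z"
      using z by (simp add: coboundary_apply cochains_apply vertex_maps_apply hD)
  qed (use h H.smult_closed[of k h] C.smult_closed[of k "coboundary h"] coboundary_closed in simp_all)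
  fix h' assume h': "h' \<in> carrier vertex_maps"
  note hD' = vertex_mapsD(2)[OF h']
  show "coboundary (h \<oplus>\<^bsub>vertex_maps\<^esub> h') = coboundary h \<oplus>\<^bsub>cochains\<^esub> coboundary h'"
  proof (rule cochains_eqI)
    fix a and z :: "'k vec" assume z: "z \<in> carrier_vec (x (source a))"
    have "map_at Y a (h (source a) z) \<in> carrier_vec (y (target a))"
      "h (target a) (map_at X a z) \<in> carrier_vec (y (target a))"
      "map_at Y a (h' (source a) z) \<in> carrier_vec (y (target a))"
      "h' (target a) (map_at X a z) \<in> carrier_vec (y (target a))"
      using z by (simp_all add: hD hD')
    then show "coboundary (h \<oplus>\<^bsub>vertex_maps\<^esub> h') a z = (coboundary h \<oplus>\<^bsub>cochains\<^esub> coboundary h') a z"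
      using z add_diff_add_vec[of "map_at Y a (h (source a) z)" "y (target a)"
          "map_at Y a (h' (source a) z)" "h (target a) (map_at X a z)" "h' (target a) (map_at X a z)"]
      by (simp add: coboundary_apply cochains_apply vertex_maps_apply hD hD')
  qed (use h h' coboundary_closed in simp_all)
qed

sublocale D: linear_map class_ring vertex_maps cochains coboundary
  by (intro linear_mapI vertex_maps_vectorspace cochains_vectorspace coboundary_linear)

lemma rep_hom_eq: "rep_hom X Y = {h \<in> carrier vertex_maps. coboundary h = \<zero>\<^bsub>cochains\<^esub>}"
proof -
  have "coboundary h = \<zero>\<^bsub>cochains\<^esub> \<longleftrightarrow>
      (\<forall>a. \<forall>z \<in> carrier_vec (x (source a)). h (target a) (map_at X a z) = map_at Y a (h (source a) z))"
    if h: "h \<in> carrier vertex_maps" for h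
  proof -
    have "coboundary h = \<zero>\<^bsub>cochains\<^esub> \<longleftrightarrow> (\<forall>a. \<forall>z \<in> carrier_vec (x (source a)).
        map_at Y a (h (source a) z) - h (target a) (map_at X a z) = 0\<^sub>v (y (target a)))"
      using cochains_eqI[OF coboundary_closed[OF h] C.M.zero_closed]
      by (metis coboundary_apply cochains_apply(1))
    moreover have "map_at Y a (h (source a) z) - h (target a) (map_at X a z) = 0\<^sub>v (y (target a)) \<longleftrightarrow>
        h (target a) (map_at X a z) = map_at Y a (h (source a) z)"
      if z: "z \<in> carrier_vec (x (source a))" for a z
    proof -
      have "h (target a) (map_at X a z) \<in> carrier_vec (y (target a))"
        "map_at Y a (h (source a) z) \<in> carrier_vec (y (target a))"
        using z by (simp_all add: vertex_mapsD[OF h])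
      then show ?thesis by (auto simp: vec_eq_iff)
    qed
    ultimately show ?thesis by simp
  qed
  then show ?thesis
    by (auto simp: rep_hom_def vertex_maps_def hom_family_def)
qed

text \<open>An equality of records and not just an isomorphism, since both sides use the same
  extensional operations. Rank-nullity for \<open>coboundary\<close> thus speaks of
  \<open>hom_dim\<close> directly.\<close>

lemma hom_space_eq: "hom_space X Y = vertex_maps\<lparr>carrier := D.kerT\<rparr>"
  unfolding D.ker_def hom_space_def rep_hom_eq by (simp add: vertex_maps_def hom_family_def)

end

section \<open>Short exact sequences and their linear sections\<close>

lemma rep_homD:
  assumes "f \<in> rep_hom V W"
  shows "f v \<in> linear_maps (space_at V v) (space_at W v)"
    and "f v \<in> extensional (carrier (space_at V v))"
    and "z \<in> carrier (space_at V (source a)) \<Longrightarrow>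
      f (target a) (map_at V a z) = map_at W a (f (source a) z)"
  using assms by (auto simp: rep_hom_def)

lemma rep_homI:
  assumes "\<And>v. f v \<in> linear_maps (space_at V v) (space_at W v)"
    and "\<And>v. f v \<in> extensional (carrier (space_at V v))"
    and "\<And>a z. z \<in> carrier (space_at V (source a)) \<Longrightarrow>
      f (target a) (map_at V a z) = map_at W a (f (source a) z)"
  shows "f \<in> rep_hom V W"
  using assms by (auto simp: rep_hom_def)

locale extension = coordinate_reps X Y x y for X Y :: "'k::field vrep" and x y +
  fixes S
  assumes S_ext: "S \<in> extensions X Y"
begin

abbreviation M where "M v \<equiv> space_at (middle S) v"

lemma rep: "is_rep (middle S)" and inc_hom: "inc S \<in> rep_hom Y (middle S)"
  and prj_hom: "prj S \<in> rep_hom (middle S) X"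
  using S_ext by (auto simp: extensions_def)

lemma middle_vectorspace: "vectorspace class_ring (M v)"
  using rep by (auto simp: is_rep_def)

sublocale M: vectorspace class_ring "M v" for v
  by (rule middle_vectorspace)

lemma map_linear: "map_at (middle S) a \<in> linear_maps (M (source a)) (M (target a))"
  using rep by (auto simp: is_rep_def)

lemmas map_simps [simp] = linear_mapsD[OF map_linear]
lemmas inc_simps [simp] = linear_mapsD[OF rep_homD(1)[OF inc_hom], simplified]
lemmas prj_simps [simp] = linear_mapsD[OF rep_homD(1)[OF prj_hom], simplified]

lemma smult_closed [simp]: "m \<in> carrier (M v) \<Longrightarrow> c \<odot>\<^bsub>M v\<^esub> m \<in> carrier (M v)"
  using M.smult_closed[of c m v] by simp

lemma smult_add [simp]: "m \<in> carrier (M v) \<Longrightarrow> m' \<in> carrier (M v) \<Longrightarrow>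
    c \<odot>\<^bsub>M v\<^esub> (m \<oplus>\<^bsub>M v\<^esub> m') = c \<odot>\<^bsub>M v\<^esub> m \<oplus>\<^bsub>M v\<^esub> c \<odot>\<^bsub>M v\<^esub> m'"
  using M.smult_r_distr[of c m v m'] by simp

lemma inc_zero [simp]: "inc S v (0\<^sub>v (y v)) = \<zero>\<^bsub>M v\<^esub>"
  using linear_maps_zero[OF _ middle_vectorspace rep_homD(1)[OF inc_hom]] by (simp add: vec_vs)

lemma prj_zero [simp]: "prj S v \<zero>\<^bsub>M v\<^esub> = 0\<^sub>v (x v)"
  using linear_maps_zero[OF middle_vectorspace _ rep_homD(1)[OF prj_hom]] by (simp add: vec_vs)

lemma inc_eq_iff [simp]:
  "w \<in> carrier_vec (y v) \<Longrightarrow> w' \<in> carrier_vec (y v) \<Longrightarrow> inc S v w = inc S v w' \<longleftrightarrow> w = w'"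
  using S_ext by (auto simp: extensions_def inj_on_def)

lemma exact: "inc S v ` carrier_vec (y v) = {m \<in> carrier (M v). prj S v m = 0\<^sub>v (x v)}"
  using S_ext by (auto simp: extensions_def)

lemma prj_inc [simp]: "w \<in> carrier_vec (y v) \<Longrightarrow> prj S v (inc S v w) = 0\<^sub>v (x v)"
  using exact by blast

lemma prj_zeroE:
  assumes "m \<in> carrier (M v)" "prj S v m = 0\<^sub>v (x v)"
  obtains w where "w \<in> carrier_vec (y v)" "m = inc S v w"
  using exact[of v] assms by blast

lemma prj_surj: "prj S v ` carrier (M v) = carrier_vec (x v)"
  using S_ext by (auto simp: extensions_def)

lemma map_inc [simp]:
  "w \<in> carrier_vec (y (source a)) \<Longrightarrow>
    map_at (middle S) a (inc S (source a) w) = inc S (target a) (map_at Y a w)"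
  using rep_homD(3)[OF inc_hom] by simp

lemma prj_map [simp]:
  "m \<in> carrier (M (source a)) \<Longrightarrow>
    prj S (target a) (map_at (middle S) a m) = map_at X a (prj S (source a) m)"
  using rep_homD(3)[OF prj_hom] by simp

text \<open>Exactness in the middle: m - m' is killed by the projection, so it comes from Y.\<close>

lemma M_eq_if_diff: "m \<in> carrier (M v) \<Longrightarrow> m' \<in> carrier (M v) \<Longrightarrow> prj S v m = prj S v m' \<Longrightarrow>
    \<exists>w \<in> carrier_vec (y v). m = inc S v w \<oplus>\<^bsub>M v\<^esub> m'"
proof -
  assume m: "m \<in> carrier (M v)" and m': "m' \<in> carrier (M v)" and eq: "prj S v m = prj S v m'"
  \<comment> \<open>Written as a scalar multiple, the negative is covered by the linearity rules of
    the projection.\<close>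
  have neg: "\<ominus>\<^bsub>M v\<^esub> m' = (- 1) \<odot>\<^bsub>M v\<^esub> m'"
    using M.smult_minus_1[OF m'] by (simp add: class_ring_simps)
  have "prj S v m \<in> carrier_vec (x v)" using m by simp
  then have "prj S v m + - 1 \<cdot>\<^sub>v prj S v m = 0\<^sub>v (x v)" by (auto intro!: eq_vecI)
  then have "prj S v (m \<oplus>\<^bsub>M v\<^esub> \<ominus>\<^bsub>M v\<^esub> m') = 0\<^sub>v (x v)"
    using m m' eq[symmetric] by (simp add: neg)
  then obtain w where w: "w \<in> carrier_vec (y v)" "m \<oplus>\<^bsub>M v\<^esub> \<ominus>\<^bsub>M v\<^esub> m' = inc S v w"
    using m m' by (elim prj_zeroE[rotated]) simp_all
  have "m = (m \<oplus>\<^bsub>M v\<^esub> \<ominus>\<^bsub>M v\<^esub> m') \<oplus>\<^bsub>M v\<^esub> m'"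
    using m m' by (simp add: M.M.a_assoc M.M.l_neg)
  with w show ?thesis by auto
qed

end

text \<open>The defect of the section is stated with a sum instead of a difference, so that only
  addition of the middle record occurs.\<close>

definition is_cocycle_section ::
  "('k::field) vrep \<Rightarrow> 'k extension \<Rightarrow> (arrow \<Rightarrow> 'k vec \<Rightarrow> 'k vec) \<Rightarrow> (vertex \<Rightarrow> 'k vec \<Rightarrow> 'k vec) \<Rightarrow> bool"
where
  "is_cocycle_section X S c s \<longleftrightarrow>
     (\<forall>v. s v \<in> linear_maps (space_at X v) (space_at (middle S) v) \<and>
        (\<forall>z \<in> carrier (space_at X v). prj S v (s v z) = z)) \<and>
     (\<forall>a. \<forall>z \<in> carrier (space_at X (source a)).
        map_at (middle S) a (s (source a) z) =
        inc S (target a) (c a z) \<oplus>\<^bsub>space_at (middle S) (target a)\<^esub> s (target a) (map_at X a z))"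

text \<open>A relation, because each choice of section gives its own cocycle; all cocycles of one
  extension turn out to form a coset of the coboundaries.\<close>

definition (in coordinate_reps) has_cocycle where
  "has_cocycle S c \<longleftrightarrow> S \<in> extensions X Y \<and> c \<in> carrier cochains \<and> (\<exists>s. is_cocycle_section X S c s)"

text \<open>Split only at each vertex: s is a chosen linear section and need not commute with the
  arrows. The sequence of representations splits when c can be taken to be zero
  (\<open>is_split_iff\<close>).\<close>

locale split_extension = extension X Y x y S for X Y :: "'k::field vrep" and x y S +
  fixes c s
  assumes c: "c \<in> carrier cochains" and s: "is_cocycle_section X S c s"
begin

lemma s_linear: "s v \<in> linear_maps (space_at X v) (M v)"
  using s by (simp add: is_cocycle_section_def)

lemmas s_simps [simp] = linear_mapsD[OF s_linear, simplified]
lemmas c_simps [simp] = cochainsD(2-4)[OF c]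

lemma s_zero [simp]: "s v (0\<^sub>v (x v)) = \<zero>\<^bsub>M v\<^esub>"
  using linear_maps_zero[OF _ middle_vectorspace s_linear] by (simp add: vec_vs)

lemma prj_s [simp]: "z \<in> carrier_vec (x v) \<Longrightarrow> prj S v (s v z) = z"
  using s by (simp add: is_cocycle_section_def)

lemma map_s [simp]:
  "z \<in> carrier_vec (x (source a)) \<Longrightarrow> map_at (middle S) a (s (source a) z) =
    inc S (target a) (c a z) \<oplus>\<^bsub>M (target a)\<^esub> s (target a) (map_at X a z)"
  using s by (simp add: is_cocycle_section_def)

text \<open>The retraction onto Y complementary to s. Together, \<open>ret\<close> and
  \<open>prj\<close> identify the middle space with the direct sum of Y and X at each
  vertex.\<close>

definition ret where
  "ret v m = (THE w. w \<in> carrier_vec (y v) \<and> m = inc S v w \<oplus>\<^bsub>M v\<^esub> s v (prj S v m))"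

lemma prj_combine [simp]:
  assumes "w \<in> carrier_vec (y v)" "z \<in> carrier_vec (x v)"
  shows "prj S v (inc S v w \<oplus>\<^bsub>M v\<^esub> s v z) = z"
  using assms by simp

lemma ret_combine [simp]:
  assumes w: "w \<in> carrier_vec (y v)" and z: "z \<in> carrier_vec (x v)"
  shows "ret v (inc S v w \<oplus>\<^bsub>M v\<^esub> s v z) = w"
  unfolding ret_def prj_combine[OF w z]
proof (rule the_equality)
  fix w'
  assume "w' \<in> carrier_vec (y v) \<and> inc S v w \<oplus>\<^bsub>M v\<^esub> s v z = inc S v w' \<oplus>\<^bsub>M v\<^esub> s v z"
  then show "w' = w" using w z by (metis M.M.add.right_cancel inc_eq_iff inc_simps(1) s_simps(1))
qed (use w in simp)

lemma ret: 
  assumes m: "m \<in> carrier (M v)"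
  shows "ret v m \<in> carrier_vec (y v)" and "inc S v (ret v m) \<oplus>\<^bsub>M v\<^esub> s v (prj S v m) = m"
proof -
  obtain w where w: "w \<in> carrier_vec (y v)" "m = inc S v w \<oplus>\<^bsub>M v\<^esub> s v (prj S v m)"
    using M_eq_if_diff[OF m, of "s v (prj S v m)"] m by auto
  have "ret v m = w" using ret_combine[OF w(1), of "prj S v m"] w(2) m by simp
  then show "ret v m \<in> carrier_vec (y v)" "inc S v (ret v m) \<oplus>\<^bsub>M v\<^esub> s v (prj S v m) = m"
    using w by simp_all
qed

lemma combineE:
  assumes "m \<in> carrier (M v)"
  obtains w z where "w \<in> carrier_vec (y v)" "z \<in> carrier_vec (x v)" "m = inc S v w \<oplus>\<^bsub>M v\<^esub> s v z"
  using ret[OF assms] assms by (metis prj_simps(1))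

lemma combine_add:
  assumes "w \<in> carrier_vec (y v)" "w' \<in> carrier_vec (y v)" "z \<in> carrier_vec (x v)" "z' \<in> carrier_vec (x v)"
  shows "(inc S v w \<oplus>\<^bsub>M v\<^esub> s v z) \<oplus>\<^bsub>M v\<^esub> (inc S v w' \<oplus>\<^bsub>M v\<^esub> s v z') =
    inc S v (w + w') \<oplus>\<^bsub>M v\<^esub> s v (z + z')"
  using assms by (simp add: M.M.a_ac)

lemma combine_smult:
  assumes "w \<in> carrier_vec (y v)" "z \<in> carrier_vec (x v)"
  shows "k \<odot>\<^bsub>M v\<^esub> (inc S v w \<oplus>\<^bsub>M v\<^esub> s v z) = inc S v (k \<cdot>\<^sub>v w) \<oplus>\<^bsub>M v\<^esub> s v (k \<cdot>\<^sub>v z)"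
  using assms by simp

text \<open>In the decomposition into Y and X given by s, an arrow acts by a block triangular matrix
  whose diagonal is formed by its actions on Y and X and whose off-diagonal block is the
  cocycle.\<close>

lemma map_combine:
  assumes "w \<in> carrier_vec (y (source a))" "z \<in> carrier_vec (x (source a))"
  shows "map_at (middle S) a (inc S (source a) w \<oplus>\<^bsub>M (source a)\<^esub> s (source a) z) =
    inc S (target a) (map_at Y a w + c a z) \<oplus>\<^bsub>M (target a)\<^esub> s (target a) (map_at X a z)"
  using assms by (simp add: M.M.a_assoc)

lemma ret_simps [simp]:
  shows "m \<in> carrier (M v) \<Longrightarrow> m' \<in> carrier (M v) \<Longrightarrow> ret v (m \<oplus>\<^bsub>M v\<^esub> m') = ret v m + ret v m'"
    and "m \<in> carrier (M v) \<Longrightarrow> ret v (k \<odot>\<^bsub>M v\<^esub> m) = k \<cdot>\<^sub>v ret v m"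
    and "m \<in> carrier (M (source a)) \<Longrightarrow>
      ret (target a) (map_at (middle S) a m) =
      map_at Y a (ret (source a) m) + c a (prj S (source a) m)"
    and "w \<in> carrier_vec (y v) \<Longrightarrow> ret v (inc S v w) = w"
    and "z \<in> carrier_vec (x v) \<Longrightarrow> ret v (s v z) = 0\<^sub>v (y v)"
proof -
  show "w \<in> carrier_vec (y v) \<Longrightarrow> ret v (inc S v w) = w"
    using ret_combine[of w v "0\<^sub>v (x v)"] by simp
  show "z \<in> carrier_vec (x v) \<Longrightarrow> ret v (s v z) = 0\<^sub>v (y v)"
    using ret_combine[of "0\<^sub>v (y v)" v z] by simp
  show "ret (target a) (map_at (middle S) a m) = map_at Y a (ret (source a) m) + c a (prj S (source a) m)"
    if m: "m \<in> carrier (M (source a))"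
    using m
    \<comment> \<open>The deleted rules would break up the normal form \<open>inc w + s z\<close> to
      which \<open>map_combine\<close> applies.\<close>
    by (elim combineE) (simp add: map_combine del: map_simps inc_simps prj_simps(2) s_simps(2,3))
  assume m: "m \<in> carrier (M v)"
  then show "ret v (k \<odot>\<^bsub>M v\<^esub> m) = k \<cdot>\<^sub>v ret v m"
    by (elim combineE) (simp add: combine_smult del: inc_simps(2,3) s_simps(2,3) smult_add)
  assume m': "m' \<in> carrier (M v)"
  show "ret v (m \<oplus>\<^bsub>M v\<^esub> m') = ret v m + ret v m'"
    using m m' by (elim combineE) (simp add: combine_add del: inc_simps(2,3) s_simps(2,3))
qed

lemma ret_zero [simp]: "ret v \<zero>\<^bsub>M v\<^esub> = 0\<^sub>v (y v)"
  using ret_simps(4)[of "0\<^sub>v (y v)" v] by simp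

lemmas ret_closed [simp] = ret(1)

end

lemma smult_zero_vec [simp]: "k \<cdot>\<^sub>v 0\<^sub>v n = (0\<^sub>v n :: 'k::mult_zero vec)"
  by auto

section \<open>Equivalence, scalar multiples and change of section in terms of cocycles\<close>

context coordinate_reps
begin

lemma has_cocycleE:
  assumes "has_cocycle S c"
  obtains s where "split_extension X Y x y S c s"
  using assms coordinate_reps_axioms
  unfolding has_cocycle_def split_extension_def split_extension_axioms_def extension_def extension_axioms_def
  by blast

lemma has_cocycleI:
  "S \<in> extensions X Y \<Longrightarrow> c \<in> carrier cochains \<Longrightarrow> is_cocycle_section X S c s \<Longrightarrow> has_cocycle S c"
  by (auto simp: has_cocycle_def)

lemma is_cocycle_sectionI:
  assumes "\<And>v. s v \<in> linear_maps (module_vec TYPE('k) (x v)) (space_at (middle S) v)"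
    and "\<And>v z. z \<in> carrier_vec (x v) \<Longrightarrow> prj S v (s v z) = z"
    and "\<And>a z. z \<in> carrier_vec (x (source a)) \<Longrightarrow> map_at (middle S) a (s (source a) z) =
        inc S (target a) (c a z) \<oplus>\<^bsub>space_at (middle S) (target a)\<^esub> s (target a) (map_at X a z)"
  shows "is_cocycle_section X S c s"
  using assms by (auto simp: is_cocycle_section_def)

lemma scalar_morphism_exists:
  assumes S: "has_cocycle S c" and T: "has_cocycle T (k \<odot>\<^bsub>cochains\<^esub> c)"
  obtains \<phi> where "\<phi> \<in> rep_hom (middle S) (middle T)"
    and "\<And>v w. w \<in> carrier_vec (y v) \<Longrightarrow> \<phi> v (inc S v w) = inc T v (k \<cdot>\<^sub>v w)"
    and "\<And>v m. m \<in> carrier (space_at (middle S) v) \<Longrightarrow> prj T v (\<phi> v m) = prj S v m"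
proof -
  obtain s where "split_extension X Y x y S c s" using S by (rule has_cocycleE)
  then interpret S: split_extension X Y x y S c s .
  obtain t where "split_extension X Y x y T (k \<odot>\<^bsub>cochains\<^esub> c) t" using T by (rule has_cocycleE)
  then interpret T: split_extension X Y x y T "k \<odot>\<^bsub>cochains\<^esub> c" t .
  \<comment> \<open>Block diagonal in the two decompositions: k on Y and the identity on X. It
    commutes with the arrows because the off-diagonal block of T is k times that of S.\<close>
  define \<phi> where "\<phi> v = (\<lambda>m \<in> carrier (S.M v). inc T v (k \<cdot>\<^sub>v S.ret v m) \<oplus>\<^bsub>T.M v\<^esub> t v (prj S v m))" for v
  have ap: "\<phi> v m = inc T v (k \<cdot>\<^sub>v S.ret v m) \<oplus>\<^bsub>T.M v\<^esub> t v (prj S v m)" if "m \<in> carrier (S.M v)" for v m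
    using that by (simp add: \<phi>_def)
  show ?thesis
  proof (rule that)
    show "\<phi> \<in> rep_hom (middle S) (middle T)"
    proof (rule rep_homI)
      fix v
      show "\<phi> v \<in> linear_maps (S.M v) (T.M v)"
      proof (rule linear_mapsI)
        fix m l assume m: "m \<in> carrier (S.M v)"
        have "k \<cdot>\<^sub>v (l \<cdot>\<^sub>v S.ret v m) = l \<cdot>\<^sub>v (k \<cdot>\<^sub>v S.ret v m)"
          by (auto simp: mult.left_commute)
        then show "\<phi> v (l \<odot>\<^bsub>S.M v\<^esub> m) = l \<odot>\<^bsub>T.M v\<^esub> \<phi> v m"
          using m by (simp add: ap T.combine_smult del: T.inc_simps(2,3) T.s_simps(2,3) T.smult_add)
        fix m' assume m': "m' \<in> carrier (S.M v)"
        show "\<phi> v (m \<oplus>\<^bsub>S.M v\<^esub> m') = \<phi> v m \<oplus>\<^bsub>T.M v\<^esub> \<phi> v m'"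
          using m m' by (simp add: ap T.combine_add smult_add_distrib_vec[of _ "y v"]
              del: T.inc_simps(2,3) T.s_simps(2,3))
      qed (simp add: ap)
      show "\<phi> v \<in> extensional (carrier (S.M v))" by (simp add: \<phi>_def)
    next
      fix a m assume m: "m \<in> carrier (S.M (source a))"
      then show "\<phi> (target a) (map_at (middle S) a m) = map_at (middle T) a (\<phi> (source a) m)"
        by (simp add: ap T.map_combine cochains_apply smult_add_distrib_vec[of _ "y (target a)"]
            del: T.inc_simps(2,3) T.s_simps(2,3) T.map_simps)
    qed
  qed (simp_all add: ap)
qed

text \<open>The map \<open>\<phi>\<close> carries a section of S to a section of T, and its defect
  \<open>inc S c\<close> to \<open>inc T (k c)\<close>.\<close>

lemma has_cocycle_scalar_multiple:
  assumes S: "has_cocycle S c" and T: "T \<in> extensions X Y"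
    and \<phi>: "\<phi> \<in> rep_hom (middle S) (middle T)"
    and inc: "\<And>v w. w \<in> carrier_vec (y v) \<Longrightarrow> \<phi> v (inc S v w) = inc T v (k \<cdot>\<^sub>v w)"
    and prj: "\<And>v m. m \<in> carrier (space_at (middle S) v) \<Longrightarrow> prj T v (\<phi> v m) = prj S v m"
  shows "has_cocycle T (k \<odot>\<^bsub>cochains\<^esub> c)"
proof -
  obtain s where "split_extension X Y x y S c s" using S by (rule has_cocycleE)
  then interpret S: split_extension X Y x y S c s .
  note \<phi>D = linear_mapsD[OF rep_homD(1)[OF \<phi>]]
  show ?thesis
  proof (rule has_cocycleI[OF T])
    show "k \<odot>\<^bsub>cochains\<^esub> c \<in> carrier cochains" using C.smult_closed[of k c] S.c by simp
    show "is_cocycle_section X T (k \<odot>\<^bsub>cochains\<^esub> c) (\<lambda>v z. \<phi> v (s v z))"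
    proof (rule is_cocycle_sectionI)
      fix a and z :: "'k vec" assume z: "z \<in> carrier_vec (x (source a))"
      have "map_at (middle T) a (\<phi> (source a) (s (source a) z)) =
          \<phi> (target a) (map_at (middle S) a (s (source a) z))"
        using rep_homD(3)[OF \<phi>, of "s (source a) z" a] z by (simp del: S.map_s)
      then show "map_at (middle T) a (\<phi> (source a) (s (source a) z)) =
          inc T (target a) ((k \<odot>\<^bsub>cochains\<^esub> c) a z) \<oplus>\<^bsub>space_at (middle T) (target a)\<^esub>
          \<phi> (target a) (s (target a) (map_at X a z))"
        using z by (simp add: \<phi>D inc cochains_apply)
    next
      fix v
      show "(\<lambda>z. \<phi> v (s v z)) \<in> linear_maps (module_vec TYPE('k) (x v)) (space_at (middle T) v)"
        by (rule linear_mapsI) (simp_all add: \<phi>D)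
    qed (simp add: prj)
  qed
qed

lemma is_scalar_multiple_iff:
  assumes "has_cocycle S c"
  shows "is_scalar_multiple X Y k S T \<longleftrightarrow> has_cocycle T (k \<odot>\<^bsub>cochains\<^esub> c)"
proof
  assume "is_scalar_multiple X Y k S T"
  then show "has_cocycle T (k \<odot>\<^bsub>cochains\<^esub> c)"
    unfolding is_scalar_multiple_def using has_cocycle_scalar_multiple[OF assms] by auto
next
  assume T: "has_cocycle T (k \<odot>\<^bsub>cochains\<^esub> c)"
  obtain \<phi> where "\<phi> \<in> rep_hom (middle S) (middle T)"
    "\<And>v w. w \<in> carrier_vec (y v) \<Longrightarrow> \<phi> v (inc S v w) = inc T v (k \<cdot>\<^sub>v w)"
    "\<And>v m. m \<in> carrier (space_at (middle S) v) \<Longrightarrow> prj T v (\<phi> v m) = prj S v m"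
    using scalar_morphism_exists[OF assms T] by blast
  then show "is_scalar_multiple X Y k S T"
    using T unfolding is_scalar_multiple_def has_cocycle_def by (auto intro!: bexI[of _ \<phi>])
qed

text \<open>An equivalence is a morphism as for the scalar 1 that is bijective as well; bijectivity
  is automatic by the short five lemma.\<close>

lemma ext_equiv_iff:
  assumes S: "has_cocycle S c"
  shows "(S, T) \<in> ext_equiv X Y \<longleftrightarrow> has_cocycle T c"
proof -
  have c: "c \<in> carrier cochains" using S by (simp add: has_cocycle_def)
  have one: "1 \<odot>\<^bsub>cochains\<^esub> c = c" using C.smult_one[OF c] by simp
  show ?thesis
  proof
    assume "(S, T) \<in> ext_equiv X Y"
    then have "is_scalar_multiple X Y 1 S T"
      unfolding ext_equiv_def is_scalar_multiple_def by auto
    then show "has_cocycle T c" using is_scalar_multiple_iff[OF S, of 1 T] one by simp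
  next
    assume T: "has_cocycle T c"
    then have T1: "has_cocycle T (1 \<odot>\<^bsub>cochains\<^esub> c)" by (simp add: one)
    obtain s where "split_extension X Y x y S c s" using S by (rule has_cocycleE)
    then interpret S: split_extension X Y x y S c s .
    obtain t where "split_extension X Y x y T c t" using T by (rule has_cocycleE)
    then interpret T: split_extension X Y x y T c t .
    obtain \<phi> where \<phi>: "\<phi> \<in> rep_hom (middle S) (middle T)"
      and inc: "\<And>v w. w \<in> carrier_vec (y v) \<Longrightarrow> \<phi> v (inc S v w) = inc T v (1 \<cdot>\<^sub>v w)"
      and prj: "\<And>v m. m \<in> carrier (S.M v) \<Longrightarrow> prj T v (\<phi> v m) = prj S v m"
      using scalar_morphism_exists[OF S T1] by blast
    note \<phi>D = linear_mapsD[OF rep_homD(1)[OF \<phi>]]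
    have bij: "bij_betw (\<phi> v) (carrier (S.M v)) (carrier (T.M v))" for v
    proof (rule bij_betwI')
      fix n assume n: "n \<in> carrier (T.M v)"
      \<comment> \<open>A lift of n that is right only in its X-component; the error comes from Y
        and is corrected by \<open>inc S v w\<close>.\<close>
      let ?m = "s v (prj T v n)"
      obtain w where w: "w \<in> carrier_vec (y v)" "n = inc T v w \<oplus>\<^bsub>T.M v\<^esub> \<phi> v ?m"
        using T.M_eq_if_diff[OF n, of "\<phi> v ?m"] n by (auto simp: prj \<phi>D)
      have "n = \<phi> v (inc S v w \<oplus>\<^bsub>S.M v\<^esub> ?m)" using w n by (simp add: \<phi>D inc)
      then show "\<exists>m\<in>carrier (S.M v). n = \<phi> v m"
        using w n by (intro bexI[of _ "inc S v w \<oplus>\<^bsub>S.M v\<^esub> ?m"]) simp_all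
    next
      fix m m' assume m: "m \<in> carrier (S.M v)" and m': "m' \<in> carrier (S.M v)"
      have "m = m'" if eq: "\<phi> v m = \<phi> v m'"
      proof -
        have "prj S v m = prj S v m'" using prj[OF m] prj[OF m'] eq by simp
        then obtain w where w: "w \<in> carrier_vec (y v)" "m = inc S v w \<oplus>\<^bsub>S.M v\<^esub> m'"
          using S.M_eq_if_diff[OF m m'] by auto
        then have "inc T v w \<oplus>\<^bsub>T.M v\<^esub> \<phi> v m' = \<phi> v m'" using eq m' by (simp add: \<phi>D inc)
        then have "inc T v w = \<zero>\<^bsub>T.M v\<^esub>"
          using w m' \<phi>D(1)[OF m'] T.M.M.add.right_cancel[of "\<phi> v m'" v "inc T v w" "\<zero>\<^bsub>T.M v\<^esub>"] by simp
        then have "w = 0\<^sub>v (y v)" using w T.inc_eq_iff[of w v "0\<^sub>v (y v)"] by simp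
        then show ?thesis using w m' by simp
      qed
      then show "(\<phi> v m = \<phi> v m') = (m = m')" by auto
    qed (rule \<phi>D)
    show "(S, T) \<in> ext_equiv X Y"
      unfolding ext_equiv_def using S.S_ext T.S_ext \<phi> bij inc prj by (auto intro!: bexI[of _ \<phi>])
  qed
qed

text \<open>Two sections of one projection differ by a map into Y, and this map is h.\<close>

lemma cocycle_difference:
  assumes "has_cocycle S c" "has_cocycle S c'"
  obtains h where "h \<in> carrier vertex_maps" "c' = c \<oplus>\<^bsub>cochains\<^esub> coboundary h"
proof -
  obtain s where "split_extension X Y x y S c s" using assms(1) by (rule has_cocycleE)
  then interpret S: split_extension X Y x y S c s .
  obtain t where "split_extension X Y x y S c' t" using assms(2) by (rule has_cocycleE)
  then interpret T: split_extension X Y x y S c' t .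
  define h where "h v = (\<lambda>z \<in> carrier_vec (x v). S.ret v (t v z))" for v
  have h: "h \<in> carrier vertex_maps"
    by (rule vertex_mapsI) (auto simp: h_def intro!: linear_mapsI)
  have "c' = c \<oplus>\<^bsub>cochains\<^esub> coboundary h"
  proof (rule cochains_eqI)
    fix a and z :: "'k vec" assume z: "z \<in> carrier_vec (x (source a))"
    \<comment> \<open>The Y-component of the arrow applied to \<open>t z\<close> is computed twice:
      from the block form given by s, and from the cocycle equation of t.\<close>
    have "S.ret (target a) (map_at (middle S) a (t (source a) z)) =
        map_at Y a (h (source a) z) + c a z"
      using z by (simp add: h_def del: T.map_s)
    moreover have "S.ret (target a) (map_at (middle S) a (t (source a) z)) =
        c' a z + h (target a) (map_at X a z)"
      using z by (simp add: h_def del: S.ret_simps(3))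
    ultimately have eq: "map_at Y a (h (source a) z) + c a z = c' a z + h (target a) (map_at X a z)" by simp
    have cl: "map_at Y a (h (source a) z) \<in> carrier_vec (y (target a))"
      "h (target a) (map_at X a z) \<in> carrier_vec (y (target a))"
      "c a z \<in> carrier_vec (y (target a))" "c' a z \<in> carrier_vec (y (target a))"
      using z vertex_mapsD(2)[OF h] by simp_all
    have "c' a z = c a z + (map_at Y a (h (source a) z) - h (target a) (map_at X a z))"
    proof (rule eq_vecI)
      fix i assume i: "i < dim_vec (c a z + (map_at Y a (h (source a) z) - h (target a) (map_at X a z)))"
      then have "(map_at Y a (h (source a) z) + c a z) $ i = (c' a z + h (target a) (map_at X a z)) $ i"
        using eq by simp
      then show "c' a z $ i = (c a z + (map_at Y a (h (source a) z) - h (target a) (map_at X a z))) $ i"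
        using i cl by (simp add: algebra_simps)
    qed (use cl in simp)
    then show "c' a z = (c \<oplus>\<^bsub>cochains\<^esub> coboundary h) a z"
      using z by (simp add: cochains_apply coboundary_apply)
  qed (use S.c T.c coboundary_closed[OF h] in simp_all)
  with h show ?thesis by (rule that)
qed

text \<open>The converse of \<open>cocycle_difference\<close>: the extension stays the same and its
  section s is replaced by \<open>inc h + s\<close>.\<close>

lemma has_cocycle_add_coboundary:
  assumes "has_cocycle S c" and h: "h \<in> carrier vertex_maps"
  shows "has_cocycle S (c \<oplus>\<^bsub>cochains\<^esub> coboundary h)"
proof -
  obtain s where "split_extension X Y x y S c s" using assms(1) by (rule has_cocycleE)
  then interpret S: split_extension X Y x y S c s .
  note [simp] = vertex_mapsD(2-)[OF h]
  show ?thesis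
  proof (rule has_cocycleI[OF S.S_ext])
    show "is_cocycle_section X S (c \<oplus>\<^bsub>cochains\<^esub> coboundary h)
        (\<lambda>v z. inc S v (h v z) \<oplus>\<^bsub>S.M v\<^esub> s v z)"
    proof (rule is_cocycle_sectionI)
      fix v
      show "(\<lambda>z. inc S v (h v z) \<oplus>\<^bsub>S.M v\<^esub> s v z) \<in> linear_maps (module_vec TYPE('k) (x v)) (S.M v)"
        by (rule linear_mapsI)
           (simp_all add: S.combine_add S.combine_smult del: S.inc_simps(2,3) S.s_simps(2,3) S.smult_add)
    next
      fix a and z :: "'k vec" assume z: "z \<in> carrier_vec (x (source a))"
      have "map_at Y a (h (source a) z) \<in> carrier_vec (y (target a))"
        "h (target a) (map_at X a z) \<in> carrier_vec (y (target a))" "c a z \<in> carrier_vec (y (target a))"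
        using z by simp_all
      then have "map_at Y a (h (source a) z) + c a z =
          c a z + (map_at Y a (h (source a) z) - h (target a) (map_at X a z)) + h (target a) (map_at X a z)"
        by (intro eq_vecI) (auto simp: algebra_simps)
      then show "map_at (middle S) a (inc S (source a) (h (source a) z) \<oplus>\<^bsub>S.M (source a)\<^esub> s (source a) z) =
          inc S (target a) ((c \<oplus>\<^bsub>cochains\<^esub> coboundary h) a z) \<oplus>\<^bsub>S.M (target a)\<^esub>
          (inc S (target a) (h (target a) (map_at X a z)) \<oplus>\<^bsub>S.M (target a)\<^esub> s (target a) (map_at X a z))"
        using z S.inc_simps(2)[symmetric]
        by (simp add: S.map_combine cochains_apply coboundary_apply S.M.M.a_assoc[symmetric]
            del: S.inc_simps(2) S.map_simps)
    qed simp
  qed (use S.c coboundary_closed[OF h] in simp)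
qed

text \<open>Sections are chosen vertex by vertex. The defect of a section exists pointwise by
  exactness, and injectivity of the inclusion makes it linear.\<close>

lemma has_cocycle_exists:
  assumes "S \<in> extensions X Y"
  obtains c where "has_cocycle S c"
proof -
  interpret S: extension X Y x y S using assms by unfold_locales
  have "\<exists>s. s \<in> linear_maps (module_vec TYPE('k) (x v)) (S.M v) \<and>
      (\<forall>z \<in> carrier_vec (x v). prj S v (s z) = z)" for v
  proof -
    have p: "prj S v \<in> linear_maps (S.M v) (module_vec TYPE('k) (x v))"
      using rep_homD(1)[OF S.prj_hom, of v] by simp
    show ?thesis
      by (rule linear_section_exists[OF S.middle_vectorspace p S.prj_surj]) blast
  qed
  then have "\<exists>s. \<forall>v. s v \<in> linear_maps (module_vec TYPE('k) (x v)) (S.M v) \<and>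
      (\<forall>z \<in> carrier_vec (x v). prj S v (s v z) = z)" by (intro choice) blast
  then obtain s where s: "\<And>v. s v \<in> linear_maps (module_vec TYPE('k) (x v)) (S.M v)"
    and prj: "\<And>v z. z \<in> carrier_vec (x v) \<Longrightarrow> prj S v (s v z) = z"
    by blast
  note sD = linear_mapsD[OF s, simplified]
  have "\<exists>w. w \<in> carrier_vec (y (target a)) \<and> map_at (middle S) a (s (source a) z) =
      inc S (target a) w \<oplus>\<^bsub>S.M (target a)\<^esub> s (target a) (map_at X a z)"
    if "z \<in> carrier_vec (x (source a))" for a z
    using S.M_eq_if_diff[of "map_at (middle S) a (s (source a) z)" "target a" "s (target a) (map_at X a z)"]
      that by (auto simp: sD prj)
  \<comment> \<open>Arrow and vector are packed into a pair so that a single choice yields the whole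
    cochain.\<close>
  then have "\<exists>c0. \<forall>p. snd p \<in> carrier_vec (x (source (fst p))) \<longrightarrow>
      c0 p \<in> carrier_vec (y (target (fst p))) \<and>
      map_at (middle S) (fst p) (s (source (fst p)) (snd p)) =
      inc S (target (fst p)) (c0 p) \<oplus>\<^bsub>S.M (target (fst p))\<^esub> s (target (fst p)) (map_at X (fst p) (snd p))"
    by (intro choice) blast
  then obtain c1 where c1: "\<And>p. snd p \<in> carrier_vec (x (source (fst p))) \<Longrightarrow>
      c1 p \<in> carrier_vec (y (target (fst p))) \<and>
      map_at (middle S) (fst p) (s (source (fst p)) (snd p)) =
      inc S (target (fst p)) (c1 p) \<oplus>\<^bsub>S.M (target (fst p))\<^esub> s (target (fst p)) (map_at X (fst p) (snd p))"
    by blast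
  define c0 where "c0 a z = c1 (a, z)" for a z
  have c0: "c0 a z \<in> carrier_vec (y (target a))"
    and eq: "map_at (middle S) a (s (source a) z) =
      inc S (target a) (c0 a z) \<oplus>\<^bsub>S.M (target a)\<^esub> s (target a) (map_at X a z)"
    if "z \<in> carrier_vec (x (source a))" for a z
    using c1[of "(a, z)"] that by (simp_all add: c0_def)
  define c where "c a = restrict (c0 a) (carrier_vec (x (source a)))" for a
  \<comment> \<open>Uniqueness of the Y-component: it turns equalities in the middle term into
    linearity of \<open>c0\<close>.\<close>
  have cancel: "w = w'" if "w \<in> carrier_vec (y v)" "w' \<in> carrier_vec (y v)" "m \<in> carrier (S.M v)"
      "inc S v w \<oplus>\<^bsub>S.M v\<^esub> m = inc S v w' \<oplus>\<^bsub>S.M v\<^esub> m" for v w w' m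
    using that by simp
  have "c \<in> carrier cochains"
  proof (rule cochainsI)
    fix a
    show "c a \<in> linear_maps (module_vec TYPE('k) (x (source a))) (module_vec TYPE('k) (y (target a)))"
    proof (rule linear_mapsI)
      fix z k assume "z \<in> carrier (module_vec TYPE('k) (x (source a)))"
      then have z: "z \<in> carrier_vec (x (source a))" by simp
      show "c a z \<in> carrier (module_vec TYPE('k) (y (target a)))" using z by (simp add: c_def c0)
      let ?t = "target a"
      have "inc S ?t (c0 a (k \<cdot>\<^sub>v z)) \<oplus>\<^bsub>S.M ?t\<^esub> s ?t (map_at X a (k \<cdot>\<^sub>v z)) =
          k \<odot>\<^bsub>S.M ?t\<^esub> map_at (middle S) a (s (source a) z)"
        using eq[of "k \<cdot>\<^sub>v z" a] z by (simp add: sD)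
      also have "\<dots> = inc S ?t (k \<cdot>\<^sub>v c0 a z) \<oplus>\<^bsub>S.M ?t\<^esub> s ?t (map_at X a (k \<cdot>\<^sub>v z))"
        unfolding eq[OF z] using z by (simp add: sD c0)
      finally have "c0 a (k \<cdot>\<^sub>v z) = k \<cdot>\<^sub>v c0 a z"
        by (rule cancel[rotated -1]) (simp_all add: c0 sD z)
      then show "c a (k \<odot>\<^bsub>module_vec TYPE('k) (x (source a))\<^esub> z) = k \<odot>\<^bsub>module_vec TYPE('k) (y (target a))\<^esub> c a z"
        using z by (simp add: c_def)
      fix z' assume "z' \<in> carrier (module_vec TYPE('k) (x (source a)))"
      then have z': "z' \<in> carrier_vec (x (source a))" by simp
      have "inc S ?t (c0 a (z + z')) \<oplus>\<^bsub>S.M ?t\<^esub> s ?t (map_at X a (z + z')) =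
          map_at (middle S) a (s (source a) z) \<oplus>\<^bsub>S.M ?t\<^esub> map_at (middle S) a (s (source a) z')"
        using eq[of "z + z'" a] z z' by (simp add: sD)
      also have "\<dots> = inc S ?t (c0 a z + c0 a z') \<oplus>\<^bsub>S.M ?t\<^esub> s ?t (map_at X a (z + z'))"
        unfolding eq[OF z] eq[OF z'] using z z' by (simp add: sD c0 S.M.M.a_ac)
      finally have "c0 a (z + z') = c0 a z + c0 a z'"
        by (rule cancel[rotated -1]) (simp_all add: c0 sD z z')
      then show "c a (z \<oplus>\<^bsub>module_vec TYPE('k) (x (source a))\<^esub> z') =
          c a z \<oplus>\<^bsub>module_vec TYPE('k) (y (target a))\<^esub> c a z'"
        using z z' by (simp add: c_def)
    qed
    show "c a \<in> extensional (carrier_vec (x (source a)))" by (simp add: c_def)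
  qed
  moreover have "is_cocycle_section X S c s"
    using eq by (intro is_cocycle_sectionI s prj) (simp_all add: c_def)
  ultimately show ?thesis using assms by (intro that has_cocycleI)
qed

end

section \<open>Baer sums and split extensions in terms of cocycles\<close>

context coordinate_reps
begin

text \<open>Sections s and t of the two projections pair to a section of the fibre product over X.
  Its image under \<open>\<sigma>\<close> is a section of U, with the two defects added.\<close>

lemma has_cocycle_baer_sum:
  assumes S: "has_cocycle S c" and T: "has_cocycle T c'" and U: "is_baer_sum X Y S T U"
  shows "has_cocycle U (c \<oplus>\<^bsub>cochains\<^esub> c')"
proof -
  obtain s where "split_extension X Y x y S c s" using S by (rule has_cocycleE)
  then interpret S: split_extension X Y x y S c s .
  obtain t where "split_extension X Y x y T c' t" using T by (rule has_cocycleE)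
  then interpret T: split_extension X Y x y T c' t .
  interpret U: extension X Y x y U using U by unfold_locales (simp add: is_baer_sum_def)
  let ?P = "fibre_product S T"
  have P: "(m, n) \<in> carrier (space_at ?P v) \<longleftrightarrow>
      m \<in> carrier (S.M v) \<and> n \<in> carrier (T.M v) \<and> prj S v m = prj T v n" for m n v
    by (simp add: fibre_product_def)
  have P_add: "(m, n) \<oplus>\<^bsub>space_at ?P v\<^esub> (m', n') = (m \<oplus>\<^bsub>S.M v\<^esub> m', n \<oplus>\<^bsub>T.M v\<^esub> n')" for m n m' n' v
    by (simp add: fibre_product_def direct_sum_def)
  have P_smult: "k \<odot>\<^bsub>space_at ?P v\<^esub> (m, n) = (k \<odot>\<^bsub>S.M v\<^esub> m, k \<odot>\<^bsub>T.M v\<^esub> n)" for k m n v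
    by (simp add: fibre_product_def direct_sum_def)
  obtain \<sigma> where \<sigma>: "\<sigma> \<in> rep_hom ?P (middle U)"
    and ker: "\<And>v. {z \<in> carrier (space_at ?P v). \<sigma> v z = \<zero>\<^bsub>U.M v\<^esub>} =
      (\<lambda>w. (inc S v w, inc T v (\<ominus>\<^bsub>space_at Y v\<^esub> w))) ` carrier (space_at Y v)"
    and inc: "\<And>v w. w \<in> carrier_vec (y v) \<Longrightarrow> \<sigma> v (inc S v w, \<zero>\<^bsub>T.M v\<^esub>) = inc U v w"
    and prj: "\<And>v m n. (m, n) \<in> carrier (space_at ?P v) \<Longrightarrow> prj U v (\<sigma> v (m, n)) = prj S v m"
    using U unfolding is_baer_sum_def by fastforce
  note \<sigma>D = linear_mapsD[OF rep_homD(1)[OF \<sigma>]]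
  have \<sigma>_add: "\<sigma> v (m \<oplus>\<^bsub>S.M v\<^esub> m', n \<oplus>\<^bsub>T.M v\<^esub> n') = \<sigma> v (m, n) \<oplus>\<^bsub>U.M v\<^esub> \<sigma> v (m', n')"
    if "(m, n) \<in> carrier (space_at ?P v)" "(m', n') \<in> carrier (space_at ?P v)" for m n m' n' v
    using \<sigma>D(2)[OF that] by (simp add: P_add)
  \<comment> \<open>The definition prescribes \<open>\<sigma>\<close> on the first copy of Y only.
    The second copy agrees with it modulo the antidiagonal, which \<open>\<sigma>\<close>
    kills.\<close>
  have inc': "\<sigma> v (\<zero>\<^bsub>S.M v\<^esub>, inc T v w) = inc U v w" if w: "w \<in> carrier_vec (y v)" for v w
  proof -
    let ?w = "\<ominus>\<^bsub>module_vec TYPE('k) (y v)\<^esub> w"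
    interpret Y: vectorspace class_ring "module_vec TYPE('k) (y v)" by (rule vec_vs)
    have w': "?w \<in> carrier_vec (y v)" using Y.M.a_inv_closed[of w] w by simp
    have z: "inc T v ?w \<oplus>\<^bsub>T.M v\<^esub> inc T v w = \<zero>\<^bsub>T.M v\<^esub>"
      using T.inc_simps(2)[OF w' w, symmetric] Y.M.l_neg[of w] w by simp
    have p1: "(inc S v w, inc T v ?w) \<in> carrier (space_at ?P v)"
      and p2: "(\<zero>\<^bsub>S.M v\<^esub>, inc T v w) \<in> carrier (space_at ?P v)"
      using w w' by (simp_all add: P)
    have k: "\<sigma> v (inc S v w, inc T v ?w) = \<zero>\<^bsub>U.M v\<^esub>" using ker[of v] w by auto
    have "inc U v w = \<sigma> v (inc S v w \<oplus>\<^bsub>S.M v\<^esub> \<zero>\<^bsub>S.M v\<^esub>, inc T v ?w \<oplus>\<^bsub>T.M v\<^esub> inc T v w)"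
      using w by (simp only: z) (simp add: inc)
    also have "\<dots> = \<sigma> v (\<zero>\<^bsub>S.M v\<^esub>, inc T v w)"
      using \<sigma>_add[OF p1 p2] k \<sigma>D(1)[OF p2] by simp
    finally show ?thesis by simp
  qed
  let ?u = "\<lambda>v z. \<sigma> v (s v z, t v z)"
  have st: "(s v z, t v z) \<in> carrier (space_at ?P v)" if "z \<in> carrier_vec (x v)" for v z
    using that by (simp add: P)
  show ?thesis
  proof (rule has_cocycleI[OF U.S_ext])
    show "is_cocycle_section X U (c \<oplus>\<^bsub>cochains\<^esub> c') ?u"
    proof (rule is_cocycle_sectionI)
      fix v
      show "?u v \<in> linear_maps (module_vec TYPE('k) (x v)) (U.M v)"
      proof (rule linear_mapsI)
        fix z k assume z: "z \<in> carrier (module_vec TYPE('k) (x v))"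
        show "?u v z \<in> carrier (U.M v)" using z by (simp add: \<sigma>D(1) st)
        show "?u v (k \<odot>\<^bsub>module_vec TYPE('k) (x v)\<^esub> z) = k \<odot>\<^bsub>U.M v\<^esub> ?u v z"
          using \<sigma>D(3)[OF st, of z v k] z by (simp add: P_smult)
        fix z' assume z': "z' \<in> carrier (module_vec TYPE('k) (x v))"
        show "?u v (z \<oplus>\<^bsub>module_vec TYPE('k) (x v)\<^esub> z') = ?u v z \<oplus>\<^bsub>U.M v\<^esub> ?u v z'"
          using \<sigma>_add[OF st st, of z v z'] z z' by simp
      qed
    next
      fix a and z :: "'k vec" assume z: "z \<in> carrier_vec (x (source a))"
      let ?t = "target a"
      have p1: "(s ?t (map_at X a z), t ?t (map_at X a z)) \<in> carrier (space_at ?P ?t)"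
        using z by (intro st) simp
      have p2: "(inc S ?t (c a z), \<zero>\<^bsub>T.M ?t\<^esub>) \<in> carrier (space_at ?P ?t)"
        and p3: "(\<zero>\<^bsub>S.M ?t\<^esub>, inc T ?t (c' a z)) \<in> carrier (space_at ?P ?t)"
        and p4: "(inc S ?t (c a z), inc T ?t (c' a z)) \<in> carrier (space_at ?P ?t)"
        using z by (simp_all add: P)
      have "map_at (middle U) a (?u (source a) z) =
          \<sigma> ?t (map_at (middle S) a (s (source a) z), map_at (middle T) a (t (source a) z))"
        using rep_homD(3)[OF \<sigma>, of "(s (source a) z, t (source a) z)" a] st[OF z]
        by (simp add: fibre_product_def)
      also have "\<dots> = \<sigma> ?t (inc S ?t (c a z) \<oplus>\<^bsub>S.M ?t\<^esub> s ?t (map_at X a z),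
          inc T ?t (c' a z) \<oplus>\<^bsub>T.M ?t\<^esub> t ?t (map_at X a z))"
        using z by simp
      also have "\<dots> = \<sigma> ?t (inc S ?t (c a z), inc T ?t (c' a z)) \<oplus>\<^bsub>U.M ?t\<^esub> ?u ?t (map_at X a z)"
        by (rule \<sigma>_add[OF p4 p1])
      also have "\<sigma> ?t (inc S ?t (c a z), inc T ?t (c' a z)) = inc U ?t (c a z) \<oplus>\<^bsub>U.M ?t\<^esub> inc U ?t (c' a z)"
        using \<sigma>_add[OF p2 p3] z by (simp add: inc inc')
      also have "\<dots> = inc U ?t ((c \<oplus>\<^bsub>cochains\<^esub> c') a z)"
        using z by (simp add: cochains_apply)
      finally show "map_at (middle U) a (?u (source a) z) =
          inc U ?t ((c \<oplus>\<^bsub>cochains\<^esub> c') a z) \<oplus>\<^bsub>U.M ?t\<^esub> ?u ?t (map_at X a z)" .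
    qed (simp add: prj st)
  qed (use S.c T.c in simp)
qed

lemma is_baer_sumI:
  assumes S: "has_cocycle S c" and T: "has_cocycle T c'" and U: "has_cocycle U (c \<oplus>\<^bsub>cochains\<^esub> c')"
  shows "is_baer_sum X Y S T U"
proof -
  obtain s where "split_extension X Y x y S c s" using S by (rule has_cocycleE)
  then interpret S: split_extension X Y x y S c s .
  obtain t where "split_extension X Y x y T c' t" using T by (rule has_cocycleE)
  then interpret T: split_extension X Y x y T c' t .
  obtain u where "split_extension X Y x y U (c \<oplus>\<^bsub>cochains\<^esub> c') u" using U by (rule has_cocycleE)
  then interpret U: split_extension X Y x y U "c \<oplus>\<^bsub>cochains\<^esub> c'" u .
  let ?P = "fibre_product S T"
  have P: "carrier (space_at ?P v) = {(m, n). m \<in> carrier (S.M v) \<and> n \<in> carrier (T.M v) \<and> prj S v m = prj T v n}" for v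
    by (simp add: fibre_product_def)
  have P_add: "p \<oplus>\<^bsub>space_at ?P v\<^esub> q = (fst p \<oplus>\<^bsub>S.M v\<^esub> fst q, snd p \<oplus>\<^bsub>T.M v\<^esub> snd q)" for p q v
    by (simp add: fibre_product_def direct_sum_def)
  have P_smult: "k \<odot>\<^bsub>space_at ?P v\<^esub> p = (k \<odot>\<^bsub>S.M v\<^esub> fst p, k \<odot>\<^bsub>T.M v\<^esub> snd p)" for k p v
    by (simp add: fibre_product_def direct_sum_def)
  have P_map: "map_at ?P a p = (map_at (middle S) a (fst p), map_at (middle T) a (snd p))" for a p
    by (simp add: fibre_product_def split_def)
  \<comment> \<open>In coordinates: add the two Y-components and keep the common
    X-component.\<close>
  define \<sigma> where "\<sigma> v = (\<lambda>p \<in> carrier (space_at ?P v).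
      inc U v (S.ret v (fst p) + T.ret v (snd p)) \<oplus>\<^bsub>U.M v\<^esub> u v (prj S v (fst p)))" for v
  have ap: "\<sigma> v (m, n) = inc U v (S.ret v m + T.ret v n) \<oplus>\<^bsub>U.M v\<^esub> u v (prj S v m)"
    if "m \<in> carrier (S.M v)" "n \<in> carrier (T.M v)" "prj S v m = prj T v n" for v m n
    using that by (simp add: \<sigma>_def P)
  have \<sigma>: "\<sigma> \<in> rep_hom ?P (middle U)"
  proof (rule rep_homI)
    fix v
    show "\<sigma> v \<in> linear_maps (space_at ?P v) (U.M v)"
    proof (rule linear_mapsI)
      fix p k assume "p \<in> carrier (space_at ?P v)"
      then obtain m n where p: "p = (m, n)" and m: "m \<in> carrier (S.M v)" and n: "n \<in> carrier (T.M v)"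
        and e: "prj S v m = prj T v n" by (auto simp: P)
      show "\<sigma> v p \<in> carrier (U.M v)" using m n e by (simp add: p ap)
      show "\<sigma> v (k \<odot>\<^bsub>space_at ?P v\<^esub> p) = k \<odot>\<^bsub>U.M v\<^esub> \<sigma> v p"
        using m n e by (simp add: p ap P_smult U.combine_smult smult_add_distrib_vec[of _ "y v"]
            del: U.inc_simps(2,3) U.s_simps(2,3) U.smult_add)
      fix q assume "q \<in> carrier (space_at ?P v)"
      then obtain m' n' where q: "q = (m', n')" and m': "m' \<in> carrier (S.M v)" and n': "n' \<in> carrier (T.M v)"
        and e': "prj S v m' = prj T v n'" by (auto simp: P)
      have "S.ret v m \<in> carrier_vec (y v)" "S.ret v m' \<in> carrier_vec (y v)"
        "T.ret v n \<in> carrier_vec (y v)" "T.ret v n' \<in> carrier_vec (y v)"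
        using m n m' n' by simp_all
      then have "S.ret v m + S.ret v m' + (T.ret v n + T.ret v n') =
          S.ret v m + T.ret v n + (S.ret v m' + T.ret v n')"
        by (intro eq_vecI) auto
      then show "\<sigma> v (p \<oplus>\<^bsub>space_at ?P v\<^esub> q) = \<sigma> v p \<oplus>\<^bsub>U.M v\<^esub> \<sigma> v q"
        using m n e m' n' e' by (simp add: p q ap P_add U.combine_add del: U.inc_simps(2,3) U.s_simps(2,3))
    qed
    show "\<sigma> v \<in> extensional (carrier (space_at ?P v))" by (simp add: \<sigma>_def)
  next
    fix a p assume "p \<in> carrier (space_at ?P (source a))"
    then obtain m n where p: "p = (m, n)" and m: "m \<in> carrier (S.M (source a))"
      and n: "n \<in> carrier (T.M (source a))" and e: "prj S (source a) m = prj T (source a) n"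
      by (auto simp: P)
    let ?z = "prj S (source a) m"
    have z: "?z \<in> carrier_vec (x (source a))" using m by simp
    have "map_at Y a (S.ret (source a) m) \<in> carrier_vec (y (target a))"
      "map_at Y a (T.ret (source a) n) \<in> carrier_vec (y (target a))"
      "c a ?z \<in> carrier_vec (y (target a))" "c' a ?z \<in> carrier_vec (y (target a))"
      using m n z by simp_all
    then have "map_at Y a (S.ret (source a) m) + c a ?z + (map_at Y a (T.ret (source a) n) + c' a ?z) =
        map_at Y a (S.ret (source a) m) + map_at Y a (T.ret (source a) n) + (c a ?z + c' a ?z)"
      by (intro eq_vecI) auto
    then show "\<sigma> (target a) (map_at ?P a p) = map_at (middle U) a (\<sigma> (source a) p)"
      using m n z by (simp add: p ap e[symmetric] P_map U.map_combine cochains_apply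
          del: U.inc_simps(2,3) U.s_simps(2,3) U.map_simps)
  qed
  have surj: "\<sigma> v ` carrier (space_at ?P v) = carrier (U.M v)" for v
  proof (intro equalityI subsetI)
    fix n assume "n \<in> carrier (U.M v)"
    then obtain w z where w: "w \<in> carrier_vec (y v)" and z: "z \<in> carrier_vec (x v)"
      and n: "n = inc U v w \<oplus>\<^bsub>U.M v\<^esub> u v z" by (rule U.combineE)
    have "n = \<sigma> v (inc S v w \<oplus>\<^bsub>S.M v\<^esub> s v z, t v z)"
      using w z by (simp add: ap n)
    moreover have "(inc S v w \<oplus>\<^bsub>S.M v\<^esub> s v z, t v z) \<in> carrier (space_at ?P v)"
      using w z by (simp add: P)
    ultimately show "n \<in> \<sigma> v ` carrier (space_at ?P v)" by (rule image_eqI)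
  qed (use linear_mapsD(1)[OF rep_homD(1)[OF \<sigma>]] in auto)
  \<comment> \<open>Vanishing of \<open>\<sigma>\<close> forces the X-component to be 0 and the
    Y-components to be opposite, which is the antidiagonal.\<close>
  have ker: "{p \<in> carrier (space_at ?P v). \<sigma> v p = \<zero>\<^bsub>U.M v\<^esub>} =
      (\<lambda>w. (inc S v w, inc T v (\<ominus>\<^bsub>module_vec TYPE('k) (y v)\<^esub> w))) ` carrier_vec (y v)" for v
  proof -
    interpret Y: vectorspace class_ring "module_vec TYPE('k) (y v)" by (rule vec_vs)
    have neg: "\<ominus>\<^bsub>module_vec TYPE('k) (y v)\<^esub> w \<in> carrier_vec (y v)"
      "w + \<ominus>\<^bsub>module_vec TYPE('k) (y v)\<^esub> w = 0\<^sub>v (y v)" if "w \<in> carrier_vec (y v)" for w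
      using that Y.M.a_inv_closed[of w] Y.M.r_neg[of w] by simp_all
    show ?thesis
    proof (intro equalityI subsetI)
      fix p assume "p \<in> {p \<in> carrier (space_at ?P v). \<sigma> v p = \<zero>\<^bsub>U.M v\<^esub>}"
      then obtain m n where p: "p = (m, n)" and m: "m \<in> carrier (S.M v)" and n: "n \<in> carrier (T.M v)"
        and e: "prj S v m = prj T v n" and z: "\<sigma> v (m, n) = \<zero>\<^bsub>U.M v\<^esub>" by (auto simp: P)
      have r: "S.ret v m \<in> carrier_vec (y v)" "T.ret v n \<in> carrier_vec (y v)" using m n by simp_all
      have "S.ret v m + T.ret v n = U.ret v (\<sigma> v (m, n))" "prj S v m = prj U v (\<sigma> v (m, n))"
        using m n by (simp_all add: ap[OF m n e] del: U.ret_simps(1) U.prj_simps(2) U.inc_simps(2))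
      then have sum: "S.ret v m + T.ret v n = 0\<^sub>v (y v)" and prj0: "prj S v m = 0\<^sub>v (x v)"
        by (simp_all add: z)
      have "T.ret v n = \<ominus>\<^bsub>module_vec TYPE('k) (y v)\<^esub> S.ret v m"
        using Y.M.minus_equality[of "T.ret v n" "S.ret v m"] r sum comm_add_vec[OF r] by simp
      moreover have "m = inc S v (S.ret v m)" "n = inc T v (T.ret v n)"
        using S.ret(2)[OF m] T.ret(2)[OF n] r prj0 e by simp_all
      ultimately show "p \<in> (\<lambda>w. (inc S v w, inc T v (\<ominus>\<^bsub>module_vec TYPE('k) (y v)\<^esub> w))) ` carrier_vec (y v)"
        using r by (intro image_eqI[of _ _ "S.ret v m"]) (simp_all add: p)
    qed (auto simp: P ap neg)
  qed
  have inc: "\<sigma> v (inc S v w, \<zero>\<^bsub>T.M v\<^esub>) = inc U v w" if "w \<in> carrier_vec (y v)" for v w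
    using that by (simp add: ap)
  have prj: "prj U v (\<sigma> v (m, n)) = prj S v m" if "(m, n) \<in> carrier (space_at ?P v)" for v m n
    using that by (simp add: P ap)
  show ?thesis
    unfolding is_baer_sum_def
  proof (intro conjI bexI[OF _ \<sigma>] allI U.S_ext)
    show "\<forall>(m, n) \<in> carrier (space_at ?P v). prj U v (\<sigma> v (m, n)) = prj S v m" for v
      using prj by auto
  qed (simp_all add: surj ker inc)
qed

lemma is_baer_sum_iff:
  assumes "has_cocycle S c" "has_cocycle T c'"
  shows "is_baer_sum X Y S T U \<longleftrightarrow> has_cocycle U (c \<oplus>\<^bsub>cochains\<^esub> c')"
  using has_cocycle_baer_sum[OF assms] is_baer_sumI[OF assms] by blast

text \<open>A section commutes with the arrows exactly when its defect is zero. The proof restricts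
  it to the carriers, as \<open>rep_hom\<close> demands extensional maps.\<close>

lemma is_split_iff: "is_split X Y S \<longleftrightarrow> has_cocycle S \<zero>\<^bsub>cochains\<^esub>"
proof
  assume "is_split X Y S"
  then obtain s where S: "S \<in> extensions X Y" and s: "s \<in> rep_hom X (middle S)"
    and prj: "\<And>v z. z \<in> carrier_vec (x v) \<Longrightarrow> prj S v (s v z) = z"
    by (auto simp: is_split_def)
  interpret S: extension X Y x y S using S by unfold_locales
  show "has_cocycle S \<zero>\<^bsub>cochains\<^esub>"
  proof (rule has_cocycleI[OF S C.M.zero_closed], rule is_cocycle_sectionI)
    show s': "s v \<in> linear_maps (module_vec TYPE('k) (x v)) (S.M v)" for v
      using rep_homD(1)[OF s, of v] by simp
    fix a and z :: "'k vec" assume z: "z \<in> carrier_vec (x (source a))"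
    have "s (target a) (map_at X a z) \<in> carrier (S.M (target a))"
      using linear_mapsD(1)[OF s', of "map_at X a z" "target a"] z by simp
    then show "map_at (middle S) a (s (source a) z) =
        inc S (target a) (\<zero>\<^bsub>cochains\<^esub> a z) \<oplus>\<^bsub>S.M (target a)\<^esub> s (target a) (map_at X a z)"
      using rep_homD(3)[OF s, of z a] z by (simp add: cochains_apply)
  qed (rule prj)
next
  assume "has_cocycle S \<zero>\<^bsub>cochains\<^esub>"
  then obtain s where "split_extension X Y x y S \<zero>\<^bsub>cochains\<^esub> s" by (rule has_cocycleE)
  then interpret S: split_extension X Y x y S "\<zero>\<^bsub>cochains\<^esub>" s .
  have "(\<lambda>v. restrict (s v) (carrier_vec (x v))) \<in> rep_hom X (middle S)"
    by (rule rep_homI) (auto simp: cochains_apply intro!: linear_mapsI)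
  then show "is_split X Y S"
    using S.S_ext unfolding is_split_def by (auto intro!: bexI)
qed

end

section \<open>Ext as the cokernel of the coboundary\<close>

lemma module_vec_fin_dim: "vectorspace.fin_dim class_ring (module_vec TYPE('k::field) n)"
proof -
  interpret vec_space "TYPE('k)" n .
  show ?thesis by simp
qed

lemma vec_first_simps [simp]:
  "w \<in> carrier_vec n \<Longrightarrow> vec_first (w @\<^sub>v z) n = w"
  "u \<in> carrier_vec (n + m) \<Longrightarrow> u' \<in> carrier_vec (n + m) \<Longrightarrow>
    vec_first (u + u') n = vec_first u n + vec_first u' n"
  "u \<in> carrier_vec (n + m) \<Longrightarrow> vec_first (k \<cdot>\<^sub>v u) n = k \<cdot>\<^sub>v vec_first u n"
  by (auto simp: vec_first_def)

lemma vec_last_simps [simp]: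
  "z \<in> carrier_vec m \<Longrightarrow> vec_last (w @\<^sub>v z) m = z"
  "u \<in> carrier_vec (n + m) \<Longrightarrow> u' \<in> carrier_vec (n + m) \<Longrightarrow>
    vec_last (u + u') m = vec_last u m + vec_last u' m"
  "u \<in> carrier_vec (n + m) \<Longrightarrow> vec_last (k \<cdot>\<^sub>v u) m = k \<cdot>\<^sub>v vec_last u m"
  by (auto simp: vec_last_def)

lemma append_vec_smult: "k \<cdot>\<^sub>v (u @\<^sub>v w) = (k \<cdot>\<^sub>v u) @\<^sub>v (k \<cdot>\<^sub>v w)"
  by (intro eq_vecI) auto

lemma append_zero_vec [simp]: "0\<^sub>v n @\<^sub>v 0\<^sub>v m = 0\<^sub>v (n + m)"
  by (intro eq_vecI) auto

lemma UNIV_vertex: "UNIV = {Vb, Vminus, Vplus, Ve}"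
  using vertex.exhaust by auto

lemma UNIV_arrow: "UNIV = {b_to_plus, plus_to_e, b_to_minus, minus_to_e}"
  using arrow.exhaust by auto

instance vertex :: finite
  by standard (simp add: UNIV_vertex)

instance arrow :: finite
  by standard (simp add: UNIV_arrow)

context coordinate_reps
begin

text \<open>The block triangular form of \<open>map_combine\<close> taken as a definition, with the
  coordinates of Y before those of X. No compatibility of c between arrows is required, as the
  quiver has no relations.\<close>

definition extension_of :: "(arrow \<Rightarrow> 'k vec \<Rightarrow> 'k vec) \<Rightarrow> 'k extension" where
  "extension_of c = \<lparr>
     middle = \<lparr>
       space_at = (\<lambda>v. module_vec TYPE('k) (y v + x v)),
       map_at = (\<lambda>a u.
         (map_at Y a (vec_first u (y (source a))) + c a (vec_last u (x (source a)))) @\<^sub>v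
         map_at X a (vec_last u (x (source a))))\<rparr>,
     inc = (\<lambda>v. \<lambda>w \<in> carrier_vec (y v). w @\<^sub>v 0\<^sub>v (x v)),
     prj = (\<lambda>v. \<lambda>u \<in> carrier_vec (y v + x v). vec_last u (x v))\<rparr>"

lemma extension_of_simps [simp]:
  "space_at (middle (extension_of c)) v = module_vec TYPE('k) (y v + x v)"
  "w \<in> carrier_vec (y v) \<Longrightarrow> inc (extension_of c) v w = w @\<^sub>v 0\<^sub>v (x v)"
  "u \<in> carrier_vec (y v + x v) \<Longrightarrow> prj (extension_of c) v u = vec_last u (x v)"
  "w \<in> carrier_vec (y (source a)) \<Longrightarrow> z \<in> carrier_vec (x (source a)) \<Longrightarrow>
    map_at (middle (extension_of c)) a (w @\<^sub>v z) = (map_at Y a w + c a z) @\<^sub>v map_at X a z"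
  by (simp_all add: extension_of_def)

lemma append_vecE:
  assumes "u \<in> carrier_vec (n + m)"
  obtains w z where "w \<in> carrier_vec n" "z \<in> carrier_vec m" "u = w @\<^sub>v z"
  using vec_first_last_append[OF assms] by (metis vec_first_carrier vec_last_carrier)

lemma extension_of_has_cocycle:
  assumes c: "c \<in> carrier cochains"
  shows "has_cocycle (extension_of c) c"
proof -
  let ?S = "extension_of c"
  note [simp] = cochainsD(2-4)[OF c]
  have map: "map_at (middle ?S) a \<in> linear_maps (space_at (middle ?S) (source a)) (space_at (middle ?S) (target a))"
    for a
  proof (rule linear_mapsI)
    let ?n = "y (source a)" and ?m = "x (source a)"
    fix u k assume "u \<in> carrier (space_at (middle ?S) (source a))"
    then obtain w z where w: "w \<in> carrier_vec ?n" and z: "z \<in> carrier_vec ?m" and u: "u = w @\<^sub>v z"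
      by (auto elim: append_vecE)
    show "map_at (middle ?S) a u \<in> carrier (space_at (middle ?S) (target a))"
      using w z by (simp add: u)
    show "map_at (middle ?S) a (k \<odot>\<^bsub>space_at (middle ?S) (source a)\<^esub> u) =
        k \<odot>\<^bsub>space_at (middle ?S) (target a)\<^esub> map_at (middle ?S) a u"
      using w z by (simp add: u append_vec_smult smult_add_distrib_vec[of _ "y (target a)"])
    fix u' assume "u' \<in> carrier (space_at (middle ?S) (source a))"
    then obtain w' z' where w': "w' \<in> carrier_vec ?n" and z': "z' \<in> carrier_vec ?m" and u': "u' = w' @\<^sub>v z'"
      by (auto elim: append_vecE)
    have "map_at Y a w \<in> carrier_vec (y (target a))" "map_at Y a w' \<in> carrier_vec (y (target a))"
      "c a z \<in> carrier_vec (y (target a))" "c a z' \<in> carrier_vec (y (target a))"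
      using w w' z z' by simp_all
    then have e: "map_at Y a w + map_at Y a w' + (c a z + c a z') =
        (map_at Y a w + c a z) + (map_at Y a w' + c a z')"
      by (intro eq_vecI) auto
    show "map_at (middle ?S) a (u \<oplus>\<^bsub>space_at (middle ?S) (source a)\<^esub> u') =
        map_at (middle ?S) a u \<oplus>\<^bsub>space_at (middle ?S) (target a)\<^esub> map_at (middle ?S) a u'"
      using w z w' z' e
      by (simp add: u u' append_vec_add[of _ "?n" _ _ "?m"]
          append_vec_add[of _ "y (target a)" _ _ "x (target a)"])
  qed
  have rep: "is_rep (middle ?S)"
    using map by (simp add: is_rep_def vec_vs module_vec_fin_dim)
  have inc: "inc ?S \<in> rep_hom Y (middle ?S)"
  proof (rule rep_homI)
    fix v
    show "inc ?S v \<in> linear_maps (space_at Y v) (space_at (middle ?S) v)"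
      by (rule linear_mapsI)
         (auto simp: append_vec_smult append_vec_add[of _ "y v" _ _ "x v"])
    show "inc ?S v \<in> extensional (carrier (space_at Y v))" by (simp add: extension_of_def)
  next
    fix a w assume "w \<in> carrier (space_at Y (source a))"
    then have w: "w \<in> carrier_vec (y (source a))" by simp
    have "c a (0\<^sub>v (x (source a))) = 0\<^sub>v (y (target a))" "map_at X a (0\<^sub>v (x (source a))) = 0\<^sub>v (x (target a))"
      using linear_maps_zero[OF vec_vs vec_vs cochainsD(1)[OF c]]
        linear_maps_zero[OF vec_vs vec_vs X_map[simplified]] by simp_all
    then show "inc ?S (target a) (map_at Y a w) = map_at (middle ?S) a (inc ?S (source a) w)"
      using w by simp
  qed
  have prj: "prj ?S \<in> rep_hom (middle ?S) X"
  proof (rule rep_homI)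
    fix v
    show "prj ?S v \<in> linear_maps (space_at (middle ?S) v) (space_at X v)"
      by (rule linear_mapsI) simp_all
    show "prj ?S v \<in> extensional (carrier (space_at (middle ?S) v))" by (simp add: extension_of_def)
  qed (auto elim!: append_vecE)
  have "?S \<in> extensions X Y"
    unfolding extensions_def
  proof (intro CollectI conjI allI rep inc prj)
    fix v
    show "inj_on (inc ?S v) (carrier (space_at Y v))"
      by (rule inj_onI) (simp add: append_vec_eq[of _ "y v"])
    show "prj ?S v ` carrier (space_at (middle ?S) v) = carrier (space_at X v)"
    proof (intro equalityI subsetI)
      fix z assume z: "z \<in> carrier (space_at X v)"
      then show "z \<in> prj ?S v ` carrier (space_at (middle ?S) v)"
        by (intro image_eqI[of _ _ "0\<^sub>v (y v) @\<^sub>v z"]) simp_all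
    qed auto
    show "inc ?S v ` carrier (space_at Y v) =
        {m \<in> carrier (space_at (middle ?S) v). prj ?S v m = \<zero>\<^bsub>space_at X v\<^esub>}"
      by (auto elim!: append_vecE)
  qed
  moreover have "is_cocycle_section X ?S c (\<lambda>v z. 0\<^sub>v (y v) @\<^sub>v z)"
  proof (rule is_cocycle_sectionI)
    fix v
    show "(\<lambda>z. 0\<^sub>v (y v) @\<^sub>v z) \<in> linear_maps (module_vec TYPE('k) (x v)) (space_at (middle ?S) v)"
      by (rule linear_mapsI) (auto simp: append_vec_smult append_vec_add[of _ "y v" _ _ "x v"])
  next
    fix a and z :: "'k vec" assume z: "z \<in> carrier_vec (x (source a))"
    have "map_at Y a (0\<^sub>v (y (source a))) = 0\<^sub>v (y (target a))"
      using linear_maps_zero[OF vec_vs vec_vs Y_map[simplified]] by simp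
    then show "map_at (middle ?S) a (0\<^sub>v (y (source a)) @\<^sub>v z) =
        inc ?S (target a) (c a z) \<oplus>\<^bsub>space_at (middle ?S) (target a)\<^esub> (0\<^sub>v (y (target a)) @\<^sub>v map_at X a z)"
      using z by (simp add: append_vec_add[of _ "y (target a)" _ _ "x (target a)"])
  qed simp
  ultimately show ?thesis using c by (intro has_cocycleI)
qed

text \<open>For a cochain c this is a single equivalence class; it is nonempty because it contains
  \<open>extension_of c\<close>.\<close>

definition cocycle_class :: "(arrow \<Rightarrow> 'k vec \<Rightarrow> 'k vec) \<Rightarrow> 'k extension set" where
  "cocycle_class c = {S. has_cocycle S c}"

lemma cocycle_class_eq_equiv_class:
  assumes "has_cocycle S c"
  shows "cocycle_class c = ext_equiv X Y `` {S}"
  using ext_equiv_iff[OF assms] by (auto simp: cocycle_class_def)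

lemma cocycle_class_closed:
  assumes "c \<in> carrier cochains"
  shows "cocycle_class c \<in> carrier (ext_space X Y)"
  using cocycle_class_eq_equiv_class[OF extension_of_has_cocycle[OF assms]]
    extension_of_has_cocycle[OF assms]
  by (auto simp: ext_space_def has_cocycle_def intro: quotientI)

text \<open>The operations of \<open>ext_space\<close> collect results over all representatives. By
  \<open>is_baer_sum_iff\<close> and \<open>is_scalar_multiple_iff\<close> the result depends only
  on the cocycles, and \<open>extension_of\<close> supplies the representatives needed.\<close>

lemma cocycle_class_linear: "cocycle_class \<in> linear_maps cochains (ext_space X Y)"
proof (rule linear_mapsI)
  fix c k assume c: "c \<in> carrier cochains"
  show "cocycle_class c \<in> carrier (ext_space X Y)" using c by (rule cocycle_class_closed)
  show "cocycle_class (k \<odot>\<^bsub>cochains\<^esub> c) = k \<odot>\<^bsub>ext_space X Y\<^esub> cocycle_class c"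
    using extension_of_has_cocycle[OF c]
    by (auto simp: cocycle_class_def ext_space_def is_scalar_multiple_iff)
  fix c' assume c': "c' \<in> carrier cochains"
  show "cocycle_class (c \<oplus>\<^bsub>cochains\<^esub> c') = cocycle_class c \<oplus>\<^bsub>ext_space X Y\<^esub> cocycle_class c'"
  proof -
    have "has_cocycle U (c \<oplus>\<^bsub>cochains\<^esub> c') \<longleftrightarrow>
        (\<exists>S \<in> cocycle_class c. \<exists>T \<in> cocycle_class c'. is_baer_sum X Y S T U)" for U
      using extension_of_has_cocycle[OF c] extension_of_has_cocycle[OF c'] is_baer_sum_iff
      unfolding cocycle_class_def by blast
    then show ?thesis by (auto simp: cocycle_class_def ext_space_def)
  qed
qed

lemma cocycle_class_zero: "cocycle_class \<zero>\<^bsub>cochains\<^esub> = \<zero>\<^bsub>ext_space X Y\<^esub>"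
  by (simp add: cocycle_class_def ext_space_def is_split_iff)

lemma cocycle_class_surj: "cocycle_class ` carrier cochains = carrier (ext_space X Y)"
proof (intro equalityI subsetI)
  fix C assume "C \<in> carrier (ext_space X Y)"
  then obtain S where S: "S \<in> extensions X Y" "C = ext_equiv X Y `` {S}"
    by (auto simp: ext_space_def elim: quotientE)
  obtain c where c: "has_cocycle S c" using S(1) by (rule has_cocycle_exists)
  then show "C \<in> cocycle_class ` carrier cochains"
    using S(2) cocycle_class_eq_equiv_class[OF c] by (auto simp: has_cocycle_def)
qed (use cocycle_class_closed in auto)

lemma ext_space_vectorspace: "vectorspace class_ring (ext_space X Y)"
  by (rule surjective_image_vectorspace[where f = cocycle_class and V = cochains and W = "ext_space X Y",
        OF cochains_vectorspace cocycle_class_linear cocycle_class_surj cocycle_class_zero])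

sublocale Q: linear_map class_ring cochains "ext_space X Y" cocycle_class
  by (intro linear_mapI cochains_vectorspace ext_space_vectorspace cocycle_class_linear)

text \<open>If c has the class of zero, then \<open>extension_of c\<close> has both c and 0 as
  cocycles, which therefore differ by a coboundary. Conversely, a coboundary is a second cocycle of
  the trivial extension.\<close>

lemma cocycle_class_kernel: "Q.kerT = D.imT"
proof (intro equalityI subsetI)
  fix c assume "c \<in> Q.kerT"
  then have c: "c \<in> carrier cochains" and z: "cocycle_class c = cocycle_class \<zero>\<^bsub>cochains\<^esub>"
    by (simp_all add: Q.ker_def cocycle_class_zero)
  then have "has_cocycle (extension_of c) \<zero>\<^bsub>cochains\<^esub>"
    using extension_of_has_cocycle[OF c] by (auto simp: cocycle_class_def)
  then obtain h where "h \<in> carrier vertex_maps" "c = \<zero>\<^bsub>cochains\<^esub> \<oplus>\<^bsub>cochains\<^esub> coboundary h"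
    using extension_of_has_cocycle[OF c] by (rule cocycle_difference)
  then show "c \<in> D.imT" by (auto simp: D.im_def coboundary_closed)
next
  fix c assume "c \<in> D.imT"
  then obtain h where h: "h \<in> carrier vertex_maps" and c: "c = coboundary h"
    by (auto simp: D.im_def)
  let ?S = "extension_of \<zero>\<^bsub>cochains\<^esub>"
  have S0: "has_cocycle ?S \<zero>\<^bsub>cochains\<^esub>" by (rule extension_of_has_cocycle) simp
  have "has_cocycle ?S c"
    using has_cocycle_add_coboundary[OF S0 h] by (simp add: c coboundary_closed h)
  then have "cocycle_class c = cocycle_class \<zero>\<^bsub>cochains\<^esub>"
    using cocycle_class_eq_equiv_class S0 by metis
  then show "c \<in> Q.kerT" by (simp add: Q.ker_def c coboundary_closed h cocycle_class_zero)
qed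

section \<open>The Euler form\<close>

lemma vertex_maps_dim:
  "vectorspace.fin_dim class_ring vertex_maps" "vectorspace.dim class_ring vertex_maps = (\<Sum>v\<in>UNIV. x v * y v)"
  unfolding vertex_maps_def by (rule hom_family_module_vec_dim)+

lemma cochains_dim:
  "vectorspace.fin_dim class_ring cochains"
  "vectorspace.dim class_ring cochains = (\<Sum>a\<in>UNIV. x (source a) * y (target a))"
  unfolding cochains_def by (rule hom_family_module_vec_dim)+

text \<open>Rank-nullity for \<open>coboundary\<close> and for \<open>cocycle_class\<close>; the
  rank of the coboundary occurs in both and cancels. The additive form avoids truncated
  subtraction.\<close>

theorem euler_form:
  "hom_dim X Y + (\<Sum>a\<in>UNIV. x (source a) * y (target a)) = ext_dim X Y + (\<Sum>v\<in>UNIV. x v * y v)"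
proof -
  have "vectorspace.dim class_ring (cochains\<lparr>carrier := D.imT\<rparr>) + hom_dim X Y = (\<Sum>v\<in>UNIV. x v * y v)"
    using D.rank_nullity[OF vertex_maps_dim(1)] by (simp add: hom_dim_def hom_space_eq vertex_maps_dim(2))
  moreover have "ext_dim X Y + vectorspace.dim class_ring (cochains\<lparr>carrier := D.imT\<rparr>) =
      (\<Sum>a\<in>UNIV. x (source a) * y (target a))"
    using Q.rank_nullity[OF cochains_dim(1)] Q.surj_imp_imT_carrier[OF cocycle_class_surj]
    by (simp add: ext_dim_def cocycle_class_kernel cochains_dim(2))
  ultimately show ?thesis by simp
qed

lemma hom_dim_zero:
  assumes "\<And>h. h \<in> rep_hom X Y \<Longrightarrow> h = \<zero>\<^bsub>vertex_maps\<^esub>"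
  shows "hom_dim X Y = 0"
proof -
  have "D.kerT = {\<zero>\<^bsub>vertex_maps\<^esub>}"
    using assms by (auto simp: rep_hom_eq D.ker_def)
  then have "inj_on coboundary (carrier vertex_maps)" by (intro D.Ke0_imp_inj) simp
  then show ?thesis using D.inj_imp_dim_ker0 by (simp add: hom_dim_def hom_space_eq)
qed

lemma ext_dim_zero:
  assumes "\<And>c. c \<in> carrier cochains \<Longrightarrow> \<exists>h \<in> carrier vertex_maps. coboundary h = c"
  shows "ext_dim X Y = 0"
proof -
  have "D.imT = carrier cochains"
    using assms coboundary_closed by (force simp: D.im_def)
  then have "Q.kerT = carrier cochains" by (simp add: cocycle_class_kernel)
  then have "vectorspace.dim class_ring (ext_space X Y) + vectorspace.dim class_ring cochains =
      vectorspace.dim class_ring cochains"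
    using Q.rank_nullity[OF cochains_dim(1)] Q.surj_imp_imT_carrier[OF cocycle_class_surj] by simp
  then show ?thesis by (simp add: ext_dim_def)
qed

end

section \<open>Difference equations on a segment of the integer line\<close>

fun label :: "vertex \<Rightarrow> int" where
  "label Vb = 0" | "label Vplus = 1" | "label Ve = 2" | "label Vminus = 3"

fun step :: "arrow \<Rightarrow> int" where
  "step b_to_plus = 1" | "step plus_to_e = 1" | "step b_to_minus = -1" | "step minus_to_e = -1"

text \<open>
  For a pair of intervals \<open>[p, q]\<close> and \<open>[p', q']\<close>, only the arrows with source in the first and target
  in the second matter. The next two definitions say that such an arrow crosses the left or the
  right end of the intersection. If the intersection is empty but the intervals are adjacent,
  both hold when the arrow between them runs from the first to the second.
\<close>

definition left_edge :: "int \<Rightarrow> int \<Rightarrow> bool" where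
  "left_edge p p' \<longleftrightarrow> (p < p' \<and> (p' mod 4 = 1 \<or> p' mod 4 = 2)) \<or> (p' < p \<and> (p mod 4 = 3 \<or> p mod 4 = 0))"

definition right_edge :: "int \<Rightarrow> int \<Rightarrow> bool" where
  "right_edge q q' \<longleftrightarrow> (q' < q \<and> (q' mod 4 = 2 \<or> q' mod 4 = 3)) \<or> (q < q' \<and> (q mod 4 = 0 \<or> q mod 4 = 1))"

lemma all_arrow: "(\<forall>a. P a) \<longleftrightarrow> P b_to_plus \<and> P plus_to_e \<and> P b_to_minus \<and> P minus_to_e"
  by (metis arrow.exhaust)

text \<open>The equations say that G does not change along an arrow. At a crossed end they compare a
  position in the intersection with one outside, where G is 0; the inner equations carry this value
  through the segment.\<close>

lemma edge_equations_injective: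
  fixes G :: "int \<Rightarrow> 'a::zero"
  assumes out: "\<And>t. \<not> (p \<le> t \<and> t \<le> q \<and> p' \<le> t \<and> t \<le> q') \<Longrightarrow> G t = 0"
    and edge: "\<And>a t. t mod 4 = label (source a) \<Longrightarrow> p \<le> t \<Longrightarrow> t \<le> q \<Longrightarrow>
      p' \<le> t + step a \<Longrightarrow> t + step a \<le> q' \<Longrightarrow> G t = G (t + step a)"
    and "left_edge p p' \<or> right_edge q q'"
  shows "G t = 0"
proof -
  \<comment> \<open>\<open>e1\<close> treats links between r - 1 and r whose arrow points up (b to
    +, + to e), \<open>e2\<close> those whose arrow points down (- to e, b to -).\<close>
  have e1: "G (r - 1) = G r"
    if "r mod 4 = 1 \<or> r mod 4 = 2" "p \<le> r - 1" "r - 1 \<le> q" "p' \<le> r" "r \<le> q'" for r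
  proof -
    have "(r - 1) mod 4 = 0 \<or> (r - 1) mod 4 = 1" using that(1) by presburger
    then show ?thesis using that edge[of "r - 1" b_to_plus] edge[of "r - 1" plus_to_e] by auto
  qed
  have e2: "G (r - 1) = G r"
    if "r mod 4 = 3 \<or> r mod 4 = 0" "p \<le> r" "r \<le> q" "p' \<le> r - 1" "r - 1 \<le> q'" for r
    using that edge[of r b_to_minus] edge[of r minus_to_e] by auto
  have mod4: "(r mod 4 = 1 \<or> r mod 4 = 2) \<or> (r mod 4 = 3 \<or> r mod 4 = 0)" for r :: int
    by presburger
  have inner: "G (r - 1) = G r"
    if "p \<le> r - 1" "p' \<le> r - 1" "r \<le> q" "r \<le> q'" for r
    using that mod4[of r] e1[of r] e2[of r] by auto
  define u w where "u = max p p'" and "w = min q q'"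
  from assms(3) show ?thesis
  proof
    assume L: "left_edge p p'"
    \<comment> \<open>Only r = u uses the crossed left end; it reaches u - 1, where G is 0.\<close>
    have step: "G (r - 1) = G r" if "u \<le> r" "r \<le> w" for r
    proof (cases "r = u")
      case True
      then show ?thesis using L that e1[of r] e2[of r]
        unfolding left_edge_def u_def w_def by (auto simp: max_def min_def split: if_splits)
    next
      case False
      then show ?thesis using that inner[of r] unfolding u_def w_def by auto
    qed
    have up: "t \<le> w \<longrightarrow> G t = 0" if "u - 1 \<le> t" for t
      using that
    proof (induction t rule: int_ge_induct)
      case base
      then show ?case using out[of "u - 1"] by (auto simp: u_def)
    next
      case (step i)
      then show ?case using \<open>\<And>r. u \<le> r \<Longrightarrow> r \<le> w \<Longrightarrow> G (r - 1) = G r\<close>[of "i + 1"] by auto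
    qed
    show ?thesis
      using up[of t] out[of t]
      by (cases "u - 1 \<le> t \<and> t \<le> w") (auto simp: u_def w_def max_def min_def split: if_splits)
  next
    assume R: "right_edge q q'"
    \<comment> \<open>Now the extra link is r = w + 1, and zero propagates downwards.\<close>
    have step: "G (r - 1) = G r" if "u < r" "r \<le> w + 1" for r
    proof (cases "r = w + 1")
      case True
      have "(w + 1) mod 4 = 3 \<or> (w + 1) mod 4 = 0" if "w mod 4 = 2 \<or> w mod 4 = 3"
        using that by presburger
      moreover have "(w + 1) mod 4 = 1 \<or> (w + 1) mod 4 = 2" if "w mod 4 = 0 \<or> w mod 4 = 1"
        using that by presburger
      ultimately show ?thesis using True R that e1[of r] e2[of r]
        unfolding right_edge_def u_def w_def by (auto simp: max_def min_def split: if_splits)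
    next
      case False
      then show ?thesis using that inner[of r] unfolding u_def w_def by auto
    qed
    have down: "u \<le> t \<longrightarrow> G t = 0" if "t \<le> w + 1" for t
      using that
    proof (induction t rule: int_le_induct)
      case base
      then show ?case using out[of "w + 1"] by (auto simp: w_def)
    next
      case (step i)
      then show ?case using \<open>\<And>r. u < r \<Longrightarrow> r \<le> w + 1 \<Longrightarrow> G (r - 1) = G r\<close>[of i] by auto
    qed
    show ?thesis
      using down[of t] out[of t]
      by (cases "u \<le> t \<and> t \<le> w + 1") (auto simp: u_def w_def max_def min_def split: if_splits)
  qed
qed

lemma sum_int_upto: 
  fixes f :: "int \<Rightarrow> 'a::ab_group_add"
  assumes "u \<le> r" shows "sum f {u..r} = sum f {u..r - 1} + f r"
proof -
  have "{u..r} = insert r {u..r - 1}" using assms by auto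
  then show ?thesis by (simp add: add.commute)
qed

lemma sum_int_downto: 
  fixes f :: "int \<Rightarrow> 'a::ab_group_add"
  assumes "r \<le> w" shows "sum f {r..w} = f r + sum f {r + 1..w}"
proof -
  have "{r..w} = insert r {r + 1..w}" using assms by auto
  then show ?thesis by simp
qed

text \<open>Sum the prescribed differences from one end towards an end that is not crossed: there no
  equation compares the last value with the 0 outside. If both ends are crossed, the hypothesis
  leaves no equations at all.\<close>

lemma edge_equations_surjective:
  fixes C :: "arrow \<Rightarrow> int \<Rightarrow> 'a::ab_group_add"
  assumes cond: "\<not> (left_edge p p' \<and> right_edge q q' \<and> max p p' \<le> min q q' + 1)"
  obtains G where "\<And>t. \<not> (p \<le> t \<and> t \<le> q \<and> p' \<le> t \<and> t \<le> q') \<Longrightarrow> G t = 0"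
    and "\<And>a t. t mod 4 = label (source a) \<Longrightarrow> p \<le> t \<Longrightarrow> t \<le> q \<Longrightarrow>
      p' \<le> t + step a \<Longrightarrow> t + step a \<le> q' \<Longrightarrow> G t - G (t + step a) = C a t"
proof -
  define u w where "u = max p p'" and "w = min q q'"
  \<comment> \<open>The prescribed value of G r - G (r - 1). The sign is negative when the arrow
    points up, since C measures source minus target.\<close>
  define \<sigma> where "\<sigma> r = (if r mod 4 = 1 then - C b_to_plus (r - 1) else if r mod 4 = 2 then - C plus_to_e (r - 1)
      else if r mod 4 = 3 then C minus_to_e r else C b_to_minus r)" for r :: int
  \<comment> \<open>The link between r - 1 and r carries an equation: the source of its arrow lies
    in the first interval and the target in the second.\<close>
  define E where "E r \<longleftrightarrow> (if r mod 4 = 1 \<or> r mod 4 = 2 then p \<le> r - 1 \<and> r - 1 \<le> q \<and> p' \<le> r \<and> r \<le> q'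
      else p \<le> r \<and> r \<le> q \<and> p' \<le> r - 1 \<and> r - 1 \<le> q')" for r :: int
  have arrows: "G t - G (t + step a) = C a t"
    if G: "\<And>r. E r \<Longrightarrow> G r - G (r - 1) = \<sigma> r"
      and t: "t mod 4 = label (source a)" "p \<le> t" "t \<le> q" "p' \<le> t + step a" "t + step a \<le> q'" for a t G
  proof -
    have m: "t mod 4 = 0 \<Longrightarrow> (t + 1) mod 4 = 1" "t mod 4 = 1 \<Longrightarrow> (t + 1) mod 4 = 2"
      by presburger+
    show ?thesis
      using t m G[of "t + 1"] G[of t] by (cases a) (auto simp: E_def \<sigma>_def algebra_simps)
  qed
  have mod4: "r mod 4 = 0 \<or> r mod 4 = 1 \<or> r mod 4 = 2 \<or> r mod 4 = 3" for r :: int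
    by presburger
  show ?thesis
  proof (cases "right_edge q q'")
    case False
    \<comment> \<open>The sum from the left agrees with the value 0 at u - 1, and the drop to 0
      after w is subject to no equation.\<close>
    define G where "G t = (if u \<le> t \<and> t \<le> w then \<Sum>r\<in>{u..t}. \<sigma> r else 0)" for t
    have "u \<le> r \<and> r \<le> w" if "E r" for r
    proof -
      have "r mod 4 = 1 \<or> r mod 4 = 2 \<Longrightarrow> (r - 1) mod 4 = 0 \<or> (r - 1) mod 4 = 1"
        "\<not> (r mod 4 = 1 \<or> r mod 4 = 2) \<Longrightarrow> (r - 1) mod 4 = 2 \<or> (r - 1) mod 4 = 3"
        by presburger+
      then show ?thesis using that False
        by (cases "r - 1 = q"; cases "r - 1 = q'")
           (auto simp: E_def right_edge_def u_def w_def split: if_splits)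
    qed
    then have "G r - G (r - 1) = \<sigma> r" if "E r" for r
      using that sum_int_upto[of u r \<sigma>] by (force simp: G_def)
    from arrows[OF this] show ?thesis
      by (intro that[of G]) (auto simp: G_def u_def w_def)
  next
    case True
    show ?thesis
    proof (cases "left_edge p p'")
      case False
      \<comment> \<open>The mirror image: the sum starts at w + 1, the link across the right end,
        and the jump at u is free.\<close>
      define G where "G t = (if u \<le> t \<and> t \<le> w then - (\<Sum>r\<in>{t + 1..w + 1}. \<sigma> r) else 0)" for t
      have "u < r \<and> r \<le> w + 1" if "E r" for r
      proof (cases "r mod 4 = 1 \<or> r mod 4 = 2")
        case True
        then have "p \<le> r - 1" "r - 1 \<le> q" "p' \<le> r" "r \<le> q'"
          using that by (auto simp: E_def)
        moreover have "r \<noteq> p'" using True False \<open>p \<le> r - 1\<close> by (auto simp: left_edge_def)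
        ultimately show ?thesis unfolding u_def w_def by linarith
      next
        case m: False
        then have "p \<le> r" "r \<le> q" "p' \<le> r - 1" "r - 1 \<le> q'"
          using that by (auto simp: E_def)
        moreover have "r \<noteq> p" using m mod4[of r] False \<open>p' \<le> r - 1\<close> by (auto simp: left_edge_def)
        ultimately show ?thesis unfolding u_def w_def by linarith
      qed
      then have "G r - G (r - 1) = \<sigma> r" if "E r" for r
        using that sum_int_downto[of r "w + 1" \<sigma>] by (force simp: G_def)
      from arrows[OF this] show ?thesis
        by (intro that[of G]) (auto simp: G_def u_def w_def)
    next
      case L: True
      \<comment> \<open>The intervals are then more than one step apart, so no arrow leads from one
        to the other.\<close>
      then have "w + 1 < u" using cond True unfolding u_def w_def by linarith
      then have "\<not> E r" for r by (auto simp: E_def u_def w_def)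
      then show ?thesis using arrows[of "\<lambda>_. 0"] by (intro that[of "\<lambda>_. 0"]) auto
    qed
  qed
qed

section \<open>Representations with a basis indexed by an interval\<close>

text \<open>\<open>pos v j\<close> is the place of the j-th coordinate at v. Arrow maps are
  described by output coordinates and not by images of basis vectors, to match the definitions of
  \<open>pi_plus\<close>, \<open>j_plus\<close> and the others. A position in the interval with the
  right residue is always occupied, so the two clauses cover every output coordinate
  (\<open>source_cases\<close>).\<close>

definition interval_rep ::
  "('k::field) vrep \<Rightarrow> (vertex \<Rightarrow> nat) \<Rightarrow> (vertex \<Rightarrow> nat \<Rightarrow> int) \<Rightarrow> int \<Rightarrow> int \<Rightarrow> bool"
where
  "interval_rep V n pos p q \<longleftrightarrow>
     (\<forall>v. space_at V v = module_vec TYPE('k) (n v)) \<and>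
     (\<forall>v. bij_betw (pos v) {..<n v} {t. p \<le> t \<and> t \<le> q \<and> t mod 4 = label v}) \<and>
     (\<forall>a. \<forall>z \<in> carrier_vec (n (source a)).
        map_at V a z \<in> carrier_vec (n (target a)) \<and>
        (\<forall>i < n (target a).
           (\<forall>j < n (source a). pos (source a) j + step a = pos (target a) i \<longrightarrow> map_at V a z $ i = z $ j) \<and>
           (pos (target a) i - step a \<notin> {p..q} \<longrightarrow> map_at V a z $ i = 0)))"

lemma label_target: "label (target a) = (label (source a) + step a) mod 4"
  by (cases a) simp_all

lemma label_source: "label (source a) = (label (target a) - step a) mod 4"
  by (cases a) simp_all

lemma label_exists: "\<exists>v. t mod 4 = label v"
proof -
  have "t mod 4 = 0 \<or> t mod 4 = 1 \<or> t mod 4 = 2 \<or> t mod 4 = 3" by presburger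
  then show ?thesis using label.simps by metis
qed

lemma label_inject: "label v = label w \<Longrightarrow> v = w"
  by (cases v; cases w) simp_all

locale interval_module =
  fixes V :: "'k::field vrep" and n pos p q
  assumes V: "interval_rep V n pos p q"
begin

lemma space [simp]: "space_at V v = module_vec TYPE('k) (n v)"
  using V by (simp add: interval_rep_def)

lemma pos_bij: "bij_betw (pos v) {..<n v} {t. p \<le> t \<and> t \<le> q \<and> t mod 4 = label v}"
  using V by (simp add: interval_rep_def)

lemma pos_range:
  assumes "j < n v" shows "p \<le> pos v j" "pos v j \<le> q" "pos v j mod 4 = label v"
  using bij_betwE[OF pos_bij[of v]] assms by auto

lemma pos_inject: "j < n v \<Longrightarrow> j' < n v \<Longrightarrow> pos v j = pos v j' \<longleftrightarrow> j = j'"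
  using bij_betw_imp_inj_on[OF pos_bij[of v]] by (auto simp: inj_on_def)

lemma pos_exists:
  assumes "p \<le> t" "t \<le> q" "t mod 4 = label v"
  shows "\<exists>j < n v. pos v j = t"
proof -
  have "t \<in> pos v ` {..<n v}" using assms pos_bij[of v] by (simp add: bij_betw_def)
  then show ?thesis by auto
qed

lemma map_closed: "z \<in> carrier_vec (n (source a)) \<Longrightarrow> map_at V a z \<in> carrier_vec (n (target a))"
  using V by (simp add: interval_rep_def)

lemma map_index:
  "z \<in> carrier_vec (n (source a)) \<Longrightarrow> i < n (target a) \<Longrightarrow> j < n (source a) \<Longrightarrow>
    pos (source a) j + step a = pos (target a) i \<Longrightarrow> map_at V a z $ i = z $ j"
  using V by (simp add: interval_rep_def)

lemma map_index_zero:
  "z \<in> carrier_vec (n (source a)) \<Longrightarrow> i < n (target a) \<Longrightarrow>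
    \<not> (p \<le> pos (target a) i - step a \<and> pos (target a) i - step a \<le> q) \<Longrightarrow> map_at V a z $ i = 0"
  using V by (simp add: interval_rep_def)

lemma source_cases:
  assumes i: "i < n (target a)"
  obtains (out) "\<not> (p \<le> pos (target a) i - step a \<and> pos (target a) i - step a \<le> q)"
  | (pos) j where "j < n (source a)" "pos (source a) j + step a = pos (target a) i"
proof (cases "p \<le> pos (target a) i - step a \<and> pos (target a) i - step a \<le> q")
  case True
  have "(pos (target a) i - step a) mod 4 = label (source a)"
    using pos_range(3)[OF i] label_source[of a] by (metis mod_diff_left_eq)
  then obtain j where "j < n (source a)" "pos (source a) j = pos (target a) i - step a"
    using True pos_exists by blast
  then show ?thesis by (intro pos) auto
qed (rule out)

lemma map_linear: "map_at V a \<in> linear_maps (space_at V (source a)) (space_at V (target a))"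
proof (rule linear_mapsI)
  fix z k assume "z \<in> carrier (space_at V (source a))"
  then have z: "z \<in> carrier_vec (n (source a))" by simp
  show "map_at V a z \<in> carrier (space_at V (target a))" using z by (simp add: map_closed)
  show "map_at V a (k \<odot>\<^bsub>space_at V (source a)\<^esub> z) = k \<odot>\<^bsub>space_at V (target a)\<^esub> map_at V a z"
  proof (rule eq_vecI)
    fix i assume "i < dim_vec (k \<odot>\<^bsub>space_at V (target a)\<^esub> map_at V a z)"
    then have i: "i < n (target a)" using map_closed[OF z] by simp
    show "map_at V a (k \<odot>\<^bsub>space_at V (source a)\<^esub> z) $ i =
        (k \<odot>\<^bsub>space_at V (target a)\<^esub> map_at V a z) $ i"
      using carrier_vecD[OF map_closed[OF z]] z i
      by (cases rule: source_cases[OF i]) (simp_all add: map_index map_index_zero)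
  qed (use map_closed[of "k \<cdot>\<^sub>v z" a] map_closed[OF z] z in simp)
  fix z' assume "z' \<in> carrier (space_at V (source a))"
  then have z': "z' \<in> carrier_vec (n (source a))" by simp
  show "map_at V a (z \<oplus>\<^bsub>space_at V (source a)\<^esub> z') =
      map_at V a z \<oplus>\<^bsub>space_at V (target a)\<^esub> map_at V a z'"
  proof (rule eq_vecI)
    fix i assume "i < dim_vec (map_at V a z \<oplus>\<^bsub>space_at V (target a)\<^esub> map_at V a z')"
    then have i: "i < n (target a)" using map_closed[OF z'] by simp
    show "map_at V a (z \<oplus>\<^bsub>space_at V (source a)\<^esub> z') $ i =
        (map_at V a z \<oplus>\<^bsub>space_at V (target a)\<^esub> map_at V a z') $ i"
      using carrier_vecD[OF map_closed[OF z]] carrier_vecD[OF map_closed[OF z']] z z' i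
      by (cases rule: source_cases[OF i]) (simp_all add: map_index map_index_zero)
  qed (use map_closed[of "z + z'" a] map_closed[OF z'] z z' in simp)
qed

lemma map_unit_vec:
  assumes j: "j < n (source a)" and j': "j' < n (target a)"
    and eq: "pos (target a) j' = pos (source a) j + step a"
  shows "map_at V a (unit_vec (n (source a)) j) = unit_vec (n (target a)) j'"
proof (rule eq_vecI)
  let ?z = "unit_vec (n (source a)) j"
  have z: "?z \<in> carrier_vec (n (source a))" by simp
  fix i assume "i < dim_vec (unit_vec (n (target a)) j' :: 'k vec)"
  then have i: "i < n (target a)" by simp
  then show "map_at V a ?z $ i = unit_vec (n (target a)) j' $ i"
  proof (cases rule: source_cases)
    case out
    then have "i \<noteq> j'" using eq pos_range[OF j] by auto
    then show ?thesis using i j' out by (simp add: map_index_zero[OF z])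
  next
    case (pos l)
    have "i = j' \<longleftrightarrow> l = j"
      using pos eq pos_inject[OF i j'] pos_inject[OF pos(1) j] by auto
    then show ?thesis using i j' j pos by (simp add: map_index[OF z i pos])
  qed
qed (use map_closed[of "unit_vec (n (source a)) j" a] in simp)

lemma map_unit_vec_zero:
  assumes j: "j < n (source a)"
    and out: "\<not> (p \<le> pos (source a) j + step a \<and> pos (source a) j + step a \<le> q)"
  shows "map_at V a (unit_vec (n (source a)) j) = 0\<^sub>v (n (target a))"
proof (rule eq_vecI)
  let ?z = "unit_vec (n (source a)) j"
  have z: "?z \<in> carrier_vec (n (source a))" by simp
  fix i assume "i < dim_vec (0\<^sub>v (n (target a)) :: 'k vec)"
  then have i: "i < n (target a)" by simp
  then show "map_at V a ?z $ i = 0\<^sub>v (n (target a)) $ i"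
  proof (cases rule: source_cases)
    case out
    then show ?thesis using i by (simp add: map_index_zero[OF z])
  next
    case (pos l)
    have "l \<noteq> j" using pos out pos_range[OF i] by auto
    then show ?thesis using i j pos by (simp add: map_index[OF z i pos])
  qed
qed (use map_closed[of "unit_vec (n (source a)) j" a] in simp)

end

section \<open>Hom and Ext between two intervals\<close>

locale interval_modules =
  X: interval_module X x px p q + Y: interval_module Y y py p' q'
  for X Y :: "'k::field vrep" and x y px py p q p' q'
begin

sublocale coordinate_reps X Y x y
  by unfold_locales (use X.map_linear Y.map_linear in simp_all)

text \<open>The coefficient of \<open>h\<close> from the basis vector of \<open>X\<close> at \<open>t\<close> to the basis vector of \<open>Y\<close> at \<open>t + D\<close>.\<close>

definition diagonal :: "(vertex \<Rightarrow> 'k vec \<Rightarrow> 'k vec) \<Rightarrow> int \<Rightarrow> int \<Rightarrow> 'k" where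
  "diagonal h D t =
     (if p \<le> t \<and> t \<le> q \<and> p' \<le> t + D \<and> t + D \<le> q'
      then (let v = (THE v. t mod 4 = label v)
            in h v (unit_vec (x v) (inv_into {..<x v} (px v) t)) $ inv_into {..<y v} (py v) (t + D))
      else 0)"

lemma diagonal_out: "\<not> (p \<le> t \<and> t \<le> q \<and> p' \<le> t + D \<and> t + D \<le> q') \<Longrightarrow> diagonal h D t = 0"
  unfolding diagonal_def by auto

lemma diagonal_in:
  assumes j: "j < x v" and i: "i < y v"
  shows "diagonal h (py v i - px v j) (px v j) = h v (unit_vec (x v) j) $ i"
proof -
  have "(THE w. px v j mod 4 = label w) = v"
    using X.pos_range(3)[OF j] label_inject by (intro the_equality) auto
  moreover have "inv_into {..<x v} (px v) (px v j) = j" "inv_into {..<y v} (py v) (py v i) = i"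
    using i j X.pos_bij[of v] Y.pos_bij[of v] by (auto simp: bij_betw_def intro!: inv_into_f_f)
  ultimately show ?thesis
    using X.pos_range[OF j] Y.pos_range[OF i] by (simp add: diagonal_def Let_def)
qed

text \<open>An arrow moves the positions of X and of Y by the same \<open>step a\<close>, so both
  terms belong to the same D, and the coboundary splits by D. Where a neighbour is missing, the
  default 0 of \<open>diagonal\<close> is the correct value.\<close>

lemma coboundary_unit_vec:
  assumes h: "h \<in> carrier vertex_maps" and j: "j < x (source a)" and i: "i < y (target a)"
    and D: "D = py (target a) i - (px (source a) j + step a)"
  shows "coboundary h a (unit_vec (x (source a)) j) $ i =
    diagonal h D (px (source a) j) - diagonal h D (px (source a) j + step a)"
proof -
  let ?e = "unit_vec (x (source a)) j :: 'k vec" and ?t = "px (source a) j"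
  have he: "h (source a) ?e \<in> carrier_vec (y (source a))" using vertex_mapsD(2)[OF h] by simp
  have "map_at Y a (h (source a) ?e) $ i = diagonal h D ?t"
    using i
  proof (cases rule: Y.source_cases)
    case out
    then have "diagonal h D ?t = 0" using D by (intro diagonal_out) auto
    then show ?thesis using Y.map_index_zero[OF he i out] by simp
  next
    case (pos l)
    have "D = py (source a) l - px (source a) j" using D pos by simp
    then show ?thesis
      using Y.map_index[OF he i pos] diagonal_in[OF j pos(1), of h] by simp
  qed
  moreover have "h (target a) (map_at X a ?e) $ i = diagonal h D (?t + step a)"
  proof (cases "p \<le> ?t + step a \<and> ?t + step a \<le> q")
    case True
    have "(?t + step a) mod 4 = label (target a)"
      using X.pos_range(3)[OF j] label_target[of a] by (metis mod_add_left_eq)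
    then obtain l where l: "l < x (target a)" "px (target a) l = ?t + step a"
      using True X.pos_exists by blast
    have "D = py (target a) i - px (target a) l" using D l by simp
    then show ?thesis
      using X.map_unit_vec[OF j l] diagonal_in[OF l(1) i, of h] l(2) by simp
  next
    case False
    have "h (target a) (0\<^sub>v (x (target a))) = 0\<^sub>v (y (target a))"
      using linear_maps_zero[OF vec_vs vec_vs vertex_mapsD(1)[OF h]] by simp
    moreover have "diagonal h D (?t + step a) = 0" using False by (intro diagonal_out) auto
    ultimately show ?thesis using X.map_unit_vec_zero[OF j False] i by simp
  qed
  moreover have "h (target a) (map_at X a ?e) \<in> carrier_vec (y (target a))"
    using vertex_mapsD(2)[OF h] by simp
  ultimately show ?thesis using i by (simp add: coboundary_apply)
qed

lemma four_dvd_positions: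
  assumes "j < x v" "i < y v"
  shows "4 dvd py v i - px v j"
  using X.pos_range(3)[OF assms(1)] Y.pos_range(3)[OF assms(2)]
    mod_eq_dvd_iff[of "py v i" 4 "px v j"] by simp

text \<open>Each translate gives one segment of entries of h, killed by
  \<open>edge_equations_injective\<close>. A translate with empty intersection has no entries, hence
  the premise of \<open>cond\<close>.\<close>

lemma bracket_hom_zero:
  assumes cond: "\<And>s. max p (p' + 4 * s) \<le> min q (q' + 4 * s) \<Longrightarrow>
      left_edge p (p' + 4 * s) \<or> right_edge q (q' + 4 * s)"
    and r: "r + (\<Sum>v\<in>UNIV. x v * y v) = (\<Sum>a\<in>UNIV. x (source a) * y (target a))"
  shows "bracket X Y = (0, r)"
proof -
  have "h = \<zero>\<^bsub>vertex_maps\<^esub>" if "h \<in> rep_hom X Y" for h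
  proof -
    have h: "h \<in> carrier vertex_maps" and d: "coboundary h = \<zero>\<^bsub>cochains\<^esub>"
      using that by (auto simp: rep_hom_eq)
    have zero: "diagonal h D t = 0" if D: "4 dvd D" for D t
    proof -
      \<comment> \<open>\<open>t + D\<close> lies in the second interval exactly when t lies in its
        translate by \<open>- D\<close>; hence the sign.\<close>
      from D obtain s where s: "D = - (4 * s)" by (metis dvdE minus_minus mult_minus_right)
      show ?thesis
      proof (cases "max p (p' + 4 * s) \<le> min q (q' + 4 * s)")
        case False
        then show ?thesis using s by (intro diagonal_out) auto
      next
        case True
        show ?thesis
        proof (rule edge_equations_injective[where G = "diagonal h D" and p = p and q = q
              and p' = "p' + 4 * s" and q' = "q' + 4 * s"])
          show "diagonal h D u = 0" if "\<not> (p \<le> u \<and> u \<le> q \<and> p' + 4 * s \<le> u \<and> u \<le> q' + 4 * s)" for u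
            using that s by (intro diagonal_out) auto
          show "left_edge p (p' + 4 * s) \<or> right_edge q (q' + 4 * s)" using cond[OF True] .
          fix a u assume u: "u mod 4 = label (source a)" "p \<le> u" "u \<le> q"
            "p' + 4 * s \<le> u + step a" "u + step a \<le> q' + 4 * s"
          obtain j where j: "j < x (source a)" "px (source a) j = u" using u X.pos_exists by blast
          have "(u + step a + D) mod 4 = (u + step a) mod 4" using D by presburger
          also have "\<dots> = label (target a)" using u(1) label_target[of a] by (metis mod_add_left_eq)
          finally obtain i where i: "i < y (target a)" "py (target a) i = u + step a + D"
            using u s Y.pos_exists[of "u + step a + D" "target a"] by auto
          have "coboundary h a (unit_vec (x (source a)) j) $ i = 0"
            using i(1) by (simp add: d cochains_apply)
          then show "diagonal h D u = diagonal h D (u + step a)"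
            using coboundary_unit_vec[OF h j(1) i(1), of D] i(2) j(2) by simp
        qed
      qed
    qed
    show ?thesis
      unfolding vertex_maps_def
    proof (rule hom_family_eqI[OF h[unfolded vertex_maps_def] H.M.zero_closed[unfolded vertex_maps_def]])
      fix v z assume z: "z \<in> carrier (module_vec TYPE('k) (x v))"
      show "h v z = \<zero>\<^bsub>hom_family (\<lambda>v. module_vec TYPE('k) (x v)) (\<lambda>v. module_vec TYPE('k) (y v))\<^esub> v z"
        unfolding vertex_maps_def[symmetric]
      proof (rule linear_maps_eq_on_unit_vecs[OF vec_vs vertex_mapsD(1)[OF h] vertex_mapsD(1)[OF H.M.zero_closed]])
        fix j assume j: "j < x v"
        show "h v (unit_vec (x v) j) = \<zero>\<^bsub>vertex_maps\<^esub> v (unit_vec (x v) j)"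
        proof (rule eq_vecI)
          fix i assume "i < dim_vec (\<zero>\<^bsub>vertex_maps\<^esub> v (unit_vec (x v) j))"
          then have i: "i < y v" by (simp add: vertex_maps_apply)
          show "h v (unit_vec (x v) j) $ i = \<zero>\<^bsub>vertex_maps\<^esub> v (unit_vec (x v) j) $ i"
            using diagonal_in[OF j i, of h] zero[OF four_dvd_positions[OF j i]] i
            by (simp add: vertex_maps_apply)
        next
          have "h v (unit_vec (x v) j) \<in> carrier_vec (y v)" using vertex_mapsD(2)[OF h] by simp
          then show "dim_vec (h v (unit_vec (x v) j)) = dim_vec (\<zero>\<^bsub>vertex_maps\<^esub> v (unit_vec (x v) j))"
            by (simp add: vertex_maps_apply)
        qed
      qed (use z in simp)
    qed
  qed
  then have "hom_dim X Y = 0" by (rule hom_dim_zero)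
  then show ?thesis using euler_form r by (simp add: bracket_def)
qed

text \<open>The bound has \<open>+ 1\<close> because adjacent intervals with empty intersection can
  be joined by an arrow: one equation and no unknown.\<close>

lemma bracket_ext_zero:
  assumes cond: "\<And>s. left_edge p (p' + 4 * s) \<Longrightarrow> right_edge q (q' + 4 * s) \<Longrightarrow>
      \<not> max p (p' + 4 * s) \<le> min q (q' + 4 * s) + 1"
    and r: "r + (\<Sum>a\<in>UNIV. x (source a) * y (target a)) = (\<Sum>v\<in>UNIV. x v * y v)"
  shows "bracket X Y = (r, 0)"
proof -
  have "\<exists>h \<in> carrier vertex_maps. coboundary h = c" if c: "c \<in> carrier cochains" for c
  proof -
    \<comment> \<open>The coefficient of c from the basis vector of X at t to that of Y at
      \<open>t + step a + D\<close>.\<close>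
    define C where "C D a t = c a (unit_vec (x (source a)) (inv_into {..<x (source a)} (px (source a)) t)) $
        inv_into {..<y (target a)} (py (target a)) (t + step a + D)" for D a t
    let ?P = "\<lambda>D G. (\<forall>t. \<not> (p \<le> t \<and> t \<le> q \<and> p' \<le> t + D \<and> t + D \<le> q') \<longrightarrow> G t = 0) \<and>
        (\<forall>a t. t mod 4 = label (source a) \<longrightarrow> p \<le> t \<longrightarrow> t \<le> q \<longrightarrow> p' \<le> t + step a + D \<longrightarrow>
          t + step a + D \<le> q' \<longrightarrow> G t - G (t + step a) = C D a t)"
    have "\<exists>G. ?P D G" if D: "4 dvd D" for D
    proof -
      from D obtain s where s: "D = - (4 * s)" by (metis dvdE minus_minus mult_minus_right)
      obtain G where "\<And>t. \<not> (p \<le> t \<and> t \<le> q \<and> p' + 4 * s \<le> t \<and> t \<le> q' + 4 * s) \<Longrightarrow> G t = 0"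
        and "\<And>a t. t mod 4 = label (source a) \<Longrightarrow> p \<le> t \<Longrightarrow> t \<le> q \<Longrightarrow>
          p' + 4 * s \<le> t + step a \<Longrightarrow> t + step a \<le> q' + 4 * s \<Longrightarrow> G t - G (t + step a) = C D a t"
        using edge_equations_surjective[of p "p' + 4 * s" q "q' + 4 * s" "C D"] cond[of s] by blast
      then show ?thesis using s by (intro exI[of _ G]) auto
    qed
    \<comment> \<open>The systems for different D share no unknowns, so their solutions can be
      chosen independently.\<close>
    then have "\<exists>G. \<forall>D. 4 dvd D \<longrightarrow> ?P D (G D)"
      by (intro choice) blast
    then obtain G where G: "\<forall>D. 4 dvd D \<longrightarrow> ?P D (G D)" by (rule exE)
    note out = G[rule_format, THEN conjunct1, rule_format]
      and edge = G[rule_format, THEN conjunct2, rule_format]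
    \<comment> \<open>The matrix entries are filled in so that \<open>diagonal h D\<close> becomes
      \<open>G D\<close> for every multiple D of 4.\<close>
    define h where "h v = matrix_map (x v) (y v) (\<lambda>j i. G (py v i - px v j) (px v j))" for v
    have h: "h \<in> carrier vertex_maps"
      by (rule vertex_mapsI) (simp_all add: h_def matrix_map_linear, simp add: matrix_map_def)
    have diag: "diagonal h D t = G D t" if D: "4 dvd D" for D t
    proof (cases "p \<le> t \<and> t \<le> q \<and> p' \<le> t + D \<and> t + D \<le> q'")
      case True
      obtain v where v: "t mod 4 = label v" using label_exists by blast
      then obtain j where j: "j < x v" "px v j = t" using True X.pos_exists by blast
      have "(t + D) mod 4 = t mod 4" using D by presburger
      then have "(t + D) mod 4 = label v" using v by simp
      then obtain i where i: "i < y v" "py v i = t + D" using True Y.pos_exists by blast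
      show ?thesis
        using diagonal_in[OF j(1) i(1), of h] j i by (simp add: h_def matrix_map_unit_vec)
    next
      case False
      then show ?thesis using out[OF D] diagonal_out by metis
    qed
    have "coboundary h = c"
    proof (rule cochains_eqI[OF coboundary_closed[OF h] c])
      fix a and z :: "'k vec" assume z: "z \<in> carrier_vec (x (source a))"
      show "coboundary h a z = c a z"
      proof (rule linear_maps_eq_on_unit_vecs[OF vec_vs cochainsD(1)[OF coboundary_closed[OF h]]
            cochainsD(1)[OF c] _ z])
        fix j assume j: "j < x (source a)"
        let ?e = "unit_vec (x (source a)) j :: 'k vec"
        have e: "?e \<in> carrier_vec (x (source a))" by simp
        note cl = cochainsD(2)[OF coboundary_closed[OF h] e] cochainsD(2)[OF c e]
        show "coboundary h a ?e = c a ?e"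
        proof (rule eq_vecI)
          fix i assume "i < dim_vec (c a ?e)"
          then have i: "i < y (target a)" using cl by simp
          define D where "D = py (target a) i - (px (source a) j + step a)"
          have "(px (source a) j + step a) mod 4 = label (target a)"
            using X.pos_range(3)[OF j] label_target[of a] by (metis mod_add_left_eq)
          then have D: "4 dvd D"
            using Y.pos_range(3)[OF i]
              mod_eq_dvd_iff[of "py (target a) i" 4 "px (source a) j + step a"] by (simp add: D_def)
          have "inv_into {..<x (source a)} (px (source a)) (px (source a) j) = j"
            "inv_into {..<y (target a)} (py (target a)) (py (target a) i) = i"
            using i j X.pos_bij[of "source a"] Y.pos_bij[of "target a"]
            by (auto simp: bij_betw_def intro!: inv_into_f_f)
          then have "C D a (px (source a) j) = c a ?e $ i" by (simp add: C_def D_def)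
          then show "coboundary h a ?e $ i = c a ?e $ i"
            using coboundary_unit_vec[OF h j i D_def] X.pos_range[OF j] Y.pos_range[OF i]
              edge[OF D, of "px (source a) j" a]
            by (simp add: diag[OF D], simp add: D_def)
        qed (use cl in simp)
      qed
    qed
    with h show ?thesis by blast
  qed
  then have "ext_dim X Y = 0" by (rule ext_dim_zero)
  then show ?thesis using euler_form r by (simp add: bracket_def)
qed

end

section \<open>The exceptional representations as intervals\<close>

text \<open>The bounds make a the first position of its class from p on, and a + 4n the first one
  beyond q. For n = 0 both are a, and the class misses the interval.\<close>

lemma bij_betw_residue_up:
  assumes "a mod 4 = l" "a - 4 < p" "p \<le> a" "a + 4 * int n - 4 \<le> q" "q < a + 4 * int n"
  shows "bij_betw (\<lambda>j. a + 4 * int j) {..<n} {t. p \<le> t \<and> t \<le> q \<and> t mod 4 = l}"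
proof (rule bij_betwI')
  fix t assume "t \<in> {t. p \<le> t \<and> t \<le> q \<and> t mod 4 = l}"
  then have t: "p \<le> t" "t \<le> q" "t mod 4 = a mod 4" using assms by auto
  then obtain d where d: "t - a = 4 * d" by (metis mod_eq_dvd_iff dvdE)
  then have "0 \<le> d" "d < int n" using t assms by linarith+
  then show "\<exists>j \<in> {..<n}. t = a + 4 * int j"
    using d by (intro bexI[of _ "nat d"]) auto
next
  fix j assume "j \<in> {..<n}"
  then have "int j + 1 \<le> int n" by simp
  then show "a + 4 * int j \<in> {t. p \<le> t \<and> t \<le> q \<and> t mod 4 = l}" using assms by simp
qed simp

lemma bij_betw_residue_down:
  assumes "a mod 4 = l" "q < a + 4" "a \<le> q" "p \<le> a - 4 * int n + 4" "a - 4 * int n < p"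
  shows "bij_betw (\<lambda>j. a - 4 * int j) {..<n} {t. p \<le> t \<and> t \<le> q \<and> t mod 4 = l}"
proof (rule bij_betwI')
  fix t assume "t \<in> {t. p \<le> t \<and> t \<le> q \<and> t mod 4 = l}"
  then have t: "p \<le> t" "t \<le> q" "a mod 4 = t mod 4" using assms by auto
  then obtain d where d: "a - t = 4 * d" by (metis mod_eq_dvd_iff dvdE)
  then have "0 \<le> d" "d < int n" using t assms by linarith+
  then show "\<exists>j \<in> {..<n}. t = a - 4 * int j"
    using d by (intro bexI[of _ "nat d"]) auto
next
  fix j assume "j \<in> {..<n}"
  then have "int j + 1 \<le> int n" by simp
  moreover have "(a - 4 * int j) mod 4 = a mod 4" by presburger
  ultimately show "a - 4 * int j \<in> {t. p \<le> t \<and> t \<le> q \<and> t mod 4 = l}" using assms by simp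
qed simp

lemma all_vertex: "(\<forall>v. P v) \<longleftrightarrow> P Vb \<and> P Vminus \<and> P Vplus \<and> P Ve"
  by (metis vertex.exhaust)

lemma module_vec_type: "module_vec k n = module_vec k' n"
  by (simp add: module_vec_def)

lemma coord_rep_space:
  fixes k :: "'k::field itself"
  shows "space_at (coord_rep k (nb, nm, np, ne) fs) v = module_vec TYPE('k) (case_vertex nb nm np ne v)"
  by (cases fs) (simp add: coord_rep_def module_vec_type[of k _ "TYPE('k)"])

lemma coord_rep_map:
  "map_at (coord_rep k (nb, nm, np, ne) (f, g, p, q)) b_to_plus = f"
  "map_at (coord_rep k (nb, nm, np, ne) (f, g, p, q)) plus_to_e = g"
  "map_at (coord_rep k (nb, nm, np, ne) (f, g, p, q)) b_to_minus = p"
  "map_at (coord_rep k (nb, nm, np, ne) (f, g, p, q)) minus_to_e = q"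
  by (simp_all add: coord_rep_def)

lemma four_times_int_eq [simp]:
  "4 * int j = 4 + 4 * int i \<longleftrightarrow> j = Suc i" "4 + 4 * int i = 4 * int j \<longleftrightarrow> j = Suc i"
  by auto

lemmas interval_rep_simps = all_vertex all_arrow coord_rep_space coord_rep_map
  pi_plus_def pi_minus_def j_plus_def j_minus_def

lemma interval_rep_upI:
  fixes V :: "'k::field vrep"
  assumes "\<forall>v. space_at V v = module_vec TYPE('k) (n v)"
    and "\<forall>v. a v mod 4 = label v \<and> a v - 4 < p \<and> p \<le> a v \<and>
      a v + 4 * int (n v) - 4 \<le> q \<and> q < a v + 4 * int (n v)"
    and "\<forall>b. \<forall>z \<in> carrier_vec (n (source b)).
      map_at V b z \<in> carrier_vec (n (target b)) \<and>
      (\<forall>i < n (target b).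
        (\<forall>j < n (source b). a (source b) + 4 * int j + step b = a (target b) + 4 * int i \<longrightarrow>
          map_at V b z $ i = z $ j) \<and>
        (a (target b) + 4 * int i - step b \<notin> {p..q} \<longrightarrow> map_at V b z $ i = 0))"
  shows "interval_rep V n (\<lambda>v j. a v + 4 * int j) p q"
  unfolding interval_rep_def using assms by (auto intro!: bij_betw_residue_up)

text \<open>One turn b, +, e, -, b raises the position by 4. It raises the coordinate number by 1 in
  the families built from \<open>pi_plus\<close> and \<open>pi_minus\<close>, and lowers it by 1 in
  those built from \<open>j_plus\<close> and \<open>j_minus\<close>; the latter are therefore
  numbered downwards.\<close>

lemma interval_rep_downI:
  fixes V :: "'k::field vrep"
  assumes "\<forall>v. space_at V v = module_vec TYPE('k) (n v)"
    and "\<forall>v. a v mod 4 = label v \<and> q < a v + 4 \<and> a v \<le> q \<and>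
      p \<le> a v - 4 * int (n v) + 4 \<and> a v - 4 * int (n v) < p"
    and "\<forall>b. \<forall>z \<in> carrier_vec (n (source b)).
      map_at V b z \<in> carrier_vec (n (target b)) \<and>
      (\<forall>i < n (target b).
        (\<forall>j < n (source b). a (source b) - 4 * int j + step b = a (target b) - 4 * int i \<longrightarrow>
          map_at V b z $ i = z $ j) \<and>
        (a (target b) - 4 * int i - step b \<notin> {p..q} \<longrightarrow> map_at V b z $ i = 0))"
  shows "interval_rep V n (\<lambda>v j. a v - 4 * int j) p q"
  unfolding interval_rep_def using assms by (auto intro!: bij_betw_residue_down)

text \<open>In the eight families coordinate 0 at b sits at position 0. Coordinate 0 at - then sits
  at -1 if the arrow from b to - is the identity, and at 3 if that arrow shifts the
  numbering.\<close>

lemma E1_interval: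
  "interval_rep (E1 k m) (case_vertex (m + 1) m m m) (\<lambda>v j. case_vertex 0 3 1 2 v + 4 * int j) (0) (4 * int m)"
  by (rule interval_rep_upI) (auto simp: E1_def interval_rep_simps split: nat.splits)

lemma E2_interval:
  "interval_rep (E2 k m) (case_vertex m (m + 1) (m + 1) (m + 1)) (\<lambda>v j. case_vertex 0 3 1 2 v - 4 * int j) (1 - 4 * int m) (3)"
  by (rule interval_rep_downI) (auto simp: E2_def interval_rep_simps split: nat.splits)

lemma E3_interval:
  "interval_rep (E3 k m) (case_vertex m m m (m + 1)) (\<lambda>v j. case_vertex 0 (-1) 1 2 v - 4 * int j) (2 - 4 * int m) (2)"
  by (rule interval_rep_downI) (auto simp: E3_def interval_rep_simps split: nat.splits)

lemma E4_interval:
  "interval_rep (E4 k m) (case_vertex (m + 1) (m + 1) (m + 1) m) (\<lambda>v j. case_vertex 0 (-1) 1 2 v + 4 * int j) (-1) (4 * int m + 1)"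
  by (rule interval_rep_upI) (auto simp: E4_def interval_rep_simps split: nat.splits)

lemma E5_interval:
  "interval_rep (E5 k m) (case_vertex m (m + 1) m (m + 1)) (\<lambda>v j. case_vertex 0 3 1 2 v - 4 * int j) (2 - 4 * int m) (3)"
  by (rule interval_rep_downI) (auto simp: E5_def interval_rep_simps split: nat.splits)

lemma E6_interval:
  "interval_rep (E6 k m) (case_vertex (m + 1) m (m + 1) m) (\<lambda>v j. case_vertex 0 3 1 2 v + 4 * int j) (0) (4 * int m + 1)"
  by (rule interval_rep_upI) (auto simp: E6_def interval_rep_simps split: nat.splits)

lemma E7_interval:
  "interval_rep (E7 k m) (case_vertex (m + 1) (m + 1) m m) (\<lambda>v j. case_vertex 0 (-1) 1 2 v + 4 * int j) (-1) (4 * int m)"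
  by (rule interval_rep_upI) (auto simp: E7_def interval_rep_simps split: nat.splits)

lemma E8_interval:
  "interval_rep (E8 k m) (case_vertex m m (m + 1) (m + 1)) (\<lambda>v j. case_vertex 0 (-1) 1 2 v - 4 * int j) (1 - 4 * int m) (2)"
  by (rule interval_rep_downI) (auto simp: E8_def interval_rep_simps split: nat.splits)

text \<open>At a vertex with zero space the offset is a dummy: the first position of the right
  residue after the interval, as the bounds for n = 0 require. The same holds for the next three
  lemmas.\<close>

lemma F_plus_interval:
  "interval_rep (F_plus k) (case_vertex 0 0 1 0) (\<lambda>v j. case_vertex 4 3 1 2 v + 4 * int j) (1) (1)"
  by (rule interval_rep_upI) (auto simp: F_plus_def interval_rep_simps split: nat.splits)

lemma F_minus_interval:
  "interval_rep (F_minus k) (case_vertex 0 1 0 0) (\<lambda>v j. case_vertex 4 3 5 6 v + 4 * int j) (3) (3)"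
  by (rule interval_rep_upI) (auto simp: F_minus_def interval_rep_simps split: nat.splits)

lemma G_plus_interval:
  "interval_rep (G_plus k) (case_vertex 1 0 1 1) (\<lambda>v j. case_vertex 0 3 1 2 v + 4 * int j) (0) (2)"
  by (rule interval_rep_upI) (auto simp: G_plus_def interval_rep_simps split: nat.splits)

text \<open>The arrows from b through - to e point down, so b is placed at 4, above - at 3 and e at
  2.\<close>

lemma G_minus_interval:
  "interval_rep (G_minus k) (case_vertex 1 1 0 1) (\<lambda>v j. case_vertex 4 3 5 2 v + 4 * int j) (2) (4)"
  by (rule interval_rep_upI) (auto simp: G_minus_def interval_rep_simps split: nat.splits)

section \<open>The table of dimensions\<close>

lemma bracket_hom_zeroI:
  assumes "interval_rep X x px p q" "interval_rep Y y py p' q'"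
    and "\<And>s. p \<le> q' + 4 * s \<Longrightarrow> p' + 4 * s \<le> q \<Longrightarrow>
      left_edge p (p' + 4 * s) \<or> right_edge q (q' + 4 * s)"
    and "r + (x Vb * y Vb + x Vminus * y Vminus + x Vplus * y Vplus + x Ve * y Ve) =
      x Vb * y Vplus + x Vplus * y Ve + x Vb * y Vminus + x Vminus * y Ve"
  shows "bracket X Y = (0, r)"
proof -
  interpret interval_modules X Y x y px py p q p' q'
    using assms(1,2) by (simp add: interval_modules_def interval_module_def)
  show ?thesis
    using assms(3,4) by (intro bracket_hom_zero) (auto simp: UNIV_vertex UNIV_arrow add.assoc)
qed

lemma bracket_ext_zeroI:
  assumes "interval_rep X x px p q" "interval_rep Y y py p' q'"
    and "\<And>s. p \<le> q' + 4 * s + 1 \<Longrightarrow> p' + 4 * s \<le> q + 1 \<Longrightarrow>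
      \<not> (left_edge p (p' + 4 * s) \<and> right_edge q (q' + 4 * s))"
    and "r + (x Vb * y Vplus + x Vplus * y Ve + x Vb * y Vminus + x Vminus * y Ve) =
      x Vb * y Vb + x Vminus * y Vminus + x Vplus * y Vplus + x Ve * y Ve"
  shows "bracket X Y = (r, 0)"
proof -
  interpret interval_modules X Y x y px py p q p' q'
    using assms(1,2) by (simp add: interval_modules_def interval_module_def)
  show ?thesis
    using assms(3,4) by (intro bracket_ext_zero) (auto simp: UNIV_vertex UNIV_arrow add.assoc)
qed

lemma E_rep_simps:
  "E_rep k 1 = E1 k" "E_rep k 2 = E2 k" "E_rep k 3 = E3 k" "E_rep k 4 = E4 k"
  "E_rep k 5 = E5 k" "E_rep k 6 = E6 k" "E_rep k 7 = E7 k" "E_rep k 8 = E8 k"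
  by (simp_all add: fun_eq_iff E_rep_def)

lemmas intervals = E1_interval E2_interval E3_interval E4_interval E5_interval E6_interval
  E7_interval E8_interval F_plus_interval F_minus_interval G_plus_interval G_minus_interval

text \<open>Translation by a multiple of 4 keeps residues. For the given intervals the residues
  become numerals, and only linear inequalities in s, m and n remain.\<close>

lemma edge_shift:
  "left_edge p (p' + 4 * s) \<longleftrightarrow> (p < p' + 4 * s \<and> (p' mod 4 = 1 \<or> p' mod 4 = 2)) \<or> (p' + 4 * s < p \<and> (p mod 4 = 3 \<or> p mod 4 = 0))"
  "right_edge q (q' + 4 * s) \<longleftrightarrow> (q' + 4 * s < q \<and> (q' mod 4 = 2 \<or> q' mod 4 = 3)) \<or> (q < q' + 4 * s \<and> (q mod 4 = 0 \<or> q mod 4 = 1))"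
  by (simp_all add: left_edge_def right_edge_def)

lemma diff_four_times_mod: "(c - 4 * x) mod 4 = (c mod 4 :: int)" "(4 * x + c) mod 4 = c mod 4"
  by presburger+

lemma ball_insert: "(\<forall>z \<in> insert a A. P z) \<longleftrightarrow> P a \<and> (\<forall>z \<in> A. P z)"
  "(\<forall>z \<in> {}. P z) \<longleftrightarrow> True"
  by auto

theorem proposition2p5:
  fixes k :: "'k::alg_closed_field itself"
  shows "
    (\<forall>i\<in>{1,4,6,7}. \<forall>m n. n < m \<longrightarrow>
        bracket (E_rep k i m) (E_rep k i n) = (1 + m - n, 0) \<and> bracket (E_rep k i n) (E_rep k i m) = (0, m - n - 1)) \<and>
    (\<forall>i\<in>{2,3,5,8}. \<forall>m n. m < n \<longrightarrow>
        bracket (E_rep k i m) (E_rep k i n) = (1 + n - m, 0) \<and> bracket (E_rep k i n) (E_rep k i m) = (0, n - m - 1)) \<and>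

    (\<forall>m n.
      bracket (E_rep k 1 m) (E_rep k 2 n) = (0, 2 + n + m) \<and> bracket (E_rep k 2 n) (E_rep k 1 m) = (m + n, 0) \<and>
      bracket (E_rep k 1 m) (E_rep k 3 n) = (0, n + m) \<and> bracket (E_rep k 3 n) (E_rep k 1 m) = (m + n, 0) \<and>
      bracket (E_rep k 1 m) (E_rep k 5 n) = (0, n + m + 1) \<and> bracket (E_rep k 5 n) (E_rep k 1 m) = (n + m, 0) \<and>
      bracket (E_rep k 1 m) (E_rep k 8 n) = (0, n + m + 1) \<and> bracket (E_rep k 8 n) (E_rep k 1 m) = (n + m, 0) \<and>
      bracket (E_rep k 2 m) (E_rep k 4 n) = (2 + m + n, 0) \<and> bracket (E_rep k 4 n) (E_rep k 2 m) = (0, n + m + 2) \<and>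
      bracket (E_rep k 2 m) (E_rep k 6 n) = (1 + m + n, 0) \<and> bracket (E_rep k 6 n) (E_rep k 2 m) = (0, n + m + 2) \<and>
      bracket (E_rep k 2 m) (E_rep k 7 n) = (1 + m + n, 0) \<and> bracket (E_rep k 7 n) (E_rep k 2 m) = (0, n + m + 2) \<and>
      bracket (E_rep k 3 m) (E_rep k 4 n) = (m + n, 0) \<and> bracket (E_rep k 4 n) (E_rep k 3 m) = (0, n + m + 2) \<and>
      bracket (E_rep k 3 m) (E_rep k 6 n) = (m + n, 0) \<and> bracket (E_rep k 6 n) (E_rep k 3 m) = (0, n + m + 1) \<and>
      bracket (E_rep k 3 m) (E_rep k 7 n) = (m + n, 0) \<and> bracket (E_rep k 7 n) (E_rep k 3 m) = (0, n + m + 1) \<and>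
      bracket (E_rep k 4 m) (E_rep k 5 n) = (0, 2 + m + n) \<and> bracket (E_rep k 5 n) (E_rep k 4 m) = (1 + m + n, 0) \<and>
      bracket (E_rep k 4 m) (E_rep k 8 n) = (0, 2 + m + n) \<and> bracket (E_rep k 8 n) (E_rep k 4 m) = (1 + m + n, 0) \<and>
      bracket (E_rep k 5 m) (E_rep k 6 n) = (m + n, 0) \<and> bracket (E_rep k 6 n) (E_rep k 5 m) = (0, 2 + m + n) \<and>
      bracket (E_rep k 5 m) (E_rep k 7 n) = (1 + m + n, 0) \<and> bracket (E_rep k 7 n) (E_rep k 5 m) = (0, 1 + m + n) \<and>
      bracket (E_rep k 6 m) (E_rep k 8 n) = (0, 1 + m + n) \<and> bracket (E_rep k 8 n) (E_rep k 6 m) = (1 + m + n, 0) \<and>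
      bracket (E_rep k 7 m) (E_rep k 8 n) = (0, 2 + m + n) \<and> bracket (E_rep k 8 n) (E_rep k 7 m) = (m + n, 0)) \<and>

    (\<forall>m n. n < m \<longrightarrow>
        bracket (E_rep k 1 m) (E_rep k 4 n) = (m - n - 1, 0) \<and> bracket (E_rep k 4 n) (E_rep k 1 m) = (0, m - n - 1)) \<and>
    (\<forall>m n. m \<le> n \<longrightarrow>
        bracket (E_rep k 1 m) (E_rep k 4 n) = (0, n - m + 1) \<and> bracket (E_rep k 4 n) (E_rep k 1 m) = (n - m + 1, 0)) \<and>
    (\<forall>i\<in>{6,7}. \<forall>m n. n < m \<longrightarrow>
        bracket (E_rep k 1 m) (E_rep k i n) = (m - n, 0) \<and> bracket (E_rep k i n) (E_rep k 1 m) = (0, m - n - 1)) \<and>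
    (\<forall>i\<in>{6,7}. \<forall>m n. m \<le> n \<longrightarrow>
        bracket (E_rep k 1 m) (E_rep k i n) = (0, n - m) \<and> bracket (E_rep k i n) (E_rep k 1 m) = (n - m + 1, 0)) \<and>
    (\<forall>m n. n \<le> m \<longrightarrow>
        bracket (E_rep k 2 m) (E_rep k 3 n) = (0, m - n + 1) \<and> bracket (E_rep k 3 n) (E_rep k 2 m) = (m - n + 1, 0)) \<and>
    (\<forall>m n. m < n \<longrightarrow>
        bracket (E_rep k 2 m) (E_rep k 3 n) = (n - m - 1, 0) \<and> bracket (E_rep k 3 n) (E_rep k 2 m) = (0, n - m - 1)) \<and>
    (\<forall>i\<in>{5,8}. \<forall>m n. m < n \<longrightarrow>
        bracket (E_rep k 2 m) (E_rep k i n) = (n - m, 0) \<and> bracket (E_rep k i n) (E_rep k 2 m) = (0, n - m - 1)) \<and>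
    (\<forall>i\<in>{5,8}. \<forall>m n. n \<le> m \<longrightarrow>
        bracket (E_rep k 2 m) (E_rep k i n) = (0, m - n) \<and> bracket (E_rep k i n) (E_rep k 2 m) = (m - n + 1, 0)) \<and>
    (\<forall>i\<in>{5,8}. \<forall>m n. m \<le> n \<longrightarrow>
        bracket (E_rep k 3 m) (E_rep k i n) = (n - m + 1, 0) \<and> bracket (E_rep k i n) (E_rep k 3 m) = (0, n - m)) \<and>
    (\<forall>i\<in>{5,8}. \<forall>m n. n < m \<longrightarrow>
        bracket (E_rep k 3 m) (E_rep k i n) = (0, m - n - 1) \<and> bracket (E_rep k i n) (E_rep k 3 m) = (m - n, 0)) \<and>
    (\<forall>i\<in>{6,7}. \<forall>m n. m < n \<longrightarrow>
        bracket (E_rep k 4 m) (E_rep k i n) = (0, n - m - 1) \<and> bracket (E_rep k i n) (E_rep k 4 m) = (n - m, 0)) \<and>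
    (\<forall>i\<in>{6,7}. \<forall>m n. n \<le> m \<longrightarrow>
        bracket (E_rep k 4 m) (E_rep k i n) = (1 + m - n, 0) \<and> bracket (E_rep k i n) (E_rep k 4 m) = (0, m - n)) \<and>
    (\<forall>m n. m \<le> n \<longrightarrow>
        bracket (E_rep k 5 m) (E_rep k 8 n) = (n - m, 0) \<and> bracket (E_rep k 8 n) (E_rep k 5 m) = (0, n - m)) \<and>
    (\<forall>m n. n \<le> m \<longrightarrow>
        bracket (E_rep k 5 m) (E_rep k 8 n) = (0, m - n) \<and> bracket (E_rep k 8 n) (E_rep k 5 m) = (m - n, 0)) \<and>
    (\<forall>m n. n \<le> m \<longrightarrow>
        bracket (E_rep k 6 m) (E_rep k 7 n) = (m - n, 0) \<and> bracket (E_rep k 7 n) (E_rep k 6 m) = (0, m - n)) \<and>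
    (\<forall>m n. m \<le> n \<longrightarrow>
        bracket (E_rep k 6 m) (E_rep k 7 n) = (0, n - m) \<and> bracket (E_rep k 7 n) (E_rep k 6 m) = (n - m, 0)) \<and>

    (\<forall>F\<in>{F_plus k, F_minus k}. \<forall>m.
      bracket F (E_rep k 1 m) = (0, 0) \<and> bracket (E_rep k 1 m) F = (0, 1) \<and>
      bracket F (E_rep k 2 m) = (0, 0) \<and> bracket (E_rep k 2 m) F = (1, 0) \<and>
      bracket F (E_rep k 3 m) = (0, 1) \<and> bracket (E_rep k 3 m) F = (0, 0) \<and>
      bracket F (E_rep k 4 m) = (1, 0) \<and> bracket (E_rep k 4 m) F = (0, 0)) \<and>
    (\<forall>m.
      bracket (F_plus k) (E_rep k 5 m) = (0, 1) \<and> bracket (E_rep k 5 m) (F_plus k) = (0, 0) \<and>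
      bracket (F_minus k) (E_rep k 5 m) = (0, 0) \<and> bracket (E_rep k 5 m) (F_minus k) = (1, 0) \<and>
      bracket (F_plus k) (E_rep k 6 m) = (1, 0) \<and> bracket (E_rep k 6 m) (F_plus k) = (0, 0) \<and>
      bracket (F_minus k) (E_rep k 6 m) = (0, 0) \<and> bracket (E_rep k 6 m) (F_minus k) = (0, 1) \<and>
      bracket (F_plus k) (E_rep k 7 m) = (0, 0) \<and> bracket (E_rep k 7 m) (F_plus k) = (0, 1) \<and>
      bracket (F_minus k) (E_rep k 7 m) = (1, 0) \<and> bracket (E_rep k 7 m) (F_minus k) = (0, 0) \<and>
      bracket (F_plus k) (E_rep k 8 m) = (0, 0) \<and> bracket (E_rep k 8 m) (F_plus k) = (1, 0) \<and>
      bracket (F_minus k) (E_rep k 8 m) = (0, 1) \<and> bracket (E_rep k 8 m) (F_minus k) = (0, 0)) \<and>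
    (\<forall>G\<in>{G_plus k, G_minus k}. \<forall>m.
      bracket G (E_rep k 1 m) = (1, 0) \<and> bracket (E_rep k 1 m) G = (0, 0) \<and>
      bracket G (E_rep k 2 m) = (0, 1) \<and> bracket (E_rep k 2 m) G = (0, 0) \<and>
      bracket G (E_rep k 3 m) = (0, 0) \<and> bracket (E_rep k 3 m) G = (1, 0) \<and>
      bracket G (E_rep k 4 m) = (0, 0) \<and> bracket (E_rep k 4 m) G = (0, 1)) \<and>
    (\<forall>m.
      bracket (G_plus k) (E_rep k 5 m) = (0, 1) \<and> bracket (E_rep k 5 m) (G_plus k) = (0, 0) \<and>
      bracket (G_minus k) (E_rep k 5 m) = (0, 0) \<and> bracket (E_rep k 5 m) (G_minus k) = (1, 0) \<and>
      bracket (G_plus k) (E_rep k 6 m) = (1, 0) \<and> bracket (E_rep k 6 m) (G_plus k) = (0, 0) \<and>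
      bracket (G_minus k) (E_rep k 6 m) = (0, 0) \<and> bracket (E_rep k 6 m) (G_minus k) = (0, 1) \<and>
      bracket (G_plus k) (E_rep k 7 m) = (0, 0) \<and> bracket (E_rep k 7 m) (G_plus k) = (0, 1) \<and>
      bracket (G_minus k) (E_rep k 7 m) = (1, 0) \<and> bracket (E_rep k 7 m) (G_minus k) = (0, 0) \<and>
      bracket (G_plus k) (E_rep k 8 m) = (0, 0) \<and> bracket (E_rep k 8 m) (G_plus k) = (1, 0) \<and>
      bracket (G_minus k) (E_rep k 8 m) = (0, 1) \<and> bracket (E_rep k 8 m) (G_minus k) = (0, 0)) \<and>

    bracket (F_plus k) (G_minus k) = (0, 1) \<and>
    bracket (G_minus k) (F_plus k) = (0, 1) \<and>
    bracket (F_minus k) (G_plus k) = (0, 1) \<and>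
    bracket (G_plus k) (F_minus k) = (0, 1) \<and>
    bracket (F_plus k) (F_minus k) = (0, 0) \<and>
    bracket (F_minus k) (F_plus k) = (0, 0) \<and>
    bracket (F_plus k) (G_plus k) = (0, 0) \<and>
    bracket (G_plus k) (F_plus k) = (0, 0) \<and>
    bracket (F_minus k) (G_minus k) = (0, 0) \<and>
    bracket (G_minus k) (F_minus k) = (0, 0) \<and>
    bracket (G_plus k) (G_minus k) = (0, 0) \<and>
    bracket (G_minus k) (G_plus k) = (0, 0)"
  unfolding ball_insert E_rep_simps
  \<comment> \<open>Each entry is settled by one of the two rules; for the value (0, 0) both match,
    and the second is tried if the first fails. In the Euler form the products of m and n cancel,
    since the dimension vector (1, 1, 1, 1) is isotropic.\<close>
  by (intro conjI allI impI TrueI;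
    ((rule bracket_hom_zeroI, rule intervals, rule intervals,
        (unfold edge_shift, simp add: diff_four_times_mod; presburger?; fail),
        (simp add: algebra_simps; fail | arith))
    | (rule bracket_ext_zeroI, rule intervals, rule intervals,
        (unfold edge_shift, simp add: diff_four_times_mod; presburger?; fail),
        (simp add: algebra_simps; fail | arith))))

end
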